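(* Let $\mathbb{F}$ be a field, let $a$ and $b$ be even positive integers, $n=a+b$ and $\lambda=(a,1^b)$. Then $\operatorname{End}_{\mathscr{H}_n}(S_\lambda)$ is one-dimensional over $\mathbb{F}$, where $\mathscr{H}_n=\mathscr{H}_{\mathbb{F},-1}(\mathfrak{S}_n)$. In particular, $S_\lambda$ is indecomposable.
   Context: The algebra. $\mathbb{F}$ is a field, $q=-1$. $\mathscr{H}_n=\mathscr{H}_{\mathbb{F},-1}(\mathfrak{S}_n)$ is the Iwahori--Hecke algebra: the unital associative $\mathbb{F}$-algebra generated by $T_1,\dots,T_{n-1}$ with relations $(T_i-q)(T_i+1)=0$, $T_iT_j=T_jT_i$ for $|i-j|>1$, $T_iT_{i+1}T_i=T_{i+1}T_iT_{i+1}$. By a theorem of Brundan and Kleshchev it is isomorphic to, and is identified with, the unital associative $\mathbb{F}$-algebra with generators $y_1,\dots,y_n$, $\psi_1,\dots,\psi_{n-1}$, $e(i)$ ($i=(i_1,\dots,i_n)\in\{0,1\}^n$) and relations: $y_1=0$; $e(i)=0$ if $i_1=1$; $e(i)e(j)=\delta_{ij}e(i)$; $\sum_i e(i)=1$; $y_re(i)=e(i)y_r$; $\psi_re(i)=e(s_r\cdot i)\psi_r$, where $s_r\cdot i$ swaps the $r$-th and $(r+1)$-th terms of $i$; $y_sy_r=y_ry_s$; $y_s\psi_r=\psi_ry_s$ if $s\neq r,r+1$; $y_r\psi_re(i)=(\psi_ry_{r+1}-\delta_{i_r,i_{r+1}})e(i)$; $y_{r+1}\psi_re(i)=(\psi_ry_r+\delta_{i_r,i_{r+1}})e(i)$;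 $\psi_s\psi_r=\psi_r\psi_s$ if $s\neq r\pm1$; $\psi_r^2e(i)=0$ if $i_r=i_{r+1}$ and $\psi_r^2e(i)=-(y_r-y_{r+1})^2e(i)$ if $i_r\neq i_{r+1}$; $\psi_r\psi_{r+1}\psi_re(i)=\psi_{r+1}\psi_r\psi_{r+1}e(i)$ if $i_r=i_{r+1}$ or $i_{r+1}=i_{r+2}$; $\psi_r\psi_{r+1}\psi_re(i)=(\psi_{r+1}\psi_r\psi_{r+1}+y_r-2y_{r+1}+y_{r+2})e(i)$ if $i_r\neq i_{r+1}\neq i_{r+2}$. The Specht module. For a hook partition $\lambda=(a,1^b)$ of $n=a+b$, the node in row $r$ and column $c$ has residue $c-r\pmod 2$; $T_\lambda$ is the tableau with $1,\dots,n$ entered consecutively down the columns (so $1,\dots,b+1$ down the first column, then $b+2,\dots,n$ along the rest of the first row), and $i_\lambda\in\{0,1\}^n$ is the sequence whose $k$-th term is the residue of the node containing $k$ in $T_\lambda$. $S_\lambda$ is the left $\mathscr{H}_n$-module generated by $z$ subject to: $y_kz=0$ for all $k$; $e(i)z=\delta_{i,i_\lambda}z$ for all $i$; $\psi_jz=0$ for all $j\neq b+1$; $\psi_1\psi_2\cdots\psi_{b+1}z=0$. *)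

theory Defs
  imports
    "HOL-Library.Poly_Mapping"
    "HOL-Algebra.QuotRing"
    "HOL-Combinatorics.Transposition"
    "Jordan_Normal_Form.VS_Connect"
begin

section \<open>Algebras given by generators and relations\<close>

datatype 'g free_monoid = Word (letters: "'g list")

instantiation free_monoid :: (type) monoid_add
begin

definition zero_free_monoid :: "'a free_monoid" where
  "0 = Word []"

definition plus_free_monoid :: "'a free_monoid \<Rightarrow> 'a free_monoid \<Rightarrow> 'a free_monoid" where
  "u + v = Word (letters u @ letters v)"

instance
  by standard (simp_all add: zero_free_monoid_def plus_free_monoid_def)

end

text \<open>Since \<^typ>\<open>'g free_monoid\<close> is written additively, the library's product on finitely
  supported functions is the convolution product, i.e. the type below is the free associative
  unital algebra on all of \<^typ>\<open>'g\<close>.\<close>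

type_synonym ('g, 'f) free_alg = "'g free_monoid \<Rightarrow>\<^sub>0 'f"

definition scalar :: "'f::field \<Rightarrow> ('g, 'f) free_alg" where
  "scalar c = Poly_Mapping.single 0 c"

definition gen :: "'g \<Rightarrow> ('g, 'f::field) free_alg" where
  "gen g = Poly_Mapping.single (Word [g]) 1"

definition free_algebra :: "'g set \<Rightarrow> ('g, 'f::field) free_alg ring" where
  "free_algebra X = class_ring\<lparr>carrier := {p. \<forall>w \<in> Poly_Mapping.keys p. set (letters w) \<subseteq> X}\<rparr>"

text \<open>The algebra with generators \<open>X\<close> and relations \<open>r = 0\<close> for \<open>r \<in> R\<close>, the canonical map onto
  it from the free algebra, and its structure map as an algebra over the field.\<close>

definition presented_algebra ::
    "'g set \<Rightarrow> ('g, 'f::field) free_alg set \<Rightarrow> ('g, 'f) free_alg set ring" where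
  "presented_algebra X R = free_algebra X Quot (Idl\<^bsub>free_algebra X\<^esub> R)"

definition presented_class ::
    "'g set \<Rightarrow> ('g, 'f::field) free_alg set \<Rightarrow> ('g, 'f) free_alg \<Rightarrow> ('g, 'f) free_alg set" where
  "presented_class X R p = (Idl\<^bsub>free_algebra X\<^esub> R) +>\<^bsub>free_algebra X\<^esub> p"

definition presented_scalar ::
    "'g set \<Rightarrow> ('g, 'f::field) free_alg set \<Rightarrow> 'f \<Rightarrow> ('g, 'f) free_alg set" where
  "presented_scalar X R c = presented_class X R (scalar c)"


section \<open>Left modules over noncommutative rings\<close>

text \<open>The locale \<^locale>\<open>module\<close> requires a commutative ring of scalars, so only the record type and
  the notions not depending on that locale are used here. The record fields \<^const>\<open>mult\<close> and
  \<^const>\<open>one\<close> have no meaning for a module.\<close>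

definition gen_left_ideal :: "('r, 'c) ring_scheme \<Rightarrow> 'r set \<Rightarrow> 'r set" where
  "gen_left_ideal R X =
     \<Inter>{L. additive_subgroup L R \<and> (\<forall>r \<in> carrier R. \<forall>x \<in> L. r \<otimes>\<^bsub>R\<^esub> x \<in> L) \<and> X \<subseteq> L}"

text \<open>The left module generated by one element \<open>z\<close> subject to \<open>x z = 0\<close> for \<open>x \<in> X\<close>, realised as
  the quotient of \<open>R\<close> by the left ideal generated by \<open>X\<close>; the generator \<open>z\<close> is the coset of 1.\<close>

definition cyclic_module :: "('r, 'c) ring_scheme \<Rightarrow> 'r set \<Rightarrow> ('r, 'r set) module" where
  "cyclic_module R X = (let L = gen_left_ideal R X in
     \<lparr>carrier = a_rcosets\<^bsub>R\<^esub> L, mult = undefined, one = undefined, zero = L, add = set_add R,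
      smult = (\<lambda>r C. \<Union>x \<in> C. L +>\<^bsub>R\<^esub> (r \<otimes>\<^bsub>R\<^esub> x))\<rparr>)"

definition pullback_module :: "('s \<Rightarrow> 'r) \<Rightarrow> ('r, 'm) module \<Rightarrow> ('s, 'm) module" where
  "pullback_module \<theta> M =
     \<lparr>carrier = carrier M, mult = mult M, one = one M, zero = zero M, add = add M,
      smult = (\<lambda>s x. \<theta> s \<odot>\<^bsub>M\<^esub> x)\<rparr>"

text \<open>The endomorphisms of the left \<open>R\<close>-module \<open>M\<close>, as a vector space over the field of scalars
  acting through \<open>\<eta>\<close>. Endomorphisms are made extensional, so that they are
  determined by their values on \<^term>\<open>carrier M\<close>.\<close>

definition End_space ::
    "('f \<Rightarrow> 'r) \<Rightarrow> ('r, 'c) ring_scheme \<Rightarrow> ('r, 'm) module \<Rightarrow> ('f, 'm \<Rightarrow> 'm) module" where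
  "End_space \<eta> R M =
     \<lparr>carrier = LinearCombinations.module_hom R M M \<inter> extensional (carrier M),
      mult = compose (carrier M),
      one = (\<lambda>x \<in> carrier M. x),
      zero = (\<lambda>x \<in> carrier M. \<zero>\<^bsub>M\<^esub>),
      add = (\<lambda>f g. \<lambda>x \<in> carrier M. f x \<oplus>\<^bsub>M\<^esub> g x),
      smult = (\<lambda>c f. \<lambda>x \<in> carrier M. \<eta> c \<odot>\<^bsub>M\<^esub> f x)\<rparr>"

definition one_dimensional :: "('f::field, 'v) module \<Rightarrow> bool" where
  "one_dimensional V \<longleftrightarrow> vectorspace class_ring V \<and>
     vectorspace.fin_dim class_ring V \<and> vectorspace.dim class_ring V = 1"

definition indecomposable_module :: "('r, 'c) ring_scheme \<Rightarrow> ('r, 'm) module \<Rightarrow> bool" where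
  "indecomposable_module R M \<longleftrightarrow>
     carrier M \<noteq> {\<zero>\<^bsub>M\<^esub>} \<and>
     \<not> (\<exists>N\<^sub>1 N\<^sub>2. Module.submodule N\<^sub>1 R M \<and> Module.submodule N\<^sub>2 R M \<and>
          N\<^sub>1 \<noteq> {\<zero>\<^bsub>M\<^esub>} \<and> N\<^sub>2 \<noteq> {\<zero>\<^bsub>M\<^esub>} \<and>
          N\<^sub>1 \<inter> N\<^sub>2 = {\<zero>\<^bsub>M\<^esub>} \<and> N\<^sub>1 <+>\<^bsub>M\<^esub> N\<^sub>2 = carrier M)"


section \<open>The Iwahori--Hecke algebra\<close>

inductive_set hecke_rels :: "'f::field \<Rightarrow> nat \<Rightarrow> (nat, 'f) free_alg set"
  for q :: 'f and n :: nat where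
  quadratic: "1 \<le> i \<Longrightarrow> i < n \<Longrightarrow> (gen i - scalar q) * (gen i + 1) \<in> hecke_rels q n"
| commute: "1 \<le> i \<Longrightarrow> i < n \<Longrightarrow> 1 \<le> j \<Longrightarrow> j < n \<Longrightarrow> \<bar>int i - int j\<bar> > 1 \<Longrightarrow>
    gen i * gen j - gen j * gen i \<in> hecke_rels q n"
| braid: "1 \<le> i \<Longrightarrow> i + 1 < n \<Longrightarrow>
    gen i * gen (i + 1) * gen i - gen (i + 1) * gen i * gen (i + 1) \<in> hecke_rels q n"

abbreviation iwahori_hecke :: "'f::field \<Rightarrow> nat \<Rightarrow> (nat, 'f) free_alg set ring" where
  "iwahori_hecke q n \<equiv> presented_algebra {1..<n} (hecke_rels q n)"

abbreviation iwahori_hecke_scalar :: "'f::field \<Rightarrow> nat \<Rightarrow> 'f \<Rightarrow> (nat, 'f) free_alg set" where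
  "iwahori_hecke_scalar q n \<equiv> presented_scalar {1..<n} (hecke_rels q n)"


section \<open>The Brundan--Kleshchev presentation for \<open>q = -1\<close>\<close>

text \<open>Residue sequences \<open>(i\<^sub>1, \<dots>, i\<^sub>n)\<close> are functions on \<open>{1..n}\<close>; they are extensional, so
  that \<open>i \<circ> Transposition.transpose r (r + 1)\<close>, for \<open>1 \<le> r < n\<close>, is again such a sequence.\<close>

definition res_seqs :: "nat \<Rightarrow> (nat \<Rightarrow> nat) set" where
  "res_seqs n = {1..n} \<rightarrow>\<^sub>E {0, 1}"

datatype klr_gen = GenY nat | GenPsi nat | GenE "nat \<Rightarrow> nat"

definition klr_gens :: "nat \<Rightarrow> klr_gen set" where
  "klr_gens n = GenY ` {1..n} \<union> GenPsi ` {1..<n} \<union> GenE ` res_seqs n"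

abbreviation y_el :: "nat \<Rightarrow> (klr_gen, 'f::field) free_alg" where "y_el r \<equiv> gen (GenY r)"
abbreviation psi_el :: "nat \<Rightarrow> (klr_gen, 'f::field) free_alg" where "psi_el r \<equiv> gen (GenPsi r)"
abbreviation e_el :: "(nat \<Rightarrow> nat) \<Rightarrow> (klr_gen, 'f::field) free_alg" where "e_el i \<equiv> gen (GenE i)"

inductive_set klr_rels :: "nat \<Rightarrow> (klr_gen, 'f::field) free_alg set"
  for n :: nat where
  y_one: "y_el 1 \<in> klr_rels n"
| e_one: "i \<in> res_seqs n \<Longrightarrow> i 1 = 1 \<Longrightarrow> e_el i \<in> klr_rels n"
| e_orth: "i \<in> res_seqs n \<Longrightarrow> j \<in> res_seqs n \<Longrightarrow>
    e_el i * e_el j - (if i = j then e_el i else 0) \<in> klr_rels n"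
| e_sum: "(\<Sum>i \<in> res_seqs n. e_el i) - 1 \<in> klr_rels n"
| y_e: "r \<in> {1..n} \<Longrightarrow> i \<in> res_seqs n \<Longrightarrow> y_el r * e_el i - e_el i * y_el r \<in> klr_rels n"
| psi_e: "r \<in> {1..<n} \<Longrightarrow> i \<in> res_seqs n \<Longrightarrow>
    psi_el r * e_el i - e_el (i \<circ> Transposition.transpose r (r + 1)) * psi_el r \<in> klr_rels n"
| y_y: "r \<in> {1..n} \<Longrightarrow> s \<in> {1..n} \<Longrightarrow> y_el s * y_el r - y_el r * y_el s \<in> klr_rels n"
| y_psi_commute: "s \<in> {1..n} \<Longrightarrow> r \<in> {1..<n} \<Longrightarrow> s \<noteq> r \<Longrightarrow> s \<noteq> r + 1 \<Longrightarrow>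
    y_el s * psi_el r - psi_el r * y_el s \<in> klr_rels n"
| y_psi: "r \<in> {1..<n} \<Longrightarrow> i \<in> res_seqs n \<Longrightarrow>
    y_el r * psi_el r * e_el i -
      (psi_el r * y_el (r + 1) - (if i r = i (r + 1) then 1 else 0)) * e_el i
      \<in> klr_rels n"
| y_Suc_psi: "r \<in> {1..<n} \<Longrightarrow> i \<in> res_seqs n \<Longrightarrow>
    y_el (r + 1) * psi_el r * e_el i -
      (psi_el r * y_el r + (if i r = i (r + 1) then 1 else 0)) * e_el i
      \<in> klr_rels n"
| psi_psi: "r \<in> {1..<n} \<Longrightarrow> s \<in> {1..<n} \<Longrightarrow> s \<noteq> r + 1 \<Longrightarrow> r \<noteq> s + 1 \<Longrightarrow>
    psi_el s * psi_el r - psi_el r * psi_el s \<in> klr_rels n"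
| psi_sq_eq: "r \<in> {1..<n} \<Longrightarrow> i \<in> res_seqs n \<Longrightarrow> i r = i (r + 1) \<Longrightarrow>
    (psi_el r)\<^sup>2 * e_el i \<in> klr_rels n"
| psi_sq_neq: "r \<in> {1..<n} \<Longrightarrow> i \<in> res_seqs n \<Longrightarrow> i r \<noteq> i (r + 1) \<Longrightarrow>
    (psi_el r)\<^sup>2 * e_el i - (- ((y_el r - y_el (r + 1))\<^sup>2 * e_el i)) \<in> klr_rels n"
| psi_braid: "1 \<le> r \<Longrightarrow> r + 1 < n \<Longrightarrow> i \<in> res_seqs n \<Longrightarrow>
    i r = i (r + 1) \<or> i (r + 1) = i (r + 2) \<Longrightarrow>
    psi_el r * psi_el (r + 1) * psi_el r * e_el i - psi_el (r + 1) * psi_el r * psi_el (r + 1) * e_el i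
      \<in> klr_rels n"
| psi_braid_neq: "1 \<le> r \<Longrightarrow> r + 1 < n \<Longrightarrow> i \<in> res_seqs n \<Longrightarrow>
    i r \<noteq> i (r + 1) \<Longrightarrow> i (r + 1) \<noteq> i (r + 2) \<Longrightarrow>
    psi_el r * psi_el (r + 1) * psi_el r * e_el i
      - (psi_el (r + 1) * psi_el r * psi_el (r + 1) + y_el r - 2 * y_el (r + 1) + y_el (r + 2)) * e_el i
      \<in> klr_rels n"

abbreviation klr_algebra :: "nat \<Rightarrow> (klr_gen, 'f::field) free_alg set ring" where
  "klr_algebra n \<equiv> presented_algebra (klr_gens n) (klr_rels n)"

abbreviation klr_scalar :: "nat \<Rightarrow> 'f::field \<Rightarrow> (klr_gen, 'f) free_alg set" where
  "klr_scalar n \<equiv> presented_scalar (klr_gens n) (klr_rels n)"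

text \<open>By a theorem of Brundan and Kleshchev the following set is nonempty: the Iwahori--Hecke
  algebra of the symmetric group with \<open>q = -1\<close> is isomorphic to \<^const>\<open>klr_algebra\<close> as an algebra,
  and is identified with it along such an isomorphism.\<close>

definition bk_isos ::
    "nat \<Rightarrow> ((nat, 'f::field) free_alg set \<Rightarrow> (klr_gen, 'f) free_alg set) set" where
  "bk_isos n = {\<theta> \<in> ring_iso (iwahori_hecke (-1) n) (klr_algebra n).
     \<forall>c. \<theta> (iwahori_hecke_scalar (-1) n c) = klr_scalar n c}"


section \<open>Specht modules of hooks\<close>

definition residue :: "nat \<times> nat \<Rightarrow> nat" where
  "residue = (\<lambda>(r, c). nat ((int c - int r) mod 2))"

text \<open>The node (row, column) of the hook \<open>(a, 1\<^sup>b)\<close> containing \<open>k\<close> when \<open>1, 2, \<dots>\<close> are entered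
  consecutively down the columns.\<close>

definition hook_node :: "nat \<Rightarrow> nat \<Rightarrow> nat \<times> nat" where
  "hook_node b k = (if k \<le> b + 1 then (k, 1) else (1, k - b))"

definition hook_res_seq :: "nat \<Rightarrow> nat \<Rightarrow> (nat \<Rightarrow> nat)" where
  "hook_res_seq a b = (\<lambda>k \<in> {1..a + b}. residue (hook_node b k))"

definition specht_rels :: "nat \<Rightarrow> nat \<Rightarrow> (klr_gen, 'f::field) free_alg set" where
  "specht_rels a b =
     {y_el k | k. k \<in> {1..a + b}}
     \<union> {e_el i - (if i = hook_res_seq a b then 1 else 0) | i. i \<in> res_seqs (a + b)}
     \<union> {psi_el j | j. j \<in> {1..<a + b} \<and> j \<noteq> b + 1}
     \<union> {prod_list (map psi_el [1..<b + 2])}"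

definition specht_hook ::
    "nat \<Rightarrow> nat \<Rightarrow> ((klr_gen, 'f::field) free_alg set, (klr_gen, 'f) free_alg set set) module" where
  "specht_hook a b = cyclic_module (klr_algebra (a + b))
     (presented_class (klr_gens (a + b)) (klr_rels (a + b)) ` specht_rels a b)"

end

theory Submission
  imports Defs
begin

text \<open>Since \<open>n\<close> is even and \<open>i\<^sub>\<lambda> = (0, 1, 0, 1, \<dots>)\<close>, we group the positions \<open>2, \<dots>, n + 1\<close> into
  slots \<open>{2m, 2m + 1}\<close>. A tableau of the hook is a word in the letters \<open>L\<close> (leg) and \<open>A\<close> (arm), with
  an additional letter \<open>A\<close> at the position \<open>n + 1\<close>. The residue sequence of a word tells exactly which of
  its slots are pure, that is \<open>LL\<close> or \<open>AA\<close>, and the Brundan--Kleshchev algebra acts on the span of all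
  words by operators that only involve one or two adjacent slots: \<open>\<psi>\<^bsub>2m\<^esub>\<close>, \<open>y\<^bsub>2m\<^esub>\<close> and
  \<open>y\<^bsub>2m+1\<^esub>\<close> generate the \<open>2 \<times> 2\<close> matrices on the mixed states of slot \<open>m\<close>, and \<open>\<psi>\<^bsub>2m+1\<^esub>\<close> is built
  from a symplectic form on the span of \<open>LL\<close> and \<open>AA\<close>.

  This representation contains a vector satisfying the relations of \<open>z\<close>. Conversely, modulo shorter
  products the \<open>\<psi>\<^sub>r\<close> satisfy the relations of the nilCoxeter algebra, so the Specht module is spanned by
  one element \<open>\<psi>\<^sub>T z\<close> for each tableau \<open>T\<close>. Their images in the representation are
  unitriangular with respect to the basis of words, so the Specht module embeds into it.

  An endomorphism maps \<open>z\<close> to a combination of pure words that is killed by \<open>\<psi>\<^sub>j\<close> for \<open>j \<noteq> b + 1\<close>.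
  For odd \<open>j > b + 1\<close> this makes the combination symmetric in two adjacent slots, and since the last slot
  is always \<open>AA\<close>, all the slots right of position \<open>b + 1\<close> are. Hence the image of \<open>z\<close> is a multiple of
  \<open>z\<close>. The component of \<open>z\<close> in a direct summand satisfies the same relations, so it is
  a multiple of \<open>z\<close> as well.\<close>

section \<open>Local operators on words\<close>

text \<open>Letters \<open>L\<close> and \<open>A\<close> are encoded as \<^const>\<open>False\<close> and \<^const>\<open>True\<close>. The operators act on
  coefficient functions, so \<open>T\<close> is the target word. On basis words, with the slots \<open>p q\<close> and
  \<open>r s\<close>, \<open>opB\<close> maps \<open>X \<otimes> Y \<mapsto> \<omega>(X, Y) LA \<otimes> LA\<close>, \<open>AL \<otimes> AL \<mapsto> AA \<otimes> LL - LL \<otimes> AA\<close>,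
  \<open>X \<otimes> AL \<mapsto> LA \<otimes> X\<close> and \<open>AL \<otimes> X \<mapsto> X \<otimes> LA\<close> for pure \<open>X\<close> and \<open>Y\<close>, where \<open>\<omega>\<close> is the symplectic form
  with \<open>\<omega>(LL, AA) = 1\<close>, and all the other words to 0.\<close>

definition opE :: "nat \<Rightarrow> nat \<Rightarrow> ((nat \<Rightarrow> bool) \<Rightarrow> 'f::field) \<Rightarrow> (nat \<Rightarrow> bool) \<Rightarrow> 'f" where
  "opE p q f T = (if \<not> T p \<and> T q then f (T(p := True, q := False)) else 0)"

definition opF :: "nat \<Rightarrow> nat \<Rightarrow> ((nat \<Rightarrow> bool) \<Rightarrow> 'f::field) \<Rightarrow> (nat \<Rightarrow> bool) \<Rightarrow> 'f" where
  "opF p q f T = (if T p \<and> \<not> T q then f (T(p := False, q := True)) else 0)"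

definition opB ::
    "nat \<Rightarrow> nat \<Rightarrow> nat \<Rightarrow> nat \<Rightarrow> ((nat \<Rightarrow> bool) \<Rightarrow> 'f::field) \<Rightarrow> (nat \<Rightarrow> bool) \<Rightarrow> 'f" where
  "opB p q r s f T = opF q r f T + (if T q = T r then opE p s f T else - opE p s f T)"

lemma opE_opE:
  assumes "distinct [p, q]"
  shows "opE p q (opE p q f) T = 0"
  using assms by (clarsimp simp: opE_def fun_upd_twist fun_upd_idem)

lemma opE_opE_commute:
  assumes "distinct [p, q, p', q']"
  shows "opE p q (opE p' q' f) T = opE p' q' (opE p q f) T"
  using assms by (clarsimp simp: opE_def fun_upd_twist fun_upd_idem)

lemma opF_opF:
  assumes "distinct [p, q]"
  shows "opF p q (opF p q f) T = 0"
  using assms by (clarsimp simp: opF_def fun_upd_twist fun_upd_idem)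

lemma opF_opF_commute:
  assumes "distinct [p, q, p', q']"
  shows "opF p q (opF p' q' f) T = opF p' q' (opF p q f) T"
  using assms by (clarsimp simp: opF_def fun_upd_twist fun_upd_idem)

lemma opE_opF_commute:
  assumes "distinct [p, q, p', q']"
  shows "opE p q (opF p' q' f) T = opF p' q' (opE p q f) T"
  using assms by (clarsimp simp: opE_def opF_def fun_upd_twist fun_upd_idem)

text \<open>On the mixed states of a slot the two operators are the two off-diagonal matrix units,
  so their products are the two diagonal projections; on pure states both vanish. This produces the
  delta terms in the relations between y and psi.\<close>

lemma opE_opF:
  assumes "distinct [p, q]"
  shows "opE p q (opF p q f) T + opF p q (opE p q f) T = (if T p = T q then 0 else f T)"
  using assms by (clarsimp simp: opE_def opF_def fun_upd_twist fun_upd_idem)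

text \<open>\<open>opB\<close> never produces a word with \<open>AL\<close> in one of its two slots,
  which is the only input that \<open>opE\<close> accepts there.\<close>

lemma opE_opB:
  assumes "distinct [p, q, r, s]"
  shows "opE p q (opB p q r s f) T = 0"
    and "opE r s (opB p q r s f) T = 0"
proof -
  have "distinct [s, r, q, p]"
    using assms by auto
  note neq = assms[simplified] this[simplified]
  show "opE p q (opB p q r s f) T = 0"
    by (cases "T p"; cases "T q"; cases "T r"; cases "T s";
      simp add: neq opB_def opE_def opF_def)
  show "opE r s (opB p q r s f) T = 0"
    by (cases "T p"; cases "T q"; cases "T r"; cases "T s";
      simp add: neq opB_def opE_def opF_def)
qed

text \<open>\<open>opE\<close> produces \<open>LA\<close>, and \<open>opB\<close> kills every word
  with \<open>LA\<close> in one of its two slots.\<close>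

lemma opB_opE:
  assumes "distinct [p, q, r, s]"
  shows "opB p q r s (opE p q f) T = 0"
    and "opB p q r s (opE r s f) T = 0"
proof -
  have "distinct [s, r, q, p]"
    using assms by auto
  note neq = assms[simplified] this[simplified]
  show "opB p q r s (opE p q f) T = 0"
    by (cases "T p"; cases "T q"; cases "T r"; cases "T s";
      simp add: neq opB_def opE_def opF_def)
  show "opB p q r s (opE r s f) T = 0"
    by (cases "T p"; cases "T q"; cases "T r"; cases "T s";
      simp add: neq opB_def opE_def opF_def)
qed

lemma opB_opE_commute:
  assumes "distinct [p, q, r, s, p', q']"
  shows "opB p q r s (opE p' q' f) T = opE p' q' (opB p q r s f) T"
proof -
  have "distinct [q', p', s, r, q, p]"
    using assms by auto
  note neq = assms[simplified] this[simplified]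
  show ?thesis
    by (cases "T p"; cases "T q"; cases "T r"; cases "T s";
      cases "T p'"; cases "T q'";
      simp add: neq opB_def opE_def opF_def fun_upd_twist fun_upd_idem)
qed

lemma opB_opF_commute:
  assumes "distinct [p, q, r, s, p', q']"
  shows "opB p q r s (opF p' q' f) T = opF p' q' (opB p q r s f) T"
proof -
  have "distinct [q', p', s, r, q, p]"
    using assms by auto
  note neq = assms[simplified] this[simplified]
  show ?thesis
    by (cases "T p"; cases "T q"; cases "T r"; cases "T s";
      cases "T p'"; cases "T q'";
      simp add: neq opB_def opE_def opF_def fun_upd_twist fun_upd_idem)
qed

text \<open>The right side is the cross term of -(y_k - y_{k+1})^2 for odd k: there y_k - y_{k+1} is
  the sum of the operators \<open>opE\<close> of the two slots, and both of them square to
  zero.\<close>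

lemma opB_opB:
  assumes "distinct [p, q, r, s]"
  shows "opB p q r s (opB p q r s f) T = - 2 * opE p q (opE r s f) T"
proof -
  have "distinct [s, r, q, p]"
    using assms by auto
  note neq = assms[simplified] this[simplified]
  show ?thesis
    by (cases "T p"; cases "T q"; cases "T r"; cases "T s";
      simp add: neq opB_def opE_def opF_def fun_upd_twist fun_upd_idem)
qed

text \<open>The two operators share the slot \<open>r s\<close>, so their commuting is not a matter
  of disjoint positions. It is required because psi_{2m+1} and psi_{2m+3} commute.\<close>

lemma opB_opB_near:
  assumes "distinct [p, q, r, s, t, u]"
  shows "opB p q r s (opB r s t u f) T = opB r s t u (opB p q r s f) T"
proof -
  have "distinct [u, t, s, r, q, p]"
    using assms by auto
  note neq = assms[simplified] this[simplified]
  show ?thesis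
    by (cases "T p"; cases "T q"; cases "T r"; cases "T s";
      cases "T t"; cases "T u";
      simp add: neq opB_def opE_def opF_def fun_upd_twist fun_upd_idem)
qed

text \<open>The correction is what remains of y_k - 2 y_{k+1} + y_{k+2} for even k: if the slot
  \<open>p q\<close> is pure, its own \<open>opE\<close> vanishes and only y_{k+2}, which is minus
  \<open>opE r s\<close>, survives.\<close>

lemma opF_opB_opF:
  assumes "distinct [p, q, r, s]"
  shows "opF p q (opB p q r s (opF p q f)) T = opB p q r s (opF p q (opB p q r s f)) T - (if T p = T q then opE r s f T else 0)"
proof -
  have "distinct [s, r, q, p]"
    using assms by auto
  note neq = assms[simplified] this[simplified]
  show ?thesis
    by (cases "T p"; cases "T q"; cases "T r"; cases "T s";
      simp add: neq opB_def opE_def opF_def fun_upd_twist fun_upd_idem)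
qed

text \<open>The mirror image for odd k: if the slot \<open>r s\<close> is pure, only y_k, which is
  \<open>opE p q\<close>, survives.\<close>

lemma opB_opF_opB:
  assumes "distinct [p, q, r, s]"
  shows "opB p q r s (opF r s (opB p q r s f)) T = opF r s (opB p q r s (opF r s f)) T + (if T r = T s then opE p q f T else 0)"
proof -
  have "distinct [s, r, q, p]"
    using assms by auto
  note neq = assms[simplified] this[simplified]
  show ?thesis
    by (cases "T p"; cases "T q"; cases "T r"; cases "T s";
      simp add: neq opB_def opE_def opF_def fun_upd_twist fun_upd_idem)
qed

lemma opB_opB_commute:
  assumes "distinct [p, q, r, s, p', q', r', s']"
  shows "opB p q r s (opB p' q' r' s' f) T = opB p' q' r' s' (opB p q r s f) T"
proof -
  have "distinct [s', r', q', p', s, r, q, p]"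
    using assms by auto
  note neq = assms[simplified] this[simplified]
  show ?thesis
    by (cases "T p"; cases "T q"; cases "T r"; cases "T s";
      cases "T p'"; cases "T q'"; cases "T r'"; cases "T s'";
      simp add: neq opB_def opE_def opF_def fun_upd_twist fun_upd_idem)
qed

section \<open>Cyclic left modules and their endomorphisms\<close>

locale cyclic_left_module = ring R for R (structure) +
  fixes X and L and M
  defines "L \<equiv> gen_left_ideal R X"
    and "M \<equiv> cyclic_module R X"
  assumes X_subset: "X \<subseteq> carrier R"
begin

sublocale L: additive_subgroup L R
proof (rule additive_subgroup.intro)
  let ?F = "{L. additive_subgroup L R \<and> (\<forall>r \<in> carrier R. \<forall>x \<in> L. r \<otimes> x \<in> L) \<and> X \<subseteq> L}"
  have "carrier R \<in> ?F"
    using X_subset add.subgroup_self by (simp add: additive_subgroup_def)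
  then have ne: "?F \<noteq> {}" by blast
  have "subgroup (\<Inter>?F) (add_monoid R)"
    by (rule add.subgroups_Inter[OF _ ne]) (auto simp: additive_subgroup_def)
  then show "subgroup L (add_monoid R)"
    by (simp add: L_def gen_left_ideal_def)
qed

sublocale L: abelian_subgroup L R
  by (rule abelian_subgroupI3[OF L.additive_subgroup_axioms abelian_group_axioms])

lemma left_ideal: "r \<in> carrier R \<Longrightarrow> x \<in> L \<Longrightarrow> r \<otimes> x \<in> L"
  unfolding L_def gen_left_ideal_def by blast

lemma X_subset_L: "X \<subseteq> L"
  unfolding L_def gen_left_ideal_def by blast

lemma L_minimal:
  "additive_subgroup K R \<Longrightarrow> (\<And>r x. r \<in> carrier R \<Longrightarrow> x \<in> K \<Longrightarrow> r \<otimes> x \<in> K) \<Longrightarrow> X \<subseteq> K \<Longrightarrow> L \<subseteq> K"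
  unfolding L_def gen_left_ideal_def by blast

lemma carrier_M: "carrier M = (\<lambda>x. L +> x) ` carrier R"
  by (auto simp: M_def L_def cyclic_module_def Let_def A_RCOSETS_def')

lemma zero_M: "\<zero>\<^bsub>M\<^esub> = L +> \<zero>"
  using L.a_subset by (simp add: M_def L_def cyclic_module_def Let_def)

lemma add_M:
  "x \<in> carrier R \<Longrightarrow> y \<in> carrier R \<Longrightarrow> (L +> x) \<oplus>\<^bsub>M\<^esub> (L +> y) = L +> (x \<oplus> y)"
  using L.a_rcos_sum by (simp add: M_def cyclic_module_def Let_def flip: L_def)

lemma coset_eq_iff:
  "x \<in> carrier R \<Longrightarrow> y \<in> carrier R \<Longrightarrow> L +> x = L +> y \<longleftrightarrow> x \<ominus> y \<in> L"
  by (metis L.a_rcos_module_minus L.a_rcos_self L.a_repr_independence' ring_axioms)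

text \<open>The union in \<open>cyclic_module\<close> consists of one coset only: changing the
  representative of the argument by an element of \<open>L\<close> changes the product by an element
  of \<open>L\<close>.\<close>

lemma smult_M:
  assumes r: "r \<in> carrier R" and x: "x \<in> carrier R"
  shows "r \<odot>\<^bsub>M\<^esub> (L +> x) = L +> (r \<otimes> x)"
proof -
  have "L +> (r \<otimes> y) = L +> (r \<otimes> x)" if y: "y \<in> L +> x" for y
  proof -
    have yc: "y \<in> carrier R"
      using y x L.a_subset a_r_coset_subset_G by blast
    have "y \<ominus> x \<in> L"
      using y yc x L.a_rcos_module_minus[OF ring_axioms] by blast
    then have "r \<otimes> (y \<ominus> x) \<in> L"
      using left_ideal r by blast
    moreover have "r \<otimes> (y \<ominus> x) = r \<otimes> y \<ominus> r \<otimes> x"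
      using r x yc by (simp add: a_minus_def r_distr r_minus)
    ultimately show ?thesis
      using coset_eq_iff r x yc by simp
  qed
  moreover have "x \<in> L +> x"
    using x L.a_rcos_self by blast
  ultimately have "(\<Union>y \<in> L +> x. L +> (r \<otimes> y)) = L +> (r \<otimes> x)"
    by blast
  then show ?thesis
    by (simp add: M_def cyclic_module_def Let_def flip: L_def)
qed

end

text \<open>Let z be the coset of 1. The assumption \<open>one_notin\<close> says that z is not
  zero, and \<open>annihilated\<close> that every vector satisfying the defining relations of z is a
  scalar multiple of z. Both conclusions about the module follow from this alone.\<close>

locale cyclic_left_module_over_field = cyclic_left_module R X L M
  for R (structure) and X L M +
  fixes \<eta> :: "'f::field \<Rightarrow> _"
  assumes eta_closed [simp]: "\<eta> c \<in> carrier R"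
    and eta_one [simp]: "\<eta> 1 = \<one>"
    and eta_add: "\<eta> (c + d) = \<eta> c \<oplus> \<eta> d"
    and eta_mult: "\<eta> (c * d) = \<eta> c \<otimes> \<eta> d"
    and eta_central: "x \<in> carrier R \<Longrightarrow> \<eta> c \<otimes> x = x \<otimes> \<eta> c"
    and one_notin: "\<one> \<notin> L"
    and annihilated: "\<And>x. x \<in> carrier R \<Longrightarrow> (\<And>r. r \<in> X \<Longrightarrow> r \<otimes> x \<in> L) \<Longrightarrow> \<exists>c. x \<ominus> \<eta> c \<in> L"
begin

lemma eta_zero: "\<eta> 0 = \<zero>"
  using eta_add[of 0 0] by (metis add.l_cancel_one' add_0 eta_closed)

lemma eta_left_commute:
  "x \<in> carrier R \<Longrightarrow> y \<in> carrier R \<Longrightarrow> x \<otimes> (\<eta> c \<otimes> y) = \<eta> c \<otimes> (x \<otimes> y)"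
  by (metis eta_central eta_closed m_assoc)

lemma eta_in_L_iff: "\<eta> c \<in> L \<longleftrightarrow> c = 0"
proof
  assume "\<eta> c \<in> L"
  then have "\<eta> (inverse c) \<otimes> \<eta> c \<in> L"
    by (simp add: left_ideal)
  then have "\<eta> (inverse c * c) \<in> L"
    by (simp add: eta_mult)
  then show "c = 0"
    using one_notin by (cases "c = 0") auto
qed (simp add: eta_zero)

definition homothety where "homothety c = (\<lambda>m \<in> carrier M. \<eta> c \<odot>\<^bsub>M\<^esub> m)"

lemma homothety_coset: "x \<in> carrier R \<Longrightarrow> homothety c (L +> x) = L +> (\<eta> c \<otimes> x)"
  by (simp add: homothety_def carrier_M smult_M)

lemma homothety_eqI:
  assumes "f \<in> extensional (carrier M)"
    and "\<And>x. x \<in> carrier R \<Longrightarrow> f (L +> x) = L +> (\<eta> c \<otimes> x)"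
  shows "f = homothety c"
  using assms(1)
  by (rule extensionalityI) (auto simp: homothety_def carrier_M smult_M assms(2))

lemma homothety_inj: "homothety c = homothety d \<longleftrightarrow> c = d"
proof
  assume "homothety c = homothety d"
  then have "L +> \<eta> c = L +> \<eta> d"
    using homothety_coset[of \<one>] by (metis eta_closed one_closed r_one)
  then have "\<eta> c \<ominus> \<eta> d \<in> L"
    by (simp add: coset_eq_iff)
  moreover have "\<eta> c = \<eta> (c - d) \<oplus> \<eta> d"
    by (simp flip: eta_add)
  ultimately have "\<eta> (c - d) \<in> L"
    by (simp add: a_minus_def a_assoc r_neg)
  then show "c = d"
    by (simp add: eta_in_L_iff)
qed simp

abbreviation "E \<equiv> End_space \<eta> R M"

text \<open>An endomorphism is determined by the image of z, and this image satisfies the relations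
  of z because z does. By \<open>annihilated\<close> it is a multiple of z.\<close>

lemma carrier_E: "carrier E = range homothety"
proof (intro equalityI subsetI)
  fix f assume "f \<in> carrier E"
  then have f: "f \<in> LinearCombinations.module_hom R M M" "f \<in> extensional (carrier M)"
    by (auto simp: End_space_def)
  have one: "L +> \<one> \<in> carrier M"
    by (auto simp: carrier_M)
  obtain x where x: "x \<in> carrier R" "f (L +> \<one>) = L +> x"
    using LinearCombinations.module_hom_closed[OF f(1)] one by (auto simp: carrier_M)
  have *: "f (L +> y) = L +> (y \<otimes> x)" if y: "y \<in> carrier R" for y
  proof -
    have "f (L +> y) = f (y \<odot>\<^bsub>M\<^esub> (L +> \<one>))"
      using y by (simp add: smult_M)
    also have "\<dots> = y \<odot>\<^bsub>M\<^esub> f (L +> \<one>)"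
      by (rule LinearCombinations.module_hom_smult[OF f(1) y one])
    finally show ?thesis
      using x y by (simp add: smult_M)
  qed
  have "r \<otimes> x \<in> L" if r: "r \<in> X" for r
  proof -
    have rc: "r \<in> carrier R"
      using r X_subset by blast
    have "r \<ominus> \<zero> \<in> L"
      using r X_subset_L rc by (auto simp: a_minus_def)
    then have "L +> r = L +> \<zero>"
      using rc coset_eq_iff by simp
    then have "L +> (r \<otimes> x) = L +> (\<zero> \<otimes> x)"
      using *[of r] *[of \<zero>] rc by simp
    then have "r \<otimes> x \<ominus> \<zero> \<in> L"
      using rc x coset_eq_iff by simp
    then show ?thesis
      using rc x by (simp add: a_minus_def)
  qed
  then obtain c where c: "x \<ominus> \<eta> c \<in> L"
    using annihilated x by blast
  have "f = homothety c"
  proof (rule homothety_eqI)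
    show "f \<in> extensional (carrier M)"
      by fact
    fix y assume y: "y \<in> carrier R"
    have "y \<otimes> (x \<ominus> \<eta> c) \<in> L"
      using c y left_ideal by blast
    moreover have "y \<otimes> (x \<ominus> \<eta> c) = y \<otimes> x \<ominus> \<eta> c \<otimes> y"
      using x y by (simp add: eta_central a_minus_def r_distr r_minus)
    ultimately show "f (L +> y) = L +> (\<eta> c \<otimes> y)"
      using * x y coset_eq_iff by simp
  qed
  then show "f \<in> range homothety" by blast
next
  fix f assume "f \<in> range homothety"
  then obtain c where f: "f = homothety c" by blast
  have "f \<in> LinearCombinations.module_hom R M M"
    unfolding LinearCombinations.module_hom_def f
    by (auto simp: carrier_M homothety_coset add_M smult_M r_distr eta_left_commute)
  then show "f \<in> carrier E"
    by (simp add: End_space_def f homothety_def)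
qed

lemma add_E: "homothety c \<oplus>\<^bsub>E\<^esub> homothety d = homothety (c + d)"
  by (rule homothety_eqI)
     (auto simp: End_space_def carrier_M homothety_coset add_M eta_add l_distr)

lemma zero_E: "\<zero>\<^bsub>E\<^esub> = homothety 0"
  by (rule homothety_eqI) (auto simp: End_space_def carrier_M zero_M eta_zero)

lemma smult_E: "c \<odot>\<^bsub>E\<^esub> homothety d = homothety (c * d)"
  by (rule homothety_eqI)
     (auto simp: End_space_def carrier_M homothety_coset smult_M eta_mult m_assoc)

lemma vectorspace_E: "vectorspace class_ring E"
proof -
  have "abelian_group E"
  proof (rule abelian_groupI)
    fix f assume "f \<in> carrier E"
    then obtain c where "f = homothety c" by (auto simp: carrier_E)
    then show "\<exists>g \<in> carrier E. g \<oplus>\<^bsub>E\<^esub> f = \<zero>\<^bsub>E\<^esub>"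
      by (intro bexI[of _ "homothety (- c)"]) (auto simp: carrier_E add_E zero_E)
  qed (auto simp: carrier_E add_E zero_E algebra_simps)
  then have "Module.module class_ring E"
    by (intro moduleI class_cring.cring_axioms)
       (auto simp: carrier_E add_E smult_E algebra_simps)
  then show ?thesis
    by (simp add: vectorspace_def class_field)
qed

theorem one_dimensional_E: "one_dimensional E"
proof -
  interpret E: vectorspace class_ring E
    by (rule vectorspace_E)
  let ?A = "{homothety 1}"
  have sub: "?A \<subseteq> carrier E"
    by (simp add: carrier_E)
  have lc: "E.lincomb a ?A = homothety (a (homothety 1))" for a
    unfolding E.lincomb_def
    by (simp add: carrier_E smult_E)
  have gen: "E.gen_set ?A"
  proof
    show "E.span ?A \<subseteq> carrier E"
      by (rule E.span_is_subset2[OF sub])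
    show "carrier E \<subseteq> E.span ?A"
    proof
      fix f assume "f \<in> carrier E"
      then obtain c where "f = homothety c" by (auto simp: carrier_E)
      then have "f = E.lincomb (\<lambda>_. c) ?A" by (simp add: lc)
      then show "f \<in> E.span ?A"
        by (auto simp: E.finite_span[OF _ sub])
    qed
  qed
  then have fd: "E.fin_dim"
    unfolding E.fin_dim_def using sub by blast
  have "E.lin_indpt ?A"
    by (rule E.finite_lin_indpt2[OF _ sub]) (simp_all add: lc zero_E homothety_inj)
  then have "1 \<le> E.dim"
    using E.li_le_dim(2)[OF fd sub] by simp
  moreover have "E.dim \<le> 1"
    using E.gen_ge_dim[OF _ sub gen] by simp
  ultimately show ?thesis
    using fd by (simp add: one_dimensional_def vectorspace_E)
qed

text \<open>Let z = x z + y z be the decomposition of the generator. A relation r kills z, so r x z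
  = - r y z lies in both summands and vanishes. Hence x z = c z for a scalar c. If c = 0, then z
  lies in \<open>N\<^sub>2\<close>, otherwise in \<open>N\<^sub>1\<close>, and a submodule
  containing z is the whole module.\<close>

theorem indecomposable: "indecomposable_module R M"
proof -
  have one: "L +> \<one> \<in> carrier M"
    by (auto simp: carrier_M)
  have coset_zero: "L +> x = \<zero>\<^bsub>M\<^esub> \<longleftrightarrow> x \<in> L" if "x \<in> carrier R" for x
    using that by (simp add: zero_M coset_eq_iff a_minus_def)
  have "L +> \<one> \<noteq> \<zero>\<^bsub>M\<^esub>"
    using one_notin by (simp add: coset_zero)
  then have "carrier M \<noteq> {\<zero>\<^bsub>M\<^esub>}"
    using one by blast
  moreover have False
    if N: "Module.submodule N\<^sub>1 R M" "Module.submodule N\<^sub>2 R M"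
      and ne: "N\<^sub>1 \<noteq> {\<zero>\<^bsub>M\<^esub>}" "N\<^sub>2 \<noteq> {\<zero>\<^bsub>M\<^esub>}"
      and int: "N\<^sub>1 \<inter> N\<^sub>2 = {\<zero>\<^bsub>M\<^esub>}" and sum: "N\<^sub>1 <+>\<^bsub>M\<^esub> N\<^sub>2 = carrier M" for N\<^sub>1 N\<^sub>2
  proof -
    have sub: "N\<^sub>1 \<subseteq> carrier M" "N\<^sub>2 \<subseteq> carrier M"
      using N[THEN Module.submodule.axioms(1), THEN subgroup.subset] by simp_all
    have smult: "m \<in> N\<^sub>1 \<Longrightarrow> r \<odot>\<^bsub>M\<^esub> m \<in> N\<^sub>1" "m \<in> N\<^sub>2 \<Longrightarrow> r \<odot>\<^bsub>M\<^esub> m \<in> N\<^sub>2"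
      if "r \<in> carrier R" for r m
      using that N[THEN Module.submodule.smult_closed] by blast+
    have full: "N = carrier M" if "N \<subseteq> carrier M" "L +> \<one> \<in> N"
      "\<And>r m. r \<in> carrier R \<Longrightarrow> m \<in> N \<Longrightarrow> r \<odot>\<^bsub>M\<^esub> m \<in> N" for N
    proof -
      have "L +> r \<in> N" if "r \<in> carrier R" for r
        using that \<open>\<And>r m. r \<in> carrier R \<Longrightarrow> m \<in> N \<Longrightarrow> r \<odot>\<^bsub>M\<^esub> m \<in> N\<close>[of r "L +> \<one>"] \<open>L +> \<one> \<in> N\<close>
        by (simp add: smult_M)
      then show ?thesis
        using \<open>N \<subseteq> carrier M\<close> by (auto simp: carrier_M)
    qed
    obtain m\<^sub>1 m\<^sub>2 where m: "m\<^sub>1 \<in> N\<^sub>1" "m\<^sub>2 \<in> N\<^sub>2" "L +> \<one> = m\<^sub>1 \<oplus>\<^bsub>M\<^esub> m\<^sub>2"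
      using one unfolding sum[symmetric] by (auto simp: set_add_def set_mult_def)
    obtain x y where xy: "x \<in> carrier R" "m\<^sub>1 = L +> x" "y \<in> carrier R" "m\<^sub>2 = L +> y"
      using subsetD[OF sub(1) m(1)] subsetD[OF sub(2) m(2)] by (auto simp: carrier_M)
    have "L +> \<one> = L +> (x \<oplus> y)"
      using m xy by (simp add: add_M)
    then have "x \<oplus> y \<ominus> \<one> \<in> L"
      using xy coset_eq_iff by (metis add.m_closed one_closed)
    have "r \<otimes> x \<in> L" if r: "r \<in> X" for r
    proof -
      have rc: "r \<in> carrier R"
        using r X_subset by blast
      have "r \<otimes> (x \<oplus> y \<ominus> \<one>) \<oplus> r \<in> L"
        using left_ideal rc \<open>x \<oplus> y \<ominus> \<one> \<in> L\<close> r X_subset_L by blast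
      moreover have "r \<otimes> (x \<oplus> y \<ominus> \<one>) \<oplus> r = r \<otimes> x \<ominus> r \<otimes> (\<ominus> y)"
        using rc xy by (simp add: a_minus_def r_distr r_minus a_assoc l_neg)
      ultimately have "L +> (r \<otimes> x) = L +> (r \<otimes> (\<ominus> y))"
        using rc xy coset_eq_iff by simp
      also have "\<dots> = (\<ominus> r) \<odot>\<^bsub>M\<^esub> m\<^sub>2"
        using rc xy by (simp add: smult_M r_minus l_minus)
      finally have "L +> (r \<otimes> x) \<in> N\<^sub>2"
        using smult(2) rc m by simp
      moreover have "L +> (r \<otimes> x) \<in> N\<^sub>1"
        using smult(1)[of r m\<^sub>1] rc m xy by (simp add: smult_M)
      ultimately have "L +> (r \<otimes> x) = \<zero>\<^bsub>M\<^esub>"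
        using int by blast
      then show ?thesis
        using rc xy by (simp add: coset_zero)
    qed
    then obtain c where c: "x \<ominus> \<eta> c \<in> L"
      using annihilated xy by blast
    show False
    proof (cases "c = 0")
      case True
      then have "m\<^sub>1 = \<zero>\<^bsub>M\<^esub>"
        using c xy by (simp add: coset_zero eta_zero a_minus_def)
      then have "L +> \<one> = m\<^sub>2"
        using m xy by (simp add: zero_M add_M)
      then have "N\<^sub>2 = carrier M"
        using full[of N\<^sub>2] sub smult m by blast
      then show False
        using ne int sub by blast
    next
      case False
      have "L +> x = L +> \<eta> c"
        using c xy coset_eq_iff by simp
      then have "\<eta> (inverse c) \<odot>\<^bsub>M\<^esub> m\<^sub>1 = L +> \<one>"
        using False xy by (simp add: smult_M flip: eta_mult)
      then have "L +> \<one> \<in> N\<^sub>1"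
        using smult(1)[of "\<eta> (inverse c)" m\<^sub>1] m by simp
      then have "N\<^sub>1 = carrier M"
        using full[of N\<^sub>1] sub smult by blast
      then show False
        using ne int sub by blast
    qed
  qed
  ultimately show ?thesis
    unfolding indecomposable_module_def by blast
qed

end

section \<open>Transport of modules along a surjective ring map\<close>

lemma module_hom_pullback:
  assumes "\<theta> ` carrier R' = carrier R"
  shows "LinearCombinations.module_hom R' (pullback_module \<theta> M) (pullback_module \<theta> M) =
    LinearCombinations.module_hom R M M"
proof -
  have "(\<forall>r m. r \<in> carrier R' \<and> m \<in> carrier M \<longrightarrow> f (\<theta> r \<odot>\<^bsub>M\<^esub> m) = \<theta> r \<odot>\<^bsub>M\<^esub> f m) \<longleftrightarrow>
    (\<forall>r m. r \<in> carrier R \<and> m \<in> carrier M \<longrightarrow> f (r \<odot>\<^bsub>M\<^esub> m) = r \<odot>\<^bsub>M\<^esub> f m)" for f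
    unfolding assms[symmetric] by auto
  then show ?thesis
    by (simp add: LinearCombinations.module_hom_def pullback_module_def)
qed

text \<open>A surjective \<open>\<theta>\<close> leaves the set of operators on \<open>M\<close>
  unchanged, so the endomorphisms are literally the same functions.\<close>

lemma End_space_pullback:
  assumes "\<theta> ` carrier R' = carrier R" "\<And>c. \<theta> (\<eta>' c) = \<eta> c"
  shows "End_space \<eta>' R' (pullback_module \<theta> M) = End_space \<eta> R M"
  unfolding End_space_def module_hom_pullback[OF assms(1)]
  by (simp add: pullback_module_def assms(2))

lemma submodule_pullback:
  assumes "\<theta> ` carrier R' = carrier R"
  shows "Module.submodule N R' (pullback_module \<theta> M) \<longleftrightarrow> Module.submodule N R M"
proof -
  have "(\<forall>r x. r \<in> carrier R' \<longrightarrow> x \<in> N \<longrightarrow> \<theta> r \<odot>\<^bsub>M\<^esub> x \<in> N) \<longleftrightarrow>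
    (\<forall>r x. r \<in> carrier R \<longrightarrow> x \<in> N \<longrightarrow> r \<odot>\<^bsub>M\<^esub> x \<in> N)"
    unfolding assms[symmetric] by auto
  then show ?thesis
    by (simp add: Module.submodule_def Module.submodule_axioms_def subgroup_def m_inv_def pullback_module_def)
qed

lemma indecomposable_module_pullback:
  assumes "\<theta> ` carrier R' = carrier R"
  shows "indecomposable_module R' (pullback_module \<theta> M) \<longleftrightarrow> indecomposable_module R M"
  unfolding indecomposable_module_def submodule_pullback[OF assms]
  by (simp add: pullback_module_def set_add_def set_mult_def)

section \<open>Free algebras, presentations and representations\<close>

lemma carrier_free_algebra:
  "carrier (free_algebra X) = {p. \<forall>w \<in> Poly_Mapping.keys p. set (letters w) \<subseteq> X}"
  by (simp add: free_algebra_def)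

lemma free_algebra_simps [simp]:
  "mult (free_algebra X) = (*)" "one (free_algebra X) = 1"
  "zero (free_algebra X) = 0" "add (free_algebra X) = (+)"
  by (simp_all add: free_algebra_def)

lemma free_algebra_zero [simp]: "0 \<in> carrier (free_algebra X)"
  by (simp add: carrier_free_algebra)

lemma free_algebra_scalar [simp]: "scalar c \<in> carrier (free_algebra X)"
  by (auto simp: carrier_free_algebra scalar_def zero_free_monoid_def split: if_splits)

lemma scalar_one: "scalar 1 = 1"
  by (simp add: scalar_def)

lemma free_algebra_one [simp]: "1 \<in> carrier (free_algebra X)"
  using free_algebra_scalar[of 1] by (simp only: scalar_one)

lemma free_algebra_gen [simp]: "g \<in> X \<Longrightarrow> gen g \<in> carrier (free_algebra X)"
  by (auto simp: carrier_free_algebra gen_def)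

lemma free_algebra_add [simp]:
  "p \<in> carrier (free_algebra X) \<Longrightarrow> q \<in> carrier (free_algebra X) \<Longrightarrow> p + q \<in> carrier (free_algebra X)"
  using keys_add[of p q] unfolding carrier_free_algebra by blast

lemma free_algebra_uminus [simp]:
  "p \<in> carrier (free_algebra X) \<Longrightarrow> - p \<in> carrier (free_algebra X)"
  by (simp add: carrier_free_algebra)

lemma free_algebra_diff [simp]:
  "p \<in> carrier (free_algebra X) \<Longrightarrow> q \<in> carrier (free_algebra X) \<Longrightarrow> p - q \<in> carrier (free_algebra X)"
  using free_algebra_add[of p X "- q"] by simp

lemma free_algebra_mult [simp]:
  assumes "p \<in> carrier (free_algebra X)" "q \<in> carrier (free_algebra X)"
  shows "p * q \<in> carrier (free_algebra X)"
proof -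
  have "set (letters w) \<subseteq> X" if w: "w \<in> Poly_Mapping.keys (p * q)" for w
  proof -
    obtain u v where "w = u + v" "u \<in> Poly_Mapping.keys p" "v \<in> Poly_Mapping.keys q"
      using w keys_mult[of p q] by blast
    then show ?thesis
      using assms by (auto simp: carrier_free_algebra plus_free_monoid_def)
  qed
  then show ?thesis
    by (simp add: carrier_free_algebra)
qed

lemma free_algebra_sum [simp]:
  "(\<And>i. i \<in> A \<Longrightarrow> p i \<in> carrier (free_algebra X)) \<Longrightarrow> sum p A \<in> carrier (free_algebra X)"
  by (induction A rule: infinite_finite_induct) auto

lemma free_algebra_power [simp]:
  "p \<in> carrier (free_algebra X) \<Longrightarrow> p ^ k \<in> carrier (free_algebra X)"
  by (induction k) auto

lemma free_algebra_prod_list [simp]: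
  "(\<And>p. p \<in> set ps \<Longrightarrow> p \<in> carrier (free_algebra X)) \<Longrightarrow> prod_list ps \<in> carrier (free_algebra X)"
  by (induction ps) auto

lemma free_algebra_two [simp]: "2 \<in> carrier (free_algebra X)"
  using free_algebra_add[OF free_algebra_one free_algebra_one] by simp

lemma ring_free_algebra: "ring (free_algebra X)"
proof (rule ringI)
  show "abelian_group (free_algebra X)"
  proof (rule abelian_groupI)
    fix p assume "p \<in> carrier (free_algebra X)"
    then show "\<exists>q \<in> carrier (free_algebra X). q \<oplus>\<^bsub>free_algebra X\<^esub> p = \<zero>\<^bsub>free_algebra X\<^esub>"
      by (intro bexI[of _ "- p"]) auto
  qed (auto simp: algebra_simps)
  show "Group.monoid (free_algebra X)"
    by (rule monoidI) (auto simp: algebra_simps)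
qed (auto simp: algebra_simps)

lemma free_algebra_minus:
  assumes "p \<in> carrier (free_algebra X)" "q \<in> carrier (free_algebra X)"
  shows "p \<ominus>\<^bsub>free_algebra X\<^esub> q = p - q"
proof -
  interpret ring "free_algebra X" by (rule ring_free_algebra)
  have "\<ominus>\<^bsub>free_algebra X\<^esub> q = - q"
    using minus_equality[of "- q" q] assms by simp
  then show ?thesis
    by (simp add: a_minus_def)
qed

lemma sum_single_keys:
  fixes p :: "'a \<Rightarrow>\<^sub>0 'b::comm_monoid_add"
  shows "(\<Sum>w \<in> Poly_Mapping.keys p. Poly_Mapping.single w (Poly_Mapping.lookup p w)) = p"
proof (rule poly_mapping_eqI)
  fix w
  have "(\<Sum>v \<in> Poly_Mapping.keys p. Poly_Mapping.lookup p v when v = w) = Poly_Mapping.lookup p w"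
    by (simp add: when_def in_keys_iff)
  then show "Poly_Mapping.lookup
      (\<Sum>v \<in> Poly_Mapping.keys p. Poly_Mapping.single v (Poly_Mapping.lookup p v)) w = Poly_Mapping.lookup p w"
    by (simp add: lookup_sum lookup_single)
qed

lemma scalar_add: "scalar (c + d) = scalar c + scalar d"
  by (simp add: scalar_def single_add)

lemma scalar_mult: "scalar (c * d) = scalar c * scalar d"
  by (simp add: scalar_def mult_single)

lemma scalar_commute: "scalar c * p = p * scalar c"
proof -
  have "scalar c * (\<Sum>w \<in> Poly_Mapping.keys p. Poly_Mapping.single w (Poly_Mapping.lookup p w)) =
    (\<Sum>w \<in> Poly_Mapping.keys p. Poly_Mapping.single w (Poly_Mapping.lookup p w)) * scalar c"
    unfolding sum_distrib_left sum_distrib_right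
    by (intro sum.cong refl) (simp add: scalar_def mult_single mult.commute)
  then show ?thesis
    by (simp add: sum_single_keys)
qed

lemma scalar_left_commute: "x * (scalar c * p) = scalar c * (x * p)"
  by (metis mult.assoc scalar_commute)

section \<open>The free algebra as a vector space and its actions by linear operators\<close>

interpretation fa: vector_space "\<lambda>c p. scalar c * p"
  by standard (simp_all add: scalar_add scalar_mult scalar_one algebra_simps)

lemma mult_left_span:
  assumes "p \<in> fa.span A" and "\<And>a. a \<in> A \<Longrightarrow> x * a \<in> fa.span B"
  shows "x * p \<in> fa.span B"
  using assms(1)
proof (induction rule: fa.span_induct_alt)
  case base
  then show ?case by (simp add: fa.span_zero)
next
  case (step c a p)
  then show ?case
    using assms(2) by (simp add: distrib_left scalar_left_commute fa.span_add fa.span_scale)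
qed

text \<open>The algebra homomorphism extending the operators of the generators; in a word the last
  letter acts first. It acts on all functions on the basis, so no finiteness of supports has to be
  maintained.\<close>

definition act ::
    "('g \<Rightarrow> ('w \<Rightarrow> 'f) \<Rightarrow> 'w \<Rightarrow> 'f) \<Rightarrow> ('g, 'f::field) free_alg \<Rightarrow> ('w \<Rightarrow> 'f) \<Rightarrow> 'w \<Rightarrow> 'f" where
  "act \<rho> p f T =
     (\<Sum>w \<in> Poly_Mapping.keys p. Poly_Mapping.lookup p w * foldr \<rho> (letters w) f T)"

locale linear_ops =
  fixes \<rho> :: "'g \<Rightarrow> ('w \<Rightarrow> 'f::field) \<Rightarrow> 'w \<Rightarrow> 'f"
  assumes op_add: "\<rho> g (\<lambda>T. f T + h T) = (\<lambda>T. \<rho> g f T + \<rho> g h T)"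
    and op_scale: "\<rho> g (\<lambda>T. c * f T) = (\<lambda>T. c * \<rho> g f T)"
begin

lemma act_superset:
  assumes "finite A" "Poly_Mapping.keys p \<subseteq> A"
  shows "act \<rho> p f T = (\<Sum>w \<in> A. Poly_Mapping.lookup p w * foldr \<rho> (letters w) f T)"
  unfolding act_def using assms
  by (intro sum.mono_neutral_left) (auto simp: in_keys_iff)

lemma act_add: "act \<rho> (p + q) f T = act \<rho> p f T + act \<rho> q f T"
proof -
  let ?A = "Poly_Mapping.keys p \<union> Poly_Mapping.keys q"
  have "Poly_Mapping.keys (p + q) \<subseteq> ?A"
    by (rule keys_add)
  then show ?thesis
    by (simp add: act_superset[where A = ?A] lookup_add distrib_right sum.distrib)
qed

lemma act_uminus: "act \<rho> (- p) f T = - act \<rho> p f T"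
  by (simp add: act_def sum_negf)

lemma act_diff: "act \<rho> (p - q) f T = act \<rho> p f T - act \<rho> q f T"
  using act_add[of p "- q" f T] act_uminus[of q f T] by simp

lemma act_single: "act \<rho> (Poly_Mapping.single w c) f T = c * foldr \<rho> (letters w) f T"
  by (simp add: act_def)

lemma act_gen: "act \<rho> (gen g) f = \<rho> g f"
  by (rule ext) (simp add: gen_def act_single)

lemma act_scalar: "act \<rho> (scalar c) f T = c * f T"
  by (simp add: scalar_def act_single zero_free_monoid_def)

lemma act_one: "act \<rho> 1 f = f"
  using act_scalar[of 1] by (auto simp: scalar_one)

lemma act_zero: "act \<rho> 0 f T = 0"
  by (simp add: act_def)

lemma act_two: "act \<rho> 2 f T = 2 * f T"
  using act_add[of 1 1 f T] by (simp add: act_one)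

lemma act_sum: "act \<rho> (sum p A) f T = (\<Sum>i \<in> A. act \<rho> (p i) f T)"
  by (induction A rule: infinite_finite_induct) (auto simp: act_zero act_add)

lemma foldr_op_add: "foldr \<rho> gs (\<lambda>T. f T + h T) T = foldr \<rho> gs f T + foldr \<rho> gs h T"
proof (induction gs arbitrary: T)
  case (Cons g gs)
  have "foldr \<rho> gs (\<lambda>T. f T + h T) = (\<lambda>T. foldr \<rho> gs f T + foldr \<rho> gs h T)"
    by (rule ext) (rule Cons)
  then show ?case
    by (simp add: op_add)
qed simp

lemma foldr_op_scale: "foldr \<rho> gs (\<lambda>T. c * f T) T = c * foldr \<rho> gs f T"
proof (induction gs arbitrary: T)
  case (Cons g gs)
  have "foldr \<rho> gs (\<lambda>T. c * f T) = (\<lambda>T. c * foldr \<rho> gs f T)"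
    by (rule ext) (rule Cons)
  then show ?case
    by (simp add: op_scale)
qed simp

lemma foldr_op_sum:
  "foldr \<rho> gs (\<lambda>T. \<Sum>i \<in> A. f i T) T = (\<Sum>i \<in> A. foldr \<rho> gs (f i) T)"
proof (induction A rule: infinite_finite_induct)
  case (infinite A)
  then show ?case
    using foldr_op_scale[of gs 0 "\<lambda>_. 0"] by simp
next
  case empty
  then show ?case
    using foldr_op_scale[of gs 0 "\<lambda>_. 0"] by simp
qed (simp add: foldr_op_add)

lemma act_mult: "act \<rho> (p * q) f = act \<rho> p (act \<rho> q f)"
proof
  fix T
  have *: "p * q = (\<Sum>u \<in> Poly_Mapping.keys p. \<Sum>v \<in> Poly_Mapping.keys q.
      Poly_Mapping.single (u + v) (Poly_Mapping.lookup p u * Poly_Mapping.lookup q v))"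
    by (subst (1) sum_single_keys[of p, symmetric], subst (1) sum_single_keys[of q, symmetric])
       (simp only: sum_distrib_left sum_distrib_right mult_single, rule sum.swap)
  have "act \<rho> (p * q) f T = (\<Sum>u \<in> Poly_Mapping.keys p. \<Sum>v \<in> Poly_Mapping.keys q.
      Poly_Mapping.lookup p u * Poly_Mapping.lookup q v *
        foldr \<rho> (letters u) (foldr \<rho> (letters v) f) T)"
    by (simp add: * act_sum act_single plus_free_monoid_def)
  also have "\<dots> = act \<rho> p (act \<rho> q f) T"
    unfolding act_def[of \<rho> p] act_def[of \<rho> q f, abs_def]
    by (simp add: foldr_op_sum foldr_op_scale sum_distrib_left mult.assoc)
  finally show "act \<rho> (p * q) f T = act \<rho> p (act \<rho> q f) T" .
qed

lemma act_scale_arg: "act \<rho> p (\<lambda>T. c * f T) T = c * act \<rho> p f T"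
  by (simp add: act_def foldr_op_scale sum_distrib_left mult.left_commute)

lemma act_zero_arg: "act \<rho> p (\<lambda>T. 0) T = 0"
  using act_scale_arg[of p 0 "\<lambda>_. 0" T] by simp

end

section \<open>Cyclic modules over a presented algebra\<close>

locale presented_module =
  fixes X :: "'g set" and R S :: "('g, 'f::field) free_alg set"
  assumes R_subset: "R \<subseteq> carrier (free_algebra X)"
    and S_subset: "S \<subseteq> carrier (free_algebra X)"
begin

abbreviation A :: "('g, 'f) free_alg set" where "A \<equiv> carrier (free_algebra X)"
definition "I = Idl\<^bsub>free_algebra X\<^esub> R"
abbreviation Q where "Q \<equiv> presented_algebra X R"
abbreviation cls where "cls \<equiv> presented_class X R"
text \<open>The annihilator of the generator z, pulled back to the free algebra:
  \<open>p \<in> J\<close> means p z = 0. Computations in the module thus become computations with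
  noncommutative polynomials modulo \<open>J\<close>.\<close>

definition "J = {p \<in> A. cls p \<in> gen_left_ideal Q (cls ` S)}"

sublocale FA: ring "free_algebra X"
  by (rule ring_free_algebra)

sublocale I: ideal I "free_algebra X"
  unfolding I_def by (rule FA.genideal_ideal[OF R_subset])

lemma R_subset_I: "R \<subseteq> I"
  unfolding I_def by (rule FA.genideal_self[OF R_subset])

lemma I_left: "x \<in> A \<Longrightarrow> i \<in> I \<Longrightarrow> x * i \<in> I"
  using I.I_l_closed by simp

lemma I_right: "x \<in> A \<Longrightarrow> i \<in> I \<Longrightarrow> i * x \<in> I"
  using I.I_r_closed by simp

lemma I_zero: "0 \<in> I"
  using I.zero_closed by simp

lemma I_add: "i \<in> I \<Longrightarrow> j \<in> I \<Longrightarrow> i + j \<in> I"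
  using I.a_closed by simp

lemma I_subset: "I \<subseteq> A"
  by (rule I.a_subset)

lemma I_diff: "i \<in> I \<Longrightarrow> j \<in> I \<Longrightarrow> i - j \<in> I"
  using I_add[of i "scalar (- 1) * j"] I_left[of "scalar (- 1)" j]
  by (simp add: scalar_def single_uminus)

lemma Q_eq: "Q = free_algebra X Quot I"
  by (simp add: presented_algebra_def I_def)

lemma cls_eq: "cls p = I +>\<^bsub>free_algebra X\<^esub> p"
  by (simp add: presented_class_def I_def)

sublocale Q: ring Q
  unfolding Q_eq by (rule I.quotient_is_ring)

lemma carrier_Q: "carrier Q = cls ` A"
  by (auto simp: Q_eq FactRing_def A_RCOSETS_def' cls_eq)

lemma cls_mult: "p \<in> A \<Longrightarrow> q \<in> A \<Longrightarrow> cls (p * q) = cls p \<otimes>\<^bsub>Q\<^esub> cls q"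
  using ring_hom_mult[OF I.rcos_ring_hom] by (simp add: Q_eq cls_eq)

lemma cls_add: "p \<in> A \<Longrightarrow> q \<in> A \<Longrightarrow> cls (p + q) = cls p \<oplus>\<^bsub>Q\<^esub> cls q"
  using ring_hom_add[OF I.rcos_ring_hom] by (simp add: Q_eq cls_eq)

lemma cls_one: "cls 1 = \<one>\<^bsub>Q\<^esub>"
  using ring_hom_one[OF I.rcos_ring_hom] by (simp add: Q_eq cls_eq)

lemma cls_closed: "p \<in> A \<Longrightarrow> cls p \<in> carrier Q"
  by (simp add: carrier_Q)

lemma cls_zero: "cls 0 = \<zero>\<^bsub>Q\<^esub>"
  using cls_add[of 0 0] Q.add.l_cancel_one'[of "cls 0" "cls 0"] cls_closed[of 0] by simp

lemma cls_diff: "p \<in> A \<Longrightarrow> q \<in> A \<Longrightarrow> cls (p - q) = cls p \<ominus>\<^bsub>Q\<^esub> cls q"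
  using cls_add[of "p - q" q] cls_closed[of p] cls_closed[of q] cls_closed[of "p - q"]
  by (simp add: a_minus_def Q.a_assoc Q.r_neg)

lemma cls_eq_iff: "p \<in> A \<Longrightarrow> q \<in> A \<Longrightarrow> cls p = cls q \<longleftrightarrow> p - q \<in> I"
  unfolding cls_eq
  by (metis I.a_rcos_module_minus I.a_rcos_self I.a_repr_independence' FA.ring_axioms free_algebra_minus)

lemma cls_I: "i \<in> I \<Longrightarrow> cls i = \<zero>\<^bsub>Q\<^esub>"
  using cls_eq_iff[of i 0] I_subset by (auto simp: cls_zero)

sublocale C: cyclic_left_module Q "cls ` S" "gen_left_ideal Q (cls ` S)" "cyclic_module Q (cls ` S)"
  by unfold_locales (use S_subset in \<open>auto intro: cls_closed\<close>)

lemma J_subset: "J \<subseteq> A"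
  by (auto simp: J_def)

lemma I_subset_J: "I \<subseteq> J"
  using I_subset C.L.zero_closed by (auto simp: J_def cls_I)

lemma S_subset_J: "S \<subseteq> J"
  using S_subset C.X_subset_L by (auto simp: J_def)

lemma J_zero: "0 \<in> J"
  using I_zero I_subset_J by blast

lemma J_add: "p \<in> J \<Longrightarrow> q \<in> J \<Longrightarrow> p + q \<in> J"
  by (auto simp: J_def cls_add C.L.a_closed)

lemma J_left: "x \<in> A \<Longrightarrow> p \<in> J \<Longrightarrow> x * p \<in> J"
  by (auto simp: J_def cls_mult cls_closed C.left_ideal)

lemma J_diff: "p \<in> J \<Longrightarrow> q \<in> J \<Longrightarrow> p - q \<in> J"
  using J_add[of p "scalar (- 1) * q"] J_left[of "scalar (- 1)" q]
  by (simp add: scalar_def single_uminus)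

lemma J_rel: "r \<in> R \<Longrightarrow> x \<in> A \<Longrightarrow> r * x \<in> J"
  using R_subset_I I_right I_subset_J by blast

text \<open>Applied to the kernel of an action on a vector, this shows that the action factors
  through the module.\<close>

lemma J_minimal:
  assumes K: "K \<subseteq> A" "0 \<in> K" "\<And>p q. p \<in> K \<Longrightarrow> q \<in> K \<Longrightarrow> p + q \<in> K"
      "\<And>x p. x \<in> A \<Longrightarrow> p \<in> K \<Longrightarrow> x * p \<in> K"
    and R: "\<And>r x. r \<in> R \<Longrightarrow> x \<in> A \<Longrightarrow> r * x \<in> K"
    and S: "S \<subseteq> K"
  shows "J \<subseteq> K"
proof -
  have K_uminus: "- p \<in> K" if "p \<in> K" for p
    using K(4)[of "scalar (- 1)" p] that by (simp add: scalar_def single_uminus)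
  \<comment> \<open>The largest two-sided ideal inside the left ideal \<open>K\<close>. It contains
    \<open>R\<close>, hence all of \<open>I\<close>.\<close>
  let ?N = "{i \<in> A. \<forall>x \<in> A. i * x \<in> K}"
  have "ideal ?N (free_algebra X)"
  proof (rule idealI[OF ring_free_algebra])
    show "subgroup ?N (add_monoid (free_algebra X))"
    proof (rule FA.add.subgroupI)
      fix p assume p: "p \<in> ?N"
      have "\<ominus>\<^bsub>free_algebra X\<^esub> p = - p"
        using FA.minus_equality[of "- p" p] p by simp
      then show "\<ominus>\<^bsub>free_algebra X\<^esub> p \<in> ?N"
        using p K_uminus by simp
    qed (use K in \<open>auto simp: distrib_right\<close>)
  qed (use K in \<open>auto simp: mult.assoc\<close>)
  then have "I \<subseteq> ?N"
    unfolding I_def using R R_subset by (intro FA.genideal_minimal) auto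
  then have I: "I \<subseteq> K"
    by (metis (mono_tags, lifting) free_algebra_one mem_Collect_eq mult.right_neutral subset_iff)
  have mem: "p \<in> K" if "p \<in> A" "q \<in> K" "cls p = cls q" for p q
  proof -
    have "p - q \<in> K"
      using that(1,3) cls_eq_iff[OF that(1) subsetD[OF K(1) that(2)]] subsetD[OF I] by simp
    then show ?thesis
      using K(3)[of "p - q" q] that by simp
  qed
  have "gen_left_ideal Q (cls ` S) \<subseteq> cls ` K"
  proof (rule C.L_minimal)
    show "additive_subgroup (cls ` K) Q"
    proof (rule additive_subgroup.intro, rule Q.add.subgroupI)
      fix u assume "u \<in> cls ` K"
      then obtain p where p: "p \<in> K" "u = cls p" by blast
      have "\<ominus>\<^bsub>Q\<^esub> u = cls (- p)"
        using cls_diff[of 0 p] p K cls_zero Q.minus_zero cls_closed[of p]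
        by (simp add: a_minus_def subset_iff)
      then show "\<ominus>\<^bsub>Q\<^esub> u \<in> cls ` K"
        using p K_uminus by simp
    next
      fix u v assume "u \<in> cls ` K" "v \<in> cls ` K"
      then show "u \<oplus>\<^bsub>Q\<^esub> v \<in> cls ` K"
        using K(1,3) by (auto simp flip: cls_add simp: subset_iff)
    qed (use K in \<open>auto intro: cls_closed\<close>)
    show "r \<otimes>\<^bsub>Q\<^esub> u \<in> cls ` K" if "r \<in> carrier Q" "u \<in> cls ` K" for r u
      using that K(1,4) by (auto simp: carrier_Q subset_iff simp flip: cls_mult)
  qed (use S in auto)
  then show ?thesis
    using mem by (auto simp: J_def)
qed

text \<open>The hypotheses of \<open>cyclic_left_module_over_field\<close>, expressed by
  representatives in the free algebra.\<close>

theorem End_and_indecomposable: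
  assumes one: "1 \<notin> J"
    and ann: "\<And>p. p \<in> A \<Longrightarrow> (\<And>s. s \<in> S \<Longrightarrow> s * p \<in> J) \<Longrightarrow> \<exists>c. p - scalar c \<in> J"
  shows "one_dimensional (End_space (presented_scalar X R) Q (cyclic_module Q (cls ` S)))"
    and "indecomposable_module Q (cyclic_module Q (cls ` S))"
proof -
  let ?L = "gen_left_ideal Q (cls ` S)" and ?\<eta> = "presented_scalar X R"
  interpret F: cyclic_left_module_over_field Q "cls ` S" ?L "cyclic_module Q (cls ` S)" ?\<eta>
  proof unfold_locales
    show "\<one>\<^bsub>Q\<^esub> \<notin> ?L"
      using one by (simp add: J_def cls_one)
    fix c d
    show "?\<eta> c \<in> carrier Q" "?\<eta> 1 = \<one>\<^bsub>Q\<^esub>" "?\<eta> (c + d) = ?\<eta> c \<oplus>\<^bsub>Q\<^esub> ?\<eta> d"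
      "?\<eta> (c * d) = ?\<eta> c \<otimes>\<^bsub>Q\<^esub> ?\<eta> d"
      by (simp_all add: presented_scalar_def cls_closed scalar_one cls_one scalar_add cls_add
          scalar_mult cls_mult)
    fix x assume x: "x \<in> carrier Q"
    then obtain p where p: "p \<in> A" "x = cls p" by (auto simp: carrier_Q)
    show "?\<eta> c \<otimes>\<^bsub>Q\<^esub> x = x \<otimes>\<^bsub>Q\<^esub> ?\<eta> c"
      using p by (simp add: presented_scalar_def scalar_commute flip: cls_mult)
    assume *: "\<And>r. r \<in> cls ` S \<Longrightarrow> r \<otimes>\<^bsub>Q\<^esub> x \<in> ?L"
    have "s * p \<in> J" if "s \<in> S" for s
      using *[of "cls s"] that p S_subset by (auto simp: J_def cls_mult)
    then obtain c where "p - scalar c \<in> J"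
      using ann p by blast
    then show "\<exists>c. x \<ominus>\<^bsub>Q\<^esub> ?\<eta> c \<in> ?L"
      using p by (intro exI[of _ c]) (simp add: J_def cls_diff presented_scalar_def)
  qed
  show "one_dimensional (End_space ?\<eta> Q (cyclic_module Q (cls ` S)))"
    by (rule F.one_dimensional_E)
  show "indecomposable_module Q (cyclic_module Q (cls ` S))"
    by (rule F.indecomposable)
qed

end

section \<open>A representation of the Brundan--Kleshchev algebra\<close>

lemma opE_cong:
  assumes "p \<noteq> q"
    and "\<And>T'. (\<And>j. j \<noteq> p \<Longrightarrow> j \<noteq> q \<Longrightarrow> T' j = T j) \<Longrightarrow> T p \<noteq> T q \<Longrightarrow> T' p \<noteq> T' q \<Longrightarrow> g T' = h T'"
  shows "opE p q g T = opE p q h T"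
  using assms(1) by (auto simp: opE_def intro!: assms(2))

lemma opF_cong:
  assumes "p \<noteq> q"
    and "\<And>T'. (\<And>j. j \<noteq> p \<Longrightarrow> j \<noteq> q \<Longrightarrow> T' j = T j) \<Longrightarrow> T p \<noteq> T q \<Longrightarrow> T' p \<noteq> T' q \<Longrightarrow> g T' = h T'"
  shows "opF p q g T = opF p q h T"
  using assms(1) by (auto simp: opF_def intro!: assms(2))

text \<open>Each summand of \<open>opB\<close> changes one letter in either slot, so both slots
  switch between pure and mixed.\<close>

lemma opB_cong:
  assumes "distinct [p, q, r, s]"
    and g: "\<And>T'. (\<And>j. j \<notin> {p, q, r, s} \<Longrightarrow> T' j = T j) \<Longrightarrow> (T' p \<noteq> T' q) = (T p = T q) \<Longrightarrow>
      (T' r \<noteq> T' s) = (T r = T s) \<Longrightarrow> g T' = h T'"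
  shows "opB p q r s g T = opB p q r s h T"
proof -
  have "distinct [s, r, q, p]"
    using assms(1) by auto
  note neq = assms(1)[simplified] this[simplified]
  show ?thesis
    using neq unfolding opB_def opE_def opF_def
    by (intro if_cong refl arg_cong2[where f = plus] arg_cong[where f = uminus] g) auto
qed

text \<open>The parity of the number of mixed slots before slot \<open>m\<close>. The test
  \<open>m \<noteq> 0\<close> skips the positions 0 and 1, which form no slot.\<close>

primrec sg :: "(nat \<Rightarrow> bool) \<Rightarrow> nat \<Rightarrow> bool" where
  "sg T 0 = False"
| "sg T (Suc m) = (m \<noteq> 0 \<and> (sg T m \<noteq> (T (2 * m) \<noteq> T (2 * m + 1))))"

text \<open>At an odd position the legs and the arms passed so far, not counting the corner, have
  equal parity, and this parity is the residue whichever letter stands there. The residue at 2m is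
  the opposite of the one at 2m - 1. Hence only the purity of slots matters.\<close>

definition word_res :: "nat \<Rightarrow> (nat \<Rightarrow> bool) \<Rightarrow> nat \<Rightarrow> nat" where
  "word_res n T = (\<lambda>k \<in> {1..n}. of_bool (if even k then \<not> sg T (k div 2) else sg T (Suc k div 2)))"

lemma sg_eqI:
  assumes "\<And>m. m \<noteq> 0 \<Longrightarrow> (T' (2 * m) = T' (2 * m + 1)) = (T (2 * m) = T (2 * m + 1))"
  shows "sg T' k = sg T k"
  using assms by (induction k) auto

text \<open>The changes of purity in two adjacent slots cancel in all later parities, so only the
  parity between the two slots changes.\<close>

lemma sg_flip:
  assumes "m \<noteq> 0" "\<And>j. j \<notin> {2 * m, 2 * m + 1, 2 * m + 2, 2 * m + 3} \<Longrightarrow> T' j = T j"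
    and "(T' (2 * m) \<noteq> T' (2 * m + 1)) = (T (2 * m) = T (2 * m + 1))"
    and "(T' (2 * m + 2) \<noteq> T' (2 * m + 3)) = (T (2 * m + 2) = T (2 * m + 3))"
  shows "sg T' k = (sg T k \<noteq> (k = Suc m))"
proof (induction k)
  case (Suc k)
  consider "k = m" | "k = Suc m" | "k \<noteq> m" "k \<noteq> Suc m" by blast
  then show ?case
  proof cases
    case 3
    then have "2 * k \<notin> {2 * m, 2 * m + 1, 2 * m + 2, 2 * m + 3}"
      "2 * k + 1 \<notin> {2 * m, 2 * m + 1, 2 * m + 2, 2 * m + 3}"
      using 3 by (simp; presburger)+
    then show ?thesis
      using 3 Suc assms(2) by simp
  qed (use Suc assms in \<open>auto simp: numeral_3_eq_3\<close>)
qed simp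

lemma word_res_mixed:
  assumes "m \<noteq> 0" "\<And>j. j \<noteq> 2 * m \<Longrightarrow> j \<noteq> 2 * m + 1 \<Longrightarrow> T' j = T j"
    and "T (2 * m) \<noteq> T (2 * m + 1)" "T' (2 * m) \<noteq> T' (2 * m + 1)"
  shows "word_res n T' = word_res n T"
proof -
  have "(T' (2 * k) = T' (2 * k + 1)) = (T (2 * k) = T (2 * k + 1))" for k
  proof (cases "k = m")
    case False
    then have "2 * k \<noteq> 2 * m" "2 * k + 1 \<noteq> 2 * m" "2 * k \<noteq> 2 * m + 1" "2 * k + 1 \<noteq> 2 * m + 1"
      by presburger+
    then show ?thesis
      using assms(2) by simp
  qed (use assms in auto)
  then have "sg T' = sg T"
    by (intro ext sg_eqI)
  then show ?thesis
    by (simp add: word_res_def cong: if_cong)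
qed

text \<open>The residues at 2m + 1 and 2m + 2 are opposite and both determined by \<open>sg\<close>
  at \<open>Suc m\<close>; reversing that value exchanges them.\<close>

lemma word_res_flip:
  assumes m: "m \<noteq> 0" "2 * m + 1 < n" 
    and T': "\<And>j. j \<notin> {2 * m, 2 * m + 1, 2 * m + 2, 2 * m + 3} \<Longrightarrow> T' j = T j"
    "(T' (2 * m) \<noteq> T' (2 * m + 1)) = (T (2 * m) = T (2 * m + 1))"
    "(T' (2 * m + 2) \<noteq> T' (2 * m + 3)) = (T (2 * m + 2) = T (2 * m + 3))"
  shows "word_res n T' = word_res n T \<circ> Transposition.transpose (2 * m + 1) (2 * m + 2)"
proof
  fix k
  have sg: "sg T' k = (sg T k \<noteq> (k = Suc m))" for k
    by (rule sg_flip) (use m T' in auto)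
  consider "k = 2 * m + 1" | "k = 2 * m + 2" | "k \<noteq> 2 * m + 1" "k \<noteq> 2 * m + 2" by blast
  then show "word_res n T' k = (word_res n T \<circ> Transposition.transpose (2 * m + 1) (2 * m + 2)) k"
  proof cases
    case 3
    have "sg T' (k div 2) = sg T (k div 2)" if "even k"
      using that 3 unfolding sg by (auto elim!: evenE)
    moreover have "sg T' (Suc k div 2) = sg T (Suc k div 2)" if "odd k"
      using that 3 unfolding sg by (auto elim!: oddE)
    ultimately show ?thesis
      using 3 by (cases "even k") (simp_all add: word_res_def transpose_def del: sg.simps)
  qed (use m in \<open>simp_all add: word_res_def sg transpose_def del: sg.simps\<close>)
qed

lemma word_res_even_odd:
  assumes "m \<noteq> 0" "2 * m < n"
  shows "word_res n T (2 * m) = word_res n T (2 * m + 1) \<longleftrightarrow> T (2 * m) \<noteq> T (2 * m + 1)"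
  using assms by (auto simp: word_res_def)

lemma word_res_odd_even:
  assumes "2 * m + 1 < n"
  shows "word_res n T (2 * m + 1) \<noteq> word_res n T (2 * m + 2)"
  using assms by (auto simp: word_res_def)

lemma word_res_one: "word_res n T 1 = 0 \<or> n = 0"
  by (auto simp: word_res_def)

lemma word_res_mem: "word_res n T \<in> res_seqs n"
  by (auto simp: word_res_def res_seqs_def)

section \<open>Operators of the generators and their effect on residue sequences\<close>

definition opR :: "nat \<Rightarrow> (nat \<Rightarrow> nat) \<Rightarrow> ((nat \<Rightarrow> bool) \<Rightarrow> 'f::field) \<Rightarrow> (nat \<Rightarrow> bool) \<Rightarrow> 'f" where
  "opR n i f T = (if word_res n T = i then f T else 0)"

text \<open>Position 1 belongs to no slot, so y_1 and psi_1 act as zero.\<close>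

definition opY :: "nat \<Rightarrow> ((nat \<Rightarrow> bool) \<Rightarrow> 'f::field) \<Rightarrow> (nat \<Rightarrow> bool) \<Rightarrow> 'f" where
  "opY r f T = (if r \<le> 1 then 0 else if even r then - opE r (r + 1) f T else opE (r - 1) r f T)"

definition opPsi :: "nat \<Rightarrow> ((nat \<Rightarrow> bool) \<Rightarrow> 'f::field) \<Rightarrow> (nat \<Rightarrow> bool) \<Rightarrow> 'f" where
  "opPsi r f T = (if r \<le> 1 then 0 else if even r then opF r (r + 1) f T
     else opB (r - 1) r (r + 1) (r + 2) f T)"

primrec rep :: "nat \<Rightarrow> klr_gen \<Rightarrow> ((nat \<Rightarrow> bool) \<Rightarrow> 'f::field) \<Rightarrow> (nat \<Rightarrow> bool) \<Rightarrow> 'f" where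
  "rep n (GenY r) = opY r"
| "rep n (GenPsi r) = opPsi r"
| "rep n (GenE i) = opR n i"

lemma opE_linear:
  "opE p q (\<lambda>T. f T + h T) = (\<lambda>T. opE p q f T + opE p q h T)"
  "opE p q (\<lambda>T. c * f T) = (\<lambda>T. c * opE p q f T)"
  by (auto simp: opE_def)

lemma opF_linear:
  "opF p q (\<lambda>T. f T + h T) = (\<lambda>T. opF p q f T + opF p q h T)"
  "opF p q (\<lambda>T. c * f T) = (\<lambda>T. c * opF p q f T)"
  by (auto simp: opF_def)

lemma opB_linear:
  "opB p q r s (\<lambda>T. f T + h T) = (\<lambda>T. opB p q r s f T + opB p q r s h T)"
  "opB p q r s (\<lambda>T. c * f T) = (\<lambda>T. c * opB p q r s f T)"
  by (auto simp: opB_def opE_linear opF_linear algebra_simps)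

interpretation rep: linear_ops "rep n :: klr_gen \<Rightarrow> ((nat \<Rightarrow> bool) \<Rightarrow> 'f::field) \<Rightarrow> _" for n
proof
  fix g and f h :: "(nat \<Rightarrow> bool) \<Rightarrow> 'f" and c :: 'f and n
  show "rep n g (\<lambda>T. f T + h T) = (\<lambda>T. rep n g f T + rep n g h T)"
    by (cases g) (auto simp: opY_def opPsi_def opR_def opE_linear opF_linear opB_linear)
  show "rep n g (\<lambda>T. c * f T) = (\<lambda>T. c * rep n g f T)"
    by (cases g) (auto simp: opY_def opPsi_def opR_def opE_linear opF_linear opB_linear)
qed


lemma ops_zero [simp]:
  "opE p q (\<lambda>T. 0) = (\<lambda>T. 0)" "opF p q (\<lambda>T. 0) = (\<lambda>T. 0)" "opB p q r s (\<lambda>T. 0) = (\<lambda>T. 0)"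
  "opY k (\<lambda>T. 0) = (\<lambda>T. 0)" "opPsi k (\<lambda>T. 0) = (\<lambda>T. 0)" "opR n i (\<lambda>T. 0) = (\<lambda>T. 0)"
  by (auto simp: opE_def opF_def opB_def opY_def opPsi_def opR_def)

lemma opE_uminus: "opE p q (\<lambda>T. - f T) = (\<lambda>T. - opE p q f T)"
  by (auto simp: opE_def)

lemma opF_uminus: "opF p q (\<lambda>T. - f T) = (\<lambda>T. - opF p q f T)"
  by (auto simp: opF_def)

lemma opB_uminus: "opB p q r s (\<lambda>T. - f T) = (\<lambda>T. - opB p q r s f T)"
  by (auto simp: opB_def opE_uminus opF_uminus)

text \<open>\<open>opE\<close> connects only mixed states of one slot. These have the same residue
  sequence, so the condition on residues can be tested at \<open>T\<close> itself.\<close>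

lemma opE_opR: "m \<noteq> 0 \<Longrightarrow> opE (2 * m) (2 * m + 1) (opR n i f) T = opR n i (opE (2 * m) (2 * m + 1) f) T"
proof -
  assume "m \<noteq> 0"
  then have "opE (2 * m) (2 * m + 1) (opR n i f) T =
      opE (2 * m) (2 * m + 1) (\<lambda>T'. if word_res n T = i then f T' else 0) T"
  proof (intro opE_cong)
    fix T' assume "\<And>j. j \<noteq> 2 * m \<Longrightarrow> j \<noteq> 2 * m + 1 \<Longrightarrow> T' j = T j"
      "T (2 * m) \<noteq> T (2 * m + 1)" "T' (2 * m) \<noteq> T' (2 * m + 1)"
    from word_res_mixed[OF \<open>m \<noteq> 0\<close> this]
    show "opR n i f T' = (if word_res n T = i then f T' else 0)"
      by (simp add: opR_def)
  qed simp
  then show ?thesis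
    by (auto simp: opR_def)
qed

lemma opF_opR: "m \<noteq> 0 \<Longrightarrow> opF (2 * m) (2 * m + 1) (opR n i f) T = opR n i (opF (2 * m) (2 * m + 1) f) T"
proof -
  assume "m \<noteq> 0"
  then have "opF (2 * m) (2 * m + 1) (opR n i f) T =
      opF (2 * m) (2 * m + 1) (\<lambda>T'. if word_res n T = i then f T' else 0) T"
  proof (intro opF_cong)
    fix T' assume "\<And>j. j \<noteq> 2 * m \<Longrightarrow> j \<noteq> 2 * m + 1 \<Longrightarrow> T' j = T j"
      "T (2 * m) \<noteq> T (2 * m + 1)" "T' (2 * m) \<noteq> T' (2 * m + 1)"
    from word_res_mixed[OF \<open>m \<noteq> 0\<close> this]
    show "opR n i f T' = (if word_res n T = i then f T' else 0)"
      by (simp add: opR_def)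
  qed simp
  then show ?thesis
    by (auto simp: opR_def)
qed

lemma opB_opR:
  assumes "m \<noteq> 0" "2 * m + 1 < n"
  shows "opB (2 * m) (2 * m + 1) (2 * m + 2) (2 * m + 3) (opR n i f) T =
    opR n (i \<circ> Transposition.transpose (2 * m + 1) (2 * m + 2))
      (opB (2 * m) (2 * m + 1) (2 * m + 2) (2 * m + 3) f) T"
proof -
  let ?t = "Transposition.transpose (2 * m + 1) (2 * m + 2)"
  have t: "i' \<circ> ?t = i \<longleftrightarrow> i' = i \<circ> ?t" for i' :: "nat \<Rightarrow> nat"
    by (metis comp_assoc comp_id transpose_comp_involutory)
  have "opB (2 * m) (2 * m + 1) (2 * m + 2) (2 * m + 3) (opR n i f) T =
      opB (2 * m) (2 * m + 1) (2 * m + 2) (2 * m + 3) (\<lambda>T'. if word_res n T = i \<circ> ?t then f T' else 0) T"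
  proof (intro opB_cong)
    fix T' assume "\<And>j. j \<notin> {2 * m, 2 * m + 1, 2 * m + 2, 2 * m + 3} \<Longrightarrow> T' j = T j"
      "(T' (2 * m) \<noteq> T' (2 * m + 1)) = (T (2 * m) = T (2 * m + 1))"
      "(T' (2 * m + 2) \<noteq> T' (2 * m + 3)) = (T (2 * m + 2) = T (2 * m + 3))"
    then have "word_res n T' = word_res n T \<circ> ?t"
      by (rule word_res_flip[OF assms])
    then show "opR n i f T' = (if word_res n T = i \<circ> ?t then f T' else 0)"
      by (simp only: opR_def t)
  qed simp
  then show ?thesis
    by (auto simp: opR_def)
qed

text \<open>\<open>opF\<close> is nonzero only at a mixed slot, where the two residues agree and the
  transposition fixes the sequence.\<close>

lemma opF_opR_transpose:
  assumes "m \<noteq> 0" "2 * m < n"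
  shows "opF (2 * m) (2 * m + 1) (opR n i f) T =
    opR n (i \<circ> Transposition.transpose (2 * m) (2 * m + 1)) (opF (2 * m) (2 * m + 1) f) T"
proof (cases "T (2 * m) = T (2 * m + 1)")
  case True
  then show ?thesis
    by (auto simp: opF_def opR_def)
next
  case False
  have "word_res n T (2 * m) = word_res n T (2 * m + 1)"
    using False assms word_res_even_odd by blast
  then have "word_res n T \<circ> Transposition.transpose (2 * m) (2 * m + 1) = word_res n T"
    by (auto simp: fun_eq_iff transpose_def)
  then have "word_res n T = i \<circ> Transposition.transpose (2 * m) (2 * m + 1) \<longleftrightarrow> word_res n T = i"
    by (metis comp_assoc comp_id transpose_comp_involutory)
  then show ?thesis
    unfolding opF_opR[OF assms(1)] by (simp add: opR_def)
qed

lemmas act_rep_simps =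
  rep.act_gen rep.act_mult rep.act_zero rep.act_one rep.act_add rep.act_diff rep.act_uminus
  rep.act_two

section \<open>Relations between the operators of slots\<close>

definition slotE :: "nat \<Rightarrow> ((nat \<Rightarrow> bool) \<Rightarrow> 'f::field) \<Rightarrow> (nat \<Rightarrow> bool) \<Rightarrow> 'f" where
  "slotE m = opE (2 * m) (2 * m + 1)"

definition slotF :: "nat \<Rightarrow> ((nat \<Rightarrow> bool) \<Rightarrow> 'f::field) \<Rightarrow> (nat \<Rightarrow> bool) \<Rightarrow> 'f" where
  "slotF m = opF (2 * m) (2 * m + 1)"

definition slotB :: "nat \<Rightarrow> ((nat \<Rightarrow> bool) \<Rightarrow> 'f::field) \<Rightarrow> (nat \<Rightarrow> bool) \<Rightarrow> 'f" where
  "slotB m = opB (2 * m) (2 * m + 1) (2 * m + 2) (2 * m + 3)"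

lemma slotE_slotE: "slotE m (slotE m f) T = 0"
  by (simp add: slotE_def opE_opE)

lemma distinct_slots:
  "m \<noteq> k \<Longrightarrow> distinct [2 * m, 2 * m + 1, 2 * k, 2 * k + 1 :: nat]"
  "k \<noteq> m \<Longrightarrow> k \<noteq> m + 1 \<Longrightarrow> distinct [2 * m, 2 * m + 1, 2 * m + 2, 2 * m + 3, 2 * k, 2 * k + 1 :: nat]"
  "k \<noteq> m \<Longrightarrow> k \<noteq> m + 1 \<Longrightarrow> m \<noteq> k + 1 \<Longrightarrow>
    distinct [2 * m, 2 * m + 1, 2 * m + 2, 2 * m + 3, 2 * k, 2 * k + 1, 2 * k + 2, 2 * k + 3 :: nat]"
  "distinct [2 * m, 2 * m + 1, 2 * m + 2, 2 * m + 3 :: nat]"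
  "distinct [2 * m, 2 * m + 1, 2 * m + 2, 2 * m + 3, 2 * m + 4, 2 * m + 5 :: nat]"
  by (simp_all; presburger)+

lemma next_slot: "2 * (m + 1) = (2 * m + 2 :: nat)" "2 * m + 2 + 1 = (2 * m + 3 :: nat)"
  by simp_all

lemma slotE_commute: "slotE m (slotE k f) T = slotE k (slotE m f) T"
  unfolding slotE_def using opE_opE_commute[OF distinct_slots(1)] by (cases "m = k") auto

lemma slotF_slotF: "slotF m (slotF m f) T = 0"
  by (simp add: slotF_def opF_opF)

lemma slotF_commute: "slotF m (slotF k f) T = slotF k (slotF m f) T"
  unfolding slotF_def using opF_opF_commute[OF distinct_slots(1)] by (cases "m = k") auto

lemma slotE_slotF_commute: "m \<noteq> k \<Longrightarrow> slotE m (slotF k f) T = slotF k (slotE m f) T"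
  unfolding slotE_def slotF_def by (rule opE_opF_commute[OF distinct_slots(1)])

lemma slotF_slotE:
  "slotF m (slotE m f) T = (if T (2 * m) = T (2 * m + 1) then 0 else f T) - slotE m (slotF m f) T"
  unfolding slotE_def slotF_def eq_diff_eq by (subst add.commute, rule opE_opF) simp

lemma slotE_slotB: "k = m \<or> k = m + 1 \<Longrightarrow> slotE k (slotB m f) T = 0"
  unfolding slotE_def slotB_def using opE_opB[OF distinct_slots(4)[of m]] by (auto simp: numeral_3_eq_3)

lemma slotB_slotE: "k = m \<or> k = m + 1 \<Longrightarrow> slotB m (slotE k f) T = 0"
  unfolding slotE_def slotB_def using opB_opE[OF distinct_slots(4)[of m]] by (auto simp: numeral_3_eq_3)

lemma slotB_slotE_commute: "slotB m (slotE k f) T = slotE k (slotB m f) T"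
proof (cases "k = m \<or> k = m + 1")
  case False
  then show ?thesis
    unfolding slotE_def slotB_def by (intro opB_opE_commute distinct_slots(2)) auto
qed (simp add: slotE_slotB slotB_slotE)

lemma slotB_slotF_commute: "k \<noteq> m \<Longrightarrow> k \<noteq> m + 1 \<Longrightarrow> slotB m (slotF k f) T = slotF k (slotB m f) T"
  unfolding slotF_def slotB_def by (rule opB_opF_commute[OF distinct_slots(2)])

lemma slotB_slotB: "slotB m (slotB m f) T = - 2 * slotE m (slotE (m + 1) f) T"
  unfolding slotE_def slotB_def using opB_opB[OF distinct_slots(4)[of m]] by (simp add: numeral_3_eq_3)

lemma slotB_commute: "slotB m (slotB k f) T = slotB k (slotB m f) T"
proof -
  have near: "slotB m (slotB (m + 1) f) T = slotB (m + 1) (slotB m f) T" for m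
    unfolding slotB_def using opB_opB_near[OF distinct_slots(5)[of m]] by (simp add: numeral_eq_Suc)
  consider "m = k" | "m = k + 1" | "k = m + 1" | "k \<noteq> m" "k \<noteq> m + 1" "m \<noteq> k + 1" by blast
  then show ?thesis
  proof cases
    case 4
    then show ?thesis
      unfolding slotB_def by (intro opB_opB_commute distinct_slots(3))
  qed (simp_all add: near[simplified])
qed

lemma slotF_slotB_slotF:
  "slotF m (slotB m (slotF m f)) T = slotB m (slotF m (slotB m f)) T -
     (if T (2 * m) = T (2 * m + 1) then slotE (m + 1) f T else 0)"
  unfolding slotE_def slotF_def slotB_def next_slot by (rule opF_opB_opF[OF distinct_slots(4)])

lemma slotB_slotF_slotB:
  "slotB m (slotF (m + 1) (slotB m f)) T = slotF (m + 1) (slotB m (slotF (m + 1) f)) T +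
     (if T (2 * m + 2) = T (2 * m + 3) then slotE m f T else 0)"
  unfolding slotE_def slotF_def slotB_def next_slot by (rule opB_opF_opB[OF distinct_slots(4)])

lemma slot_zero [simp]:
  "slotE m (\<lambda>T. 0) = (\<lambda>T. 0)" "slotF m (\<lambda>T. 0) = (\<lambda>T. 0)" "slotB m (\<lambda>T. 0) = (\<lambda>T. 0)"
  by (simp_all add: slotE_def slotF_def slotB_def)

lemma slot_uminus:
  "slotE m (\<lambda>T. - f T) = (\<lambda>T. - slotE m f T)" "slotF m (\<lambda>T. - f T) = (\<lambda>T. - slotF m f T)"
  "slotB m (\<lambda>T. - f T) = (\<lambda>T. - slotB m f T)"
  by (simp_all add: slotE_def slotF_def slotB_def opE_uminus opF_uminus opB_uminus)

lemma slot_add: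
  "slotE m (\<lambda>T. f T + g T) = (\<lambda>T. slotE m f T + slotE m g T)"
  "slotE m (\<lambda>T. f T - g T) = (\<lambda>T. slotE m f T - slotE m g T)"
  by (auto simp: slotE_def opE_def)

lemma opY_simps:
  "opY 0 f = (\<lambda>T. 0)" "opY (Suc 0) f = (\<lambda>T. 0)"
  "m \<noteq> 0 \<Longrightarrow> opY (2 * m) f = (\<lambda>T. - slotE m f T)"
  "m \<noteq> 0 \<Longrightarrow> opY (Suc (2 * m)) f = slotE m f"
  "opY (Suc (Suc (2 * m))) f = (\<lambda>T. - slotE (Suc m) f T)"
  "opY (Suc (Suc (Suc (2 * m)))) f = slotE (Suc m) f"
  by (rule ext, simp add: opY_def slotE_def)+

lemma opPsi_simps:
  "opPsi 0 f = (\<lambda>T. 0)" "opPsi (Suc 0) f = (\<lambda>T. 0)"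
  "m \<noteq> 0 \<Longrightarrow> opPsi (2 * m) f = slotF m f"
  "m \<noteq> 0 \<Longrightarrow> opPsi (Suc (2 * m)) f = slotB m f"
  "opPsi (Suc (Suc (2 * m))) f = slotF (Suc m) f"
  "opPsi (Suc (Suc (Suc (2 * m)))) f = slotB (Suc m) f"
  by (rule ext, simp add: opPsi_def slotF_def slotB_def numeral_3_eq_3)+

lemma index_cases [case_names zero one even odd]:
  fixes r :: nat
  obtains "r = 0" | "r = 1" | m where "m \<noteq> 0" "r = 2 * m" | m where "m \<noteq> 0" "r = Suc (2 * m)"
proof -
  have "r = 2 * (r div 2) \<or> r = Suc (2 * (r div 2))" "r \<noteq> 1 \<Longrightarrow> r \<noteq> 0 \<Longrightarrow> r div 2 \<noteq> 0"
    by auto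
  then show thesis
    using that by metis
qed

lemma opY_opY: "opY s (opY r f) T = opY r (opY s f) T"
  by (cases r rule: index_cases; cases s rule: index_cases)
     (simp_all add: opY_simps slot_uminus slotE_commute)

lemma opY_opPsi:
  assumes "s \<noteq> r" "s \<noteq> r + 1"
  shows "opY s (opPsi r f) T = opPsi r (opY s f) T"
  using assms
  by (cases r rule: index_cases; cases s rule: index_cases)
     (auto simp: opY_simps opPsi_simps slot_uminus slotE_slotF_commute slotB_slotE_commute)

lemma opPsi_opPsi:
  assumes "s \<noteq> r + 1" "r \<noteq> s + 1"
  shows "opPsi s (opPsi r f) T = opPsi r (opPsi s f) T"
  using assms
  by (cases r rule: index_cases; cases s rule: index_cases)
     (auto simp: opPsi_simps slotF_commute slotB_commute slotB_slotF_commute)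

section \<open>The defining relations hold in the representation\<close>

lemma slotE_opR: "m \<noteq> 0 \<Longrightarrow> slotE m (opR n i f) T = opR n i (slotE m f) T"
  unfolding slotE_def by (rule opE_opR)

lemma opR_even:
  "m \<noteq> 0 \<Longrightarrow> 2 * m < n \<Longrightarrow>
    opR n i f T = 0 \<or> (T (2 * m) = T (Suc (2 * m)) \<longleftrightarrow> i (2 * m) \<noteq> i (Suc (2 * m)))"
  using word_res_even_odd[of m n T] by (auto simp: opR_def)

lemma opR_odd:
  "Suc (2 * m) < n \<Longrightarrow> i (Suc (2 * m)) = i (Suc (Suc (2 * m))) \<Longrightarrow> opR n i f = (\<lambda>T. 0)"
  using word_res_odd_even[of m n] by (intro ext) (auto simp: opR_def)

lemma slotE_opR_pure:
  assumes "m \<noteq> 0" "2 * m < n" "i (2 * m) \<noteq> i (Suc (2 * m))"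
  shows "slotE m (opR n i f) = (\<lambda>T. 0)"
proof
  fix T
  have "opR n i f (T(2 * m := True, 2 * m + 1 := False)) = 0"
    using opR_even[of m n i f "T(2 * m := True, 2 * m + 1 := False)"] assms by simp
  then show "slotE m (opR n i f) T = 0"
    by (simp add: slotE_def opE_def)
qed

text \<open>The operator of slot \<open>k\<close> does not touch slot \<open>m\<close>, so a purity
  there that contradicts \<open>i\<close> persists in the word that is read.\<close>

lemma slotE_opR_other:
  assumes "m \<noteq> 0" "2 * m < n" "k \<noteq> m"
    and "T (2 * m) = T (Suc (2 * m)) \<longleftrightarrow> i (2 * m) = i (Suc (2 * m))"
  shows "slotE k (opR n i f) T = 0"
proof -
  let ?T = "T(2 * k := True, 2 * k + 1 := False)"
  have "2 * m \<noteq> Suc (2 * k)"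
    by presburger
  then have "opR n i f ?T = 0"
    using opR_even[of m n i f ?T] assms by auto
  then show ?thesis
    by (simp add: slotE_def opE_def)
qed

text \<open>The index r is 1, even or odd. For odd r the residues at r and r + 1 always differ, so
  the relations with equal residues are void; for even r they tell whether a slot is pure, which
  decides which of the terms \<open>slotE\<close> survive.\<close>

lemma rep_rel:
  fixes f :: "(nat \<Rightarrow> bool) \<Rightarrow> 'f::field"
  assumes "n \<noteq> 0" "x \<in> klr_rels n"
  shows "act (rep n) x f T = 0"
  using assms(2)
proof cases
  case y_one
  then show ?thesis by (simp add: act_rep_simps opY_def)
next
  case (e_one i)
  then show ?thesis using word_res_one[of n T] assms(1)
    by (auto simp: act_rep_simps opR_def)
next
  case (e_orth i j)
  then show ?thesis by (auto simp: act_rep_simps opR_def)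
next
  case e_sum
  have "finite (res_seqs n)"
    by (auto simp: res_seqs_def intro: finite_PiE)
  then show ?thesis
    using word_res_mem[of n T]
    by (simp add: e_sum act_rep_simps rep.act_sum opR_def)
next
  case (y_e r i)
  have "opY r (opR n i f) T = opR n i (opY r f) T"
    by (cases r rule: index_cases)
       (simp_all add: opY_simps slotE_opR, simp_all add: opR_def)
  then show ?thesis
    by (simp add: y_e act_rep_simps)
next
  case (psi_e r i)
  from psi_e(2) have "r < n" by simp
  then have "opPsi r (opR n i f) T =
      opR n (i \<circ> Transposition.transpose r (r + 1)) (opPsi r f) T"
    by (cases r rule: index_cases)
       (simp_all add: opPsi_simps opF_opR_transpose[simplified] opB_opR[simplified] slotF_def slotB_def)
  then show ?thesis
    by (simp add: psi_e act_rep_simps)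
next
  case (y_y r s)
  then show ?thesis by (simp add: act_rep_simps opY_opY)
next
  case (y_psi_commute s r)
  then show ?thesis by (simp add: act_rep_simps opY_opPsi)
next
  case (psi_psi r s)
  then show ?thesis
    by (simp add: act_rep_simps opPsi_opPsi)
next
  case (y_psi r i)
  let ?g = "opR n i f"
  have "r < n" using y_psi(2) by simp
  then show ?thesis
  proof (cases r rule: index_cases)
    case zero
    then show ?thesis using y_psi by simp
  next
    case one
    then show ?thesis
      using opR_odd[of 0 n i f] \<open>r < n\<close>
      by (auto simp: y_psi act_rep_simps opY_simps opPsi_simps numeral_2_eq_2)
  next
    case (even m)
    then show ?thesis
      using opR_even[of m n i f T] slotF_slotE[of m ?g T] \<open>r < n\<close>
      by (auto simp: y_psi act_rep_simps opY_simps opPsi_simps split: if_splits)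
  next
    case (odd m)
    then show ?thesis
      using opR_odd[of m n i f] \<open>r < n\<close>
      by (auto simp: y_psi act_rep_simps opY_simps opPsi_simps slotE_slotB slotB_slotE slot_uminus)
  qed
next
  case (y_Suc_psi r i)
  let ?g = "opR n i f"
  have "r < n" using y_Suc_psi(2) by simp
  then show ?thesis
  proof (cases r rule: index_cases)
    case zero
    then show ?thesis using y_Suc_psi by simp
  next
    case one
    then show ?thesis
      using opR_odd[of 0 n i f] \<open>r < n\<close>
      by (auto simp: y_Suc_psi act_rep_simps opY_simps opPsi_simps numeral_2_eq_2)
  next
    case (even m)
    then show ?thesis
      using opR_even[of m n i f T] slotF_slotE[of m ?g T] \<open>r < n\<close>
      by (auto simp: y_Suc_psi act_rep_simps opY_simps opPsi_simps slot_uminus split: if_splits)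
  next
    case (odd m)
    then show ?thesis
      using opR_odd[of m n i f] \<open>r < n\<close>
      by (auto simp: y_Suc_psi act_rep_simps opY_simps opPsi_simps slotE_slotB slotB_slotE slot_uminus)
  qed
next
  case (psi_sq_eq r i)
  then show ?thesis
    using opR_odd[of "r div 2" n i f]
    by (cases r rule: index_cases)
       (simp_all add: power2_eq_square act_rep_simps opPsi_simps slotF_slotF)
next
  case (psi_sq_neq r i)
  from psi_sq_neq have "r < n" by simp
  then show ?thesis
  proof (cases r rule: index_cases)
    case zero
    then show ?thesis using psi_sq_neq by simp
  next
    case one
    \<comment> \<open>Here psi_1 and y_1 act as zero, and y_2 is minus an operator of square
      zero.\<close>
    then show ?thesis
      by (simp add: opY_simps(5)[of 0, simplified] psi_sq_neq power2_eq_square act_rep_simps[abs_def] opY_simps opPsi_simps slot_uminus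
          slotE_slotE numeral_2_eq_2)
  next
    case (even m)
    then show ?thesis
      using slotE_opR_pure[of m n i f] psi_sq_neq(4) \<open>r < n\<close>
      by (simp add: psi_sq_neq power2_eq_square act_rep_simps[abs_def] opY_simps opPsi_simps slot_uminus
          slotE_slotE slotF_slotF)
  next
    case (odd m)
    then show ?thesis
      by (simp add: psi_sq_neq power2_eq_square act_rep_simps[abs_def] opY_simps opPsi_simps slot_uminus
          slotE_slotE slotB_slotB slot_add slotE_commute[of "Suc m" m])
  qed
next
  case (psi_braid r i)
  let ?g = "opR n i f"
  from psi_braid show ?thesis
  proof (cases r rule: index_cases)
    case (even m)
    have "slotF m (slotB m (slotF m ?g)) T = slotB m (slotF m (slotB m ?g)) T"
    proof (cases "i (2 * m) = i (Suc (2 * m))")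
      case True
      then have "T (2 * m) = T (Suc (2 * m)) \<Longrightarrow> slotE (m + 1) ?g T = 0"
        using even psi_braid by (intro slotE_opR_other[where m = m]) auto
      then show ?thesis
        using slotF_slotB_slotF[of m ?g T] by simp
    next
      case False
      then show ?thesis
        using opR_odd[of m n i f] even psi_braid by simp
    qed
    then show ?thesis
      using even by (simp add: psi_braid act_rep_simps opPsi_simps)
  next
    case (odd m)
    have "slotB m (slotF (m + 1) (slotB m ?g)) T = slotF (m + 1) (slotB m (slotF (m + 1) ?g)) T"
    proof (cases "i (2 * m + 2) = i (2 * m + 3)")
      case True
      then have "T (2 * m + 2) = T (2 * m + 3) \<Longrightarrow> slotE m ?g T = 0"
        using odd psi_braid by (intro slotE_opR_other[where m = "m + 1"]) (auto simp: numeral_3_eq_3)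
      then show ?thesis
        using slotB_slotF_slotB[of m ?g T] by simp
    next
      case False
      then show ?thesis
        using opR_odd[of m n i f] odd psi_braid by (simp add: numeral_3_eq_3)
    qed
    then show ?thesis
      using odd by (simp add: psi_braid act_rep_simps opPsi_simps)
  qed (auto simp: act_rep_simps opPsi_simps)
next
  case (psi_braid_neq r i)
  let ?g = "opR n i f"
  from psi_braid_neq show ?thesis
  proof (cases r rule: index_cases)
    case one
    \<comment> \<open>Since psi_1 and y_1 act as zero, what remains is - 2 y_2 + y_3, which is three
      times \<open>slotE 1\<close>. It vanishes because the residues at 2 and 3 differ, so that slot
      1 is pure.\<close>
    have "slotE 1 ?g = (\<lambda>T. 0)"
      using one psi_braid_neq by (intro slotE_opR_pure) (auto simp: numeral_2_eq_2 numeral_3_eq_3)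
    then show ?thesis
      by (simp add: opY_simps(5,6)[of 0, simplified] psi_braid_neq one act_rep_simps opPsi_simps opY_simps numeral_2_eq_2 numeral_3_eq_3)
  next
    case (even m)
    have 1: "slotE m ?g = (\<lambda>T. 0)"
      using even psi_braid_neq by (intro slotE_opR_pure) auto
    have "T (2 * m) \<noteq> T (Suc (2 * m)) \<Longrightarrow> slotE (m + 1) ?g T = 0"
      using even psi_braid_neq by (intro slotE_opR_other[where m = m]) auto
    then have "slotF m (slotB m (slotF m ?g)) T = slotB m (slotF m (slotB m ?g)) T - slotE (m + 1) ?g T"
      using slotF_slotB_slotF[of m ?g T] by (simp split: if_splits)
    then show ?thesis
      using even 1 by (simp add: psi_braid_neq act_rep_simps opPsi_simps opY_simps)
  next
    case (odd m)
    have 1: "slotE (m + 1) ?g = (\<lambda>T. 0)"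
      using odd psi_braid_neq by (intro slotE_opR_pure) auto
    have "T (2 * m + 2) \<noteq> T (2 * m + 3) \<Longrightarrow> slotE m ?g T = 0"
      using odd psi_braid_neq by (intro slotE_opR_other[where m = "m + 1"]) (auto simp: numeral_3_eq_3)
    then have "slotB m (slotF (m + 1) (slotB m ?g)) T =
        slotF (m + 1) (slotB m (slotF (m + 1) ?g)) T + slotE m ?g T"
      using slotB_slotF_slotB[of m ?g T] by (simp split: if_splits)
    then show ?thesis
      using odd 1 by (simp add: psi_braid_neq act_rep_simps opPsi_simps opY_simps)
  qed simp
qed

section \<open>Reduced words span the Specht module\<close>

lemma transpose_res_seqs:
  "i \<in> res_seqs n \<Longrightarrow> r \<in> {1..<n} \<Longrightarrow> i \<circ> Transposition.transpose r (r + 1) \<in> res_seqs n"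
  unfolding res_seqs_def
  by (auto simp: PiE_iff extensional_def transpose_def)

text \<open>The last parameter fixes the ground field, which the numbers do not mention.\<close>

locale even_hook =
  fixes a b n :: nat and field_type :: "'f::field itself"
  assumes even_a: "even a" and a_pos: "a > 0" and even_b: "even b" and b_pos: "b > 0"
    and n_eq: "n = a + b"
begin

text \<open>An even positive \<open>a\<close> is at least 2, so psi_{b+1} is among the
  generators.\<close>

lemma b_less: "b + 1 < n"
  using even_a a_pos by (auto simp: n_eq elim: evenE)

lemma y_el_closed: "r \<in> {1..n} \<Longrightarrow> y_el r \<in> carrier (free_algebra (klr_gens n))"
  by (intro free_algebra_gen) (simp add: klr_gens_def)

lemma psi_el_closed: "r \<in> {1..<n} \<Longrightarrow> psi_el r \<in> carrier (free_algebra (klr_gens n))"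
  by (intro free_algebra_gen) (simp add: klr_gens_def)

lemma e_el_closed: "i \<in> res_seqs n \<Longrightarrow> e_el i \<in> carrier (free_algebra (klr_gens n))"
  by (intro free_algebra_gen) (simp add: klr_gens_def)

lemma klr_rels_subset: "(klr_rels n :: (klr_gen, 'f) free_alg set) \<subseteq> carrier (free_algebra (klr_gens n))"
proof
  fix x :: "(klr_gen, 'f) free_alg"
  assume "x \<in> klr_rels n"
  then show "x \<in> carrier (free_algebra (klr_gens n))"
    by cases (use b_less transpose_res_seqs in
      \<open>auto intro!: free_algebra_diff free_algebra_mult free_algebra_add free_algebra_sum free_algebra_power
        free_algebra_uminus y_el_closed psi_el_closed e_el_closed\<close>)
qed

lemma specht_rels_subset:
  "(specht_rels a b :: (klr_gen, 'f) free_alg set) \<subseteq> carrier (free_algebra (klr_gens n))"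
  using b_less
  by (auto simp: specht_rels_def simp del: upt_Suc simp flip: n_eq
      intro!: y_el_closed psi_el_closed e_el_closed free_algebra_diff free_algebra_prod_list)

sublocale presented_module "klr_gens n" "klr_rels n" "specht_rels a b :: (klr_gen, 'f) free_alg set"
  by unfold_locales (rule klr_rels_subset specht_rels_subset)+

lemma specht_relI:
  "r \<in> {1..n} \<Longrightarrow> y_el r \<in> specht_rels a b"
  "i \<in> res_seqs n \<Longrightarrow> e_el i - (if i = hook_res_seq a b then 1 else 0) \<in> specht_rels a b"
  "r \<in> {1..<n} \<Longrightarrow> r \<noteq> b + 1 \<Longrightarrow> psi_el r \<in> specht_rels a b"
  unfolding specht_rels_def n_eq by blast+

lemmas closed [simp] = y_el_closed psi_el_closed e_el_closed
  y_el_closed[of "Suc 0", simplified] psi_el_closed[of "Suc 0", simplified]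

section \<open>Filtration of the Specht module by the length of products\<close>

definition mon :: "nat list \<Rightarrow> (klr_gen, 'f) free_alg" where
  "mon rs = prod_list (map psi_el rs)"

lemma mon_simps [simp]: "mon [] = 1" "mon (r # rs) = psi_el r * mon rs"
  by (simp_all add: mon_def)

lemma mon_closed: "set rs \<subseteq> {2..<n} \<Longrightarrow> mon rs \<in> A"
  by (induction rs) auto

text \<open>In terms of the Specht module, the span of all products of fewer than \<open>k\<close>
  factors psi_2, ..., psi_{n-1} applied to z. Because the bound is strict, \<open>U k\<close> is the
  space of error terms for products of length \<open>k\<close>. The factor psi_1 is left out since
  it is shown below to act as zero.\<close>

definition U :: "nat \<Rightarrow> (klr_gen, 'f) free_alg set" where
  "U k = fa.span (J \<union> {mon rs | rs. set rs \<subseteq> {2..<n} \<and> length rs < k})"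

lemma J_scale: "p \<in> J \<Longrightarrow> scalar c * p \<in> J"
  by (simp add: J_left)

lemma subspace_A: "fa.subspace A"
  by (simp add: fa.subspace_def)

lemma U_closed: "U k \<subseteq> A"
  unfolding U_def by (rule fa.span_minimal[OF _ subspace_A]) (use J_subset mon_closed in auto)

lemma U_mono: "k \<le> l \<Longrightarrow> U k \<subseteq> U l"
  unfolding U_def by (rule fa.span_mono) auto

lemma J_U: "p \<in> J \<Longrightarrow> p \<in> U k"
  unfolding U_def by (simp add: fa.span_base)

lemma mon_U: "set rs \<subseteq> {2..<n} \<Longrightarrow> length rs < k \<Longrightarrow> mon rs \<in> U k"
  unfolding U_def by (auto intro!: fa.span_base)

lemma U_add: "p \<in> U k \<Longrightarrow> q \<in> U k \<Longrightarrow> p + q \<in> U k"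
  unfolding U_def by (rule fa.span_add)

lemma U_diff: "p \<in> U k \<Longrightarrow> q \<in> U k \<Longrightarrow> p - q \<in> U k"
  unfolding U_def by (rule fa.span_diff)

lemma U_sum: "(\<And>i. i \<in> S \<Longrightarrow> f i \<in> U k) \<Longrightarrow> sum f S \<in> U k"
  unfolding U_def by (rule fa.span_sum)

lemma U_uminus: "p \<in> U k \<Longrightarrow> - p \<in> U k"
  unfolding U_def by (rule fa.span_neg)

lemma U_cong: "p - q \<in> J \<Longrightarrow> q \<in> U k \<Longrightarrow> p \<in> U k"
  using U_add[OF J_U, of "p - q" q] by simp

lemma left_mult_U:
  assumes "x \<in> A" "p \<in> U k"
    and "\<And>rs. set rs \<subseteq> {2..<n} \<Longrightarrow> length rs < k \<Longrightarrow> x * mon rs \<in> U l"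
  shows "x * p \<in> U l"
  unfolding U_def
proof (rule mult_left_span[where A = "J \<union> {mon rs | rs. set rs \<subseteq> {2..<n} \<and> length rs < k}"])
  fix q assume "q \<in> J \<union> {mon rs | rs. set rs \<subseteq> {2..<n} \<and> length rs < k}"
  then have "x * q \<in> U l"
    using assms J_left J_U by auto
  then show "x * q \<in> fa.span (J \<union> {mon rs | rs. set rs \<subseteq> {2..<n} \<and> length rs < l})"
    by (simp add: U_def)
qed (use assms in \<open>simp add: U_def\<close>)

lemma psi_U: "r \<in> {2..<n} \<Longrightarrow> p \<in> U k \<Longrightarrow> psi_el r * p \<in> U (Suc k)"
  by (rule left_mult_U[where k = k]) (use mon_U[of "r # _" "Suc k"] in auto)

text \<open>Moving e(i) to the right through each psi_r replaces i by s_r i, until the relation for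
  e(i) z applies: every product of psi applied to z is a weight vector.\<close>

lemma e_mon:
  assumes "i \<in> res_seqs n" "set rs \<subseteq> {2..<n}"
  shows "e_el i * mon rs \<in> J \<or> e_el i * mon rs - mon rs \<in> J"
  using assms
proof (induction rs arbitrary: i)
  case Nil
  have "e_el i - (if i = hook_res_seq a b then 1 else 0) \<in> J"
    using Nil subsetD[OF S_subset_J specht_relI(2)] by blast
  then show ?case
    by (auto split: if_splits)
next
  case (Cons r rs)
  let ?i = "i \<circ> Transposition.transpose r (r + 1)"
  have r: "r \<in> {1..<n}" and i: "?i \<in> res_seqs n"
    using Cons.prems transpose_res_seqs by auto
  have "?i \<circ> Transposition.transpose r (r + 1) = i"
    by (simp add: comp_assoc)
  then have "(psi_el r * e_el ?i - e_el i * psi_el r) * mon rs \<in> J"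
    using klr_rels.psi_e[OF r i, where 'f = 'f] mon_closed Cons.prems by (intro J_rel) auto
  then have *: "psi_el r * (e_el ?i * mon rs) - e_el i * mon (r # rs) \<in> J"
    by (simp add: algebra_simps)
  have "psi_el r \<in> A" using r by simp
  have "set rs \<subseteq> {2..<n}"
    using Cons.prems by simp
  from Cons.IH[OF i this] consider "e_el ?i * mon rs \<in> J" | "e_el ?i * mon rs - mon rs \<in> J"
    by blast
  then show ?case
  proof cases
    case 1
    then have "psi_el r * (e_el ?i * mon rs) \<in> J"
      by (rule J_left[OF \<open>psi_el r \<in> A\<close>])
    then show ?thesis
      using J_diff[OF _ *] by fastforce
  next
    case 2
    then have "psi_el r * (e_el ?i * mon rs - mon rs) \<in> J"
      by (rule J_left[OF \<open>psi_el r \<in> A\<close>])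
    then have "psi_el r * (e_el ?i * mon rs - mon rs) - (psi_el r * (e_el ?i * mon rs) - e_el i * mon (r # rs)) \<in> J"
      using * by (rule J_diff)
    then show ?thesis
      by (simp add: algebra_simps)
  qed
qed

lemma e_U: "i \<in> res_seqs n \<Longrightarrow> p \<in> U k \<Longrightarrow> e_el i * p \<in> U k"
proof (rule left_mult_U[where k = k])
  fix rs assume "i \<in> res_seqs n" "set rs \<subseteq> {2..<n}" "length rs < k"
  then show "e_el i * mon rs \<in> U k"
    using e_mon[of i rs] mon_U[of rs k] J_U U_cong by blast
qed simp_all

text \<open>Many relations are available only in front of some e(i). Inserting 1 as the sum of all
  e(i) before \<open>x\<close> makes them applicable.\<close>

lemma e_decomposition:
  assumes "u \<in> A" "x \<in> A" and "\<And>i. i \<in> res_seqs n \<Longrightarrow> u * e_el i * x \<in> U k"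
  shows "u * x \<in> U k"
proof -
  have "((\<Sum>i \<in> res_seqs n. e_el i) - 1) * x \<in> J"
    using assms(2) by (intro J_rel klr_rels.e_sum)
  then have "u * (((\<Sum>i \<in> res_seqs n. e_el i) - 1) * x) \<in> U k"
    by (rule J_U[OF J_left[OF assms(1)]])
  moreover have "(\<Sum>i \<in> res_seqs n. u * e_el i * x) \<in> U k"
    using assms(3) by (rule U_sum)
  ultimately have "(\<Sum>i \<in> res_seqs n. u * e_el i * x) - u * (((\<Sum>i \<in> res_seqs n. e_el i) - 1) * x) \<in> U k"
    using U_diff by blast
  then show ?thesis
    by (simp add: algebra_simps sum_distrib_left sum_distrib_right)
qed

text \<open>Moving y past the first psi leaves a y acting on a shorter product and, for equal
  residues, a product without that psi. In the end y z = 0.\<close>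

lemma y_U: "r \<in> {1..n} \<Longrightarrow> p \<in> U k \<Longrightarrow> y_el r * p \<in> U k"
proof (induction k arbitrary: r p)
  case 0
  then show ?case
    by (intro left_mult_U[where k = 0 and p = p]) auto
next
  case (Suc k)
  show ?case
  proof (rule left_mult_U[OF _ Suc.prems(2)])
    fix rs assume rs: "set rs \<subseteq> {2..<n}" "length rs < Suc k"
    show "y_el r * mon rs \<in> U (Suc k)"
    proof (cases rs)
      case Nil
      have "y_el r \<in> J"
        using Suc.prems(1) subsetD[OF S_subset_J specht_relI(1)] by blast
      then show ?thesis
        using Nil J_U by simp
    next
      case (Cons s ss)
      then have s: "s \<in> {2..<n}" "s \<in> {1..<n}" "s \<in> {1..n}" "s + 1 \<in> {1..n}" and x: "mon ss \<in> U k"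
        using rs mon_U by auto
      have xA: "mon ss \<in> A"
        using x U_closed by blast
      have sA: "psi_el s \<in> A" "y_el r \<in> A"
        using s Suc.prems(1) by simp_all
      consider "r \<noteq> s" "r \<noteq> s + 1" | "r = s" | "r = s + 1" by blast
      then show ?thesis
      proof cases
        case 1
        then have "(y_el r * psi_el s - psi_el s * y_el r) * mon ss \<in> J"
          using Suc.prems(1) s xA by (intro J_rel klr_rels.y_psi_commute)
        then have "y_el r * mon rs - psi_el s * (y_el r * mon ss) \<in> J"
          by (simp add: Cons algebra_simps)
        then show ?thesis
          using psi_U[OF s(1) Suc.IH[OF Suc.prems(1) x]] U_cong by blast
      next
        case 2
        have "y_el r * psi_el s * mon ss \<in> U (Suc k)"
        proof (rule e_decomposition)
          fix i assume i: "i \<in> res_seqs n"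
          let ?d = "if i s = i (s + 1) then 1 else 0 :: (klr_gen, 'f) free_alg"
          have "(y_el s * psi_el s * e_el i - (psi_el s * y_el (s + 1) - ?d) * e_el i) * mon ss \<in> J"
            using s i xA by (intro J_rel klr_rels.y_psi)
          then have "y_el r * psi_el s * e_el i * mon ss -
              (psi_el s * (y_el (s + 1) * (e_el i * mon ss)) - ?d * (e_el i * mon ss)) \<in> J"
            by (simp add: 2 algebra_simps)
          moreover have "psi_el s * (y_el (s + 1) * (e_el i * mon ss)) \<in> U (Suc k)"
            using psi_U[OF s(1) Suc.IH[OF s(4) e_U[OF i x]]] .
          moreover have "?d * (e_el i * mon ss) \<in> U (Suc k)"
            using e_U[OF i x] U_mono[of k "Suc k"] J_U[OF J_zero] by auto
          ultimately show "y_el r * psi_el s * e_el i * mon ss \<in> U (Suc k)"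
            using U_diff U_cong by blast
        qed (use sA xA in auto)
        then show ?thesis
          by (simp add: Cons mult.assoc)
      next
        case 3
        have "y_el r * psi_el s * mon ss \<in> U (Suc k)"
        proof (rule e_decomposition)
          fix i assume i: "i \<in> res_seqs n"
          let ?d = "if i s = i (s + 1) then 1 else 0 :: (klr_gen, 'f) free_alg"
          have "(y_el (s + 1) * psi_el s * e_el i - (psi_el s * y_el s + ?d) * e_el i) * mon ss \<in> J"
            using s i xA by (intro J_rel klr_rels.y_Suc_psi)
          then have "y_el r * psi_el s * e_el i * mon ss -
              (psi_el s * (y_el s * (e_el i * mon ss)) + ?d * (e_el i * mon ss)) \<in> J"
            by (simp add: 3 algebra_simps)
          moreover have "psi_el s * (y_el s * (e_el i * mon ss)) \<in> U (Suc k)"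
            using psi_U[OF s(1) Suc.IH[OF s(3) e_U[OF i x]]] .
          moreover have "?d * (e_el i * mon ss) \<in> U (Suc k)"
            using e_U[OF i x] U_mono[of k "Suc k"] J_U[OF J_zero] by auto
          ultimately show "y_el r * psi_el s * e_el i * mon ss \<in> U (Suc k)"
            using U_add U_cong by blast
        qed (use sA xA in auto)
        then show ?thesis
          by (simp add: Cons mult.assoc)
      qed
    qed
  qed (use Suc.prems in simp)
qed


text \<open>psi_r^2 e(i) is zero or minus a square of y_r - y_{r+1}, and the y do not raise the
  length. This is the nilCoxeter relation psi_r^2 = 0 modulo shorter products.\<close>

lemma psi_psi_U:
  assumes r: "r \<in> {1..<n}" and x: "x \<in> U k"
  shows "psi_el r * (psi_el r * x) \<in> U k"
proof -
  have xA: "x \<in> A" and rA: "psi_el r \<in> A"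
    using x U_closed r by auto
  have r': "r \<in> {1..n}" "r + 1 \<in> {1..n}"
    using r by auto
  have "psi_el r * psi_el r * x \<in> U k"
  proof (rule e_decomposition)
    fix i assume i: "i \<in> res_seqs n"
    show "psi_el r * psi_el r * e_el i * x \<in> U k"
    proof (cases "i r = i (r + 1)")
      case True
      then have "(psi_el r)\<^sup>2 * e_el i * x \<in> J"
        using r i xA by (intro J_rel klr_rels.psi_sq_eq)
      then show ?thesis
        by (simp add: power2_eq_square J_U)
    next
      case False
      let ?d = "y_el r - y_el (r + 1) :: (klr_gen, 'f) free_alg"
      have d: "?d * p \<in> U k" if "p \<in> U k" for p
        using U_diff[OF y_U[OF r'(1) that] y_U[OF r'(2) that]] by (simp add: algebra_simps)
      have "((psi_el r)\<^sup>2 * e_el i - (- (?d\<^sup>2 * e_el i))) * x \<in> J"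
        using r i xA False by (intro J_rel klr_rels.psi_sq_neq)
      moreover have "((psi_el r)\<^sup>2 * e_el i - (- (?d\<^sup>2 * e_el i))) * x =
          psi_el r * psi_el r * e_el i * x - (- (?d * (?d * (e_el i * x))))"
        by (simp add: power2_eq_square algebra_simps)
      ultimately show ?thesis
        using U_cong[OF _ U_uminus[OF d[OF d[OF e_U[OF i x]]]]] by simp
    qed
  qed (use rA xA in auto)
  then show ?thesis
    by (simp add: mult.assoc)
qed

text \<open>The defect of the braid relation is linear in the y, which do not raise the
  length.\<close>

lemma psi_braid_U:
  assumes r: "1 \<le> r" "r + 1 < n" and x: "x \<in> U k"
  shows "psi_el r * (psi_el (r + 1) * (psi_el r * x)) - psi_el (r + 1) * (psi_el r * (psi_el (r + 1) * x)) \<in> U k"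
proof -
  have xA: "x \<in> A" and rA: "psi_el r \<in> A" "psi_el (r + 1) \<in> A"
    using x U_closed r by auto
  have r': "r \<in> {1..n}" "r + 1 \<in> {1..n}" "r + 2 \<in> {1..n}"
    using r by auto
  let ?u = "psi_el r * psi_el (r + 1) * psi_el r - psi_el (r + 1) * psi_el r * psi_el (r + 1)
    :: (klr_gen, 'f) free_alg"
  have "?u * x \<in> U k"
  proof (rule e_decomposition)
    fix i assume i: "i \<in> res_seqs n"
    show "?u * e_el i * x \<in> U k"
    proof (cases "i r = i (r + 1) \<or> i (r + 1) = i (r + 2)")
      case True
      then have "(psi_el r * psi_el (r + 1) * psi_el r * e_el i
          - psi_el (r + 1) * psi_el r * psi_el (r + 1) * e_el i) * x \<in> J"
        using r i xA by (intro J_rel klr_rels.psi_braid)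
      then show ?thesis
        by (simp add: left_diff_distrib J_U)
    next
      case False
      let ?y = "y_el r * (e_el i * x) - (y_el (r + 1) * (e_el i * x) + y_el (r + 1) * (e_el i * x))
            + y_el (r + 2) * (e_el i * x)"
      have "(psi_el r * psi_el (r + 1) * psi_el r * e_el i
          - (psi_el (r + 1) * psi_el r * psi_el (r + 1) + y_el r - 2 * y_el (r + 1) + y_el (r + 2)) * e_el i) * x \<in> J"
        using r i xA False by (intro J_rel klr_rels.psi_braid_neq) auto
      also have "(psi_el r * psi_el (r + 1) * psi_el r * e_el i
          - (psi_el (r + 1) * psi_el r * psi_el (r + 1) + y_el r - 2 * y_el (r + 1) + y_el (r + 2)) * e_el i) * x =
          ?u * e_el i * x - ?y"
        by (simp add: algebra_simps mult_2)
      finally have "?u * e_el i * x - ?y \<in> J" .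
      moreover have "?y \<in> U k"
        using e_U[OF i x] r' by (intro U_add U_diff y_U)
      ultimately show ?thesis
        by (rule U_cong)
    qed
  qed (use rA xA in auto)
  then show ?thesis
    by (simp add: algebra_simps)
qed

lemma psi_commute_J:
  assumes "r \<in> {1..<n}" "s \<in> {1..<n}" "s \<noteq> r + 1" "r \<noteq> s + 1" "x \<in> A"
  shows "psi_el s * (psi_el r * x) - psi_el r * (psi_el s * x) \<in> J"
  using J_rel[OF klr_rels.psi_psi[OF assms(1-4)] assms(5)] by (simp add: left_diff_distrib mult.assoc)

text \<open>The generator \<open>\<psi>\<^sub>1\<close> vanishes: a sequence \<open>(0, 1, \<dots>)\<close> is moved to one starting with 1, and
  \<open>e(0, 0, \<dots>)\<close> is zero because \<open>y\<^sub>1 = 0\<close>.\<close>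

lemma psi_one_J:
  assumes x: "x \<in> A"
  shows "psi_el 1 * x \<in> J"
proof -
  have one: "(1::nat) \<in> {1..<n}" "(2::nat) \<in> {1..n}" "(1::nat) \<in> {1..n}"
    using b_less by auto
  have psi: "psi_el 1 \<in> A" and y: "y_el 2 \<in> A" "y_el 1 \<in> A"
    using one by auto
  have I: "psi_el 1 * e_el i \<in> I" if i: "i \<in> res_seqs n" for i
  proof -
    have e: "e_el i \<in> A" using i by simp
    consider "i 1 = 1" | "i 1 = 0" "i 2 = 1" | "i 1 = 0" "i 2 = 0"
      using PiE_mem[OF i[unfolded res_seqs_def] one(2)] PiE_mem[OF i[unfolded res_seqs_def] one(3)] by auto
    then show ?thesis
    proof cases
      case 1
      then show ?thesis
        using I_left[OF psi] R_subset_I klr_rels.e_one[OF i] by blast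
    next
      case 2
      let ?i = "i \<circ> Transposition.transpose 1 (1 + 1)"
      have "psi_el 1 * e_el i - e_el ?i * psi_el 1 \<in> I"
        using klr_rels.psi_e[OF one(1) i] R_subset_I by blast
      moreover have "e_el ?i \<in> klr_rels n"
        using 2 transpose_res_seqs[OF i one(1)] by (intro klr_rels.e_one) (auto simp: numeral_2_eq_2)
      then have "e_el ?i * psi_el 1 \<in> I"
        using I_right[OF psi] R_subset_I by blast
      ultimately show ?thesis
        using I_add by fastforce
    next
      case 3
      then have i12: "i 1 = i (1 + 1)"
        by (simp add: numeral_2_eq_2)
      have y1: "y_el 1 \<in> I"
        using klr_rels.y_one R_subset_I by blast
      have 1: "y_el 1 * psi_el 1 * e_el i - (psi_el 1 * y_el (1 + 1) - 1) * e_el i \<in> I"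
        using klr_rels.y_psi[OF one(1) i, where 'f = 'f] i12 R_subset_I by auto
      have 2: "(psi_el 1)\<^sup>2 * e_el i \<in> I"
        using klr_rels.psi_sq_eq[OF one(1) i i12] R_subset_I by blast
      have 3: "y_el 2 * e_el i - e_el i * y_el 2 \<in> I"
        using klr_rels.y_e[OF one(2) i] R_subset_I by blast
      \<comment> \<open>Multiplying y_1 psi_1 e(i) = (psi_1 y_2 - 1) e(i) by psi_1 from the left and
        using y_1 = 0 gives psi_1 e(i) = psi_1^2 y_2 e(i) = psi_1^2 e(i) y_2, which is zero.\<close>
      have "psi_el 1 * (y_el 1 * psi_el 1 * e_el i - (psi_el 1 * y_el (1 + 1) - 1) * e_el i)
          + psi_el 1 * psi_el 1 * (y_el 2 * e_el i - e_el i * y_el 2)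
          + (psi_el 1)\<^sup>2 * e_el i * y_el 2 - psi_el 1 * (y_el 1 * (psi_el 1 * e_el i)) \<in> I"
        using psi e y by (intro I_diff I_add I_left[OF _ 1] I_left[OF _ 3] I_right[OF _ 2]
            I_left[OF psi] I_right[OF _ y1]) auto
      then show ?thesis
        by (simp add: algebra_simps power2_eq_square numeral_2_eq_2)
    qed
  qed
  have "psi_el 1 * x \<in> U 0"
  proof (rule e_decomposition)
    fix i assume "i \<in> res_seqs n"
    then show "psi_el 1 * e_el i * x \<in> U 0"
      using I I_right[OF x] I_subset_J J_U by blast
  qed (use psi x in auto)
  moreover have "U 0 \<subseteq> J"
    unfolding U_def
    by (rule fa.span_minimal) (auto simp: fa.subspace_def J_zero J_add J_scale)
  ultimately show ?thesis
    by blast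
qed

section \<open>Reduced words of tableaux\<close>

text \<open>A word \<open>T\<close> in the letters \<open>L\<close> (\<^const>\<open>False\<close>) and \<open>A\<close> (\<^const>\<open>True\<close>) at the positions
  \<open>1, \<dots>, n\<close> records which entries of a standard tableau lie in the leg and in the arm;
  \<open>hook_word\<close> belongs to \<open>T\<^sub>\<lambda>\<close>.\<close>

definition hook_word :: "nat \<Rightarrow> bool" where "hook_word j \<longleftrightarrow> b + 2 \<le> j"

text \<open>\<open>red T rs\<close> says that \<open>rs\<close> is a reduced expression leading from
  \<open>hook_word\<close> to \<open>T\<close>. The head of the list is the swap made last, matching
  the leftmost factor of \<open>mon rs\<close>; each swap turns \<open>LA\<close> into
  \<open>AL\<close>. Positions 1 and n + 1 are never touched.\<close>

inductive red :: "(nat \<Rightarrow> bool) \<Rightarrow> nat list \<Rightarrow> bool" where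
  red_base: "red hook_word []"
| red_step: "red T rs \<Longrightarrow> r \<in> {2..<n} \<Longrightarrow> \<not> T r \<Longrightarrow> T (Suc r) \<Longrightarrow>
    red (T(r := True, Suc r := False)) (r # rs)"

lemma red_set: "red T rs \<Longrightarrow> set rs \<subseteq> {2..<n}"
  by (induction rule: red.induct) auto

lemma red_closed: "red T rs \<Longrightarrow> mon rs \<in> A"
  by (simp add: mon_closed red_set)

lemma red_U: "red T rs \<Longrightarrow> length rs < k \<Longrightarrow> mon rs \<in> U k"
  by (simp add: mon_U red_set)

text \<open>If \<open>T\<close> has \<open>AL\<close> at \<open>r\<close>, the factor psi_r can be
  brought to the front. The last swap \<open>c\<close> also left \<open>AL\<close> behind, so
  \<open>c\<close> is equal to \<open>r\<close> or at distance at least two, and only commutations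
  are needed.\<close>

lemma red_descent:
  assumes "red T rs" "r \<in> {2..<n}" "T r" "\<not> T (Suc r)"
  obtains ws where "red (T(r := False, Suc r := True)) ws" "length rs = Suc (length ws)"
    "mon rs - psi_el r * mon ws \<in> U (length rs)"
proof -
  have "\<exists>ws. red (T(r := False, Suc r := True)) ws \<and> length rs = Suc (length ws) \<and>
    mon rs - psi_el r * mon ws \<in> U (length rs)"
    using assms
  proof (induction rule: red.induct)
    case red_base
    then show ?case by (simp add: hook_word_def)
  next
    case (red_step T rs c)
    show ?case
    proof (cases "r = c")
      case True
      then have "T(c := True, Suc c := False, r := False, Suc r := True) = T"
        using red_step.hyps by (auto simp: fun_eq_iff)
      then have "red (T(c := True, Suc c := False, r := False, Suc r := True)) rs"
        using red_step.hyps by simp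
      then show ?thesis
        using True J_U[OF J_zero] by (metis length_Cons mon_simps(2) diff_self)
    next
      case False
      have rc: "r \<noteq> Suc c" "Suc r \<noteq> c"
        using red_step.prems by auto
      then have "T r" "\<not> T (Suc r)"
        using red_step.prems False by auto
      then obtain ws where ws: "red (T(r := False, Suc r := True)) ws" "length rs = Suc (length ws)"
        "mon rs - psi_el r * mon ws \<in> U (length rs)"
        using red_step.IH red_step.prems by blast
      have "red ((T(r := False, Suc r := True))(c := True, Suc c := False)) (c # ws)"
        using red_step.hyps False rc by (intro red.red_step ws(1)) auto
      moreover have "(T(r := False, Suc r := True))(c := True, Suc c := False) =
          T(c := True, Suc c := False, r := False, Suc r := True)"
        using False rc by (auto simp: fun_eq_iff)
      moreover have "mon (c # rs) - psi_el r * mon (c # ws) \<in> U (length (c # rs))"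
      proof -
        have "psi_el c * (mon rs - psi_el r * mon ws) \<in> U (Suc (length rs))"
          using psi_U[OF red_step.hyps(2) ws(3)] .
        moreover have "psi_el c * (psi_el r * mon ws) - psi_el r * (psi_el c * mon ws) \<in> U (Suc (length rs))"
          using red_step.hyps red_step.prems rc False red_closed[OF ws(1)]
          by (intro J_U psi_commute_J) auto
        ultimately show ?thesis
          using U_add by (fastforce simp: algebra_simps)
      qed
      ultimately show ?thesis
        using ws(2) by (metis length_Cons)
    qed
  qed
  then show thesis
    using that by blast
qed

text \<open>Both words can be made to start with the same letter by \<open>red_descent\<close>; the
  remaining words belong to the same smaller tableau.\<close>

lemma red_unique:
  "red T rs \<Longrightarrow> red T ss \<Longrightarrow> length rs = length ss \<and> mon rs - mon ss \<in> U (length rs)"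
proof (induction arbitrary: ss rule: red.induct)
  case red_base
  from red_base have "ss = []"
  proof cases
    case (red_step T rs r)
    then have "hook_word r" "\<not> hook_word (Suc r)"
      by simp_all
    then show ?thesis
      by (simp add: hook_word_def)
  qed
  then show ?case
    using J_U[OF J_zero] by simp
next
  case (red_step T rs c)
  let ?T = "T(c := True, Suc c := False)"
  have "?T c" "\<not> ?T (Suc c)"
    by simp_all
  then obtain ws where ws: "red (?T(c := False, Suc c := True)) ws" "length ss = Suc (length ws)"
    "mon ss - psi_el c * mon ws \<in> U (length ss)"
    using red_descent[OF red_step.prems red_step.hyps(2)] by blast
  have "?T(c := False, Suc c := True) = T"
    using red_step.hyps by (auto simp: fun_eq_iff)
  with ws(1) have "red T ws"
    by simp
  then have IH: "length rs = length ws" "mon rs - mon ws \<in> U (length rs)"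
    using red_step.IH by blast+
  have "psi_el c * (mon rs - mon ws) - (mon ss - psi_el c * mon ws) \<in> U (Suc (length rs))"
    using psi_U[OF red_step.hyps(2) IH(2)] ws(2,3) IH(1) U_diff by auto
  then show ?case
    using ws(2) IH(1) by (simp add: algebra_simps)
qed

text \<open>For \<open>hook_word\<close> the positions \<open>r\<close> and \<open>Suc r\<close>
  carry equal letters exactly if r is not b + 1, and these psi_r kill z. In general psi_r is moved
  inwards, by commutation or by a braid relation, to a shorter reduced word on which its successor
  is again stationary.\<close>

lemma red_stationary:
  "red T rs \<Longrightarrow> r \<in> {2..<n} \<Longrightarrow> T r = T (Suc r) \<Longrightarrow> psi_el r * mon rs \<in> U (Suc (length rs))"
proof (induction "length rs" arbitrary: T rs r rule: less_induct)
  case less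
  show ?case
    using less.prems(1)
  proof cases
    case red_base
    then have "psi_el r \<in> J"
      using less.prems subsetD[OF S_subset_J specht_relI(3)] by (auto simp: hook_word_def)
    then show ?thesis
      using red_base J_U by simp
  next
    case (red_step T' xs c)
    note T = \<open>T = T'(c := True, Suc c := False)\<close> and rs = \<open>rs = c # xs\<close>
    \<comment> \<open>Modulo shorter products psi_r psi_c psi_r equals psi_c psi_r psi_c, and the
      innermost psi_c meets equal letters.\<close>
    have lift: "psi_el r * (psi_el c * mon xs) \<in> U (Suc (length rs))"
      if ws: "red T'' ws" "length xs = Suc (length ws)" "mon xs - psi_el r * mon ws \<in> U (length xs)"
        and c: "T'' c = T'' (Suc c)"
        and braid: "psi_el r * (psi_el c * (psi_el r * mon ws)) - psi_el c * (psi_el r * (psi_el c * mon ws))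
          \<in> U (length xs)" for T'' ws
    proof -
      have "psi_el c * mon ws \<in> U (length xs)"
        using less.hyps[of ws T'' c] ws c red_step rs by simp
      then have "psi_el c * (psi_el r * (psi_el c * mon ws)) \<in> U (Suc (Suc (length xs)))"
        using psi_U less.prems red_step by blast
      moreover have "psi_el r * (psi_el c * (mon xs - psi_el r * mon ws)) \<in> U (Suc (Suc (length xs)))"
        using psi_U ws less.prems red_step by blast
      moreover have "psi_el r * (psi_el c * (psi_el r * mon ws)) - psi_el c * (psi_el r * (psi_el c * mon ws))
          \<in> U (Suc (Suc (length xs)))"
        using braid U_mono[of "length xs" "Suc (Suc (length xs))"] by auto
      ultimately have "psi_el c * (psi_el r * (psi_el c * mon ws)) +
          psi_el r * (psi_el c * (mon xs - psi_el r * mon ws)) +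
          (psi_el r * (psi_el c * (psi_el r * mon ws)) - psi_el c * (psi_el r * (psi_el c * mon ws)))
          \<in> U (Suc (Suc (length xs)))"
        by (intro U_add)
      then show ?thesis
        by (simp add: rs algebra_simps)
    qed
    consider "Suc r < c \<or> Suc c < r" | "r = Suc c" | "c = Suc r" | "r = c"
      by linarith
    then show ?thesis
    proof cases
      case 1
      then have "T' r = T' (Suc r)"
        using less.prems T by (auto split: if_splits)
      then have "psi_el r * mon xs \<in> U (Suc (length xs))"
        using less.hyps[of xs T' r] red_step less.prems rs by simp
      then have "psi_el c * (psi_el r * mon xs) \<in> U (Suc (length rs))"
        using psi_U[of c] red_step rs by auto
      moreover have "psi_el r * (psi_el c * mon xs) - psi_el c * (psi_el r * mon xs) \<in> J"
        using 1 red_step less.prems red_closed by (intro psi_commute_J) auto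
      ultimately show ?thesis
        using U_cong rs by simp
    next
      case 2
      \<comment> \<open>The letters of \<open>T'\<close> at c, c + 1, c + 2 are \<open>LAL\<close>;
        the descent at r = c + 1 gives \<open>LLA\<close>, which is stationary at c.\<close>
      have "T' r" "\<not> T' (Suc r)"
        using less.prems T red_step 2 by (auto split: if_splits)
      then obtain ws where ws: "red (T'(r := False, Suc r := True)) ws" "length xs = Suc (length ws)"
        "mon xs - psi_el r * mon ws \<in> U (length xs)"
        using red_descent red_step less.prems by blast
      have "mon ws \<in> U (length xs)"
        using red_U[OF ws(1)] ws(2) by simp
      then have "- (psi_el c * (psi_el (c + 1) * (psi_el c * mon ws))
          - psi_el (c + 1) * (psi_el c * (psi_el (c + 1) * mon ws))) \<in> U (length xs)"
        using red_step less.prems 2 by (intro U_uminus psi_braid_U) auto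
      then show ?thesis
        using lift[OF ws] 2 red_step rs by simp
    next
      case 3
      \<comment> \<open>The letters of \<open>T'\<close> at r, r + 1, r + 2 are \<open>ALA\<close>;
        the descent at r gives \<open>LAA\<close>, which is stationary at c = r + 1.\<close>
      have "T' r" "\<not> T' (Suc r)" "T' (Suc c)"
        using less.prems T red_step 3 by (auto split: if_splits)
      then obtain ws where ws: "red (T'(r := False, Suc r := True)) ws" "length xs = Suc (length ws)"
        "mon xs - psi_el r * mon ws \<in> U (length xs)"
        using red_descent red_step less.prems by blast
      have "mon ws \<in> U (length xs)"
        using red_U[OF ws(1)] ws(2) by simp
      then have "psi_el r * (psi_el (r + 1) * (psi_el r * mon ws))
          - psi_el (r + 1) * (psi_el r * (psi_el (r + 1) * mon ws)) \<in> U (length xs)"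
        using red_step less.prems 3 by (intro psi_braid_U) auto
      then show ?thesis
        using lift[OF ws] 3 \<open>T' (Suc c)\<close> rs by simp
    next
      case 4
      then show ?thesis
        using less.prems T by simp
    qed
  qed
qed

section \<open>Spanning by reduced words\<close>

definition Rspan :: "nat \<Rightarrow> (klr_gen, 'f) free_alg set" where
  "Rspan k = fa.span (J \<union> {mon rs | rs. (\<exists>T. red T rs) \<and> length rs < k})"

lemma Rspan_mono: "k \<le> l \<Longrightarrow> Rspan k \<subseteq> Rspan l"
  unfolding Rspan_def by (rule fa.span_mono) auto

lemma J_Rspan: "p \<in> J \<Longrightarrow> p \<in> Rspan k"
  unfolding Rspan_def by (simp add: fa.span_base)

lemma red_Rspan: "red T rs \<Longrightarrow> length rs < k \<Longrightarrow> mon rs \<in> Rspan k"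
  unfolding Rspan_def by (auto intro!: fa.span_base)

text \<open>A factor psi_r in front of a reduced word gives a longer reduced word at
  \<open>LA\<close>, a shorter product at equal letters, and, after pulling psi_r out, a square
  psi_r^2 at \<open>AL\<close>.\<close>

lemma U_subset_Rspan: "U k \<subseteq> Rspan k"
proof (induction k)
  case 0
  show ?case
    unfolding U_def Rspan_def by simp
next
  case (Suc k)
  have step: "psi_el r * p \<in> Rspan (Suc k)" if r: "r \<in> {2..<n}" and p: "p \<in> Rspan k" for r p
    unfolding Rspan_def
  proof (rule mult_left_span)
    show "p \<in> fa.span (J \<union> {mon rs | rs. (\<exists>T. red T rs) \<and> length rs < k})"
      using p by (simp add: Rspan_def)
    fix q assume "q \<in> J \<union> {mon rs | rs. (\<exists>T. red T rs) \<and> length rs < k}"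
    then consider "q \<in> J" | T rs where "red T rs" "length rs < k" "q = mon rs"
      by blast
    then have "psi_el r * q \<in> Rspan (Suc k)"
    proof cases
      case 1
      then show ?thesis
        using r by (intro J_Rspan J_left) auto
    next
      case 2
      note red = this
      have U: "psi_el r * q \<in> Rspan (Suc k)" if "psi_el r * q \<in> U (Suc (length rs))"
        using that U_mono[of "Suc (length rs)" k] 2 Suc Rspan_mono[of k "Suc k"] by auto
      consider "T r = T (Suc r)" | "\<not> T r" "T (Suc r)" | "T r" "\<not> T (Suc r)"
        by blast
      then show ?thesis
      proof cases
        case 1
        then show ?thesis
          using red_stationary[OF red(1) r] red(3) U 1 by simp
      next
        case 2
        then have "red (T(r := True, Suc r := False)) (r # rs)"
          using red r by (intro red_step)
        then show ?thesis
          using red_Rspan[of _ "r # rs" "Suc k"] red by simp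
      next
        case 3
        then obtain ws where ws: "length rs = Suc (length ws)" "mon rs - psi_el r * mon ws \<in> U (length rs)"
          "red (T(r := False, Suc r := True)) ws"
          using red_descent[OF red(1) r] by blast
        have "mon ws \<in> U (length rs)"
          using red_U[OF ws(3)] ws(1) by simp
        then have "psi_el r * (psi_el r * mon ws) \<in> U (Suc (length rs))"
          using psi_psi_U r U_mono[of "length rs" "Suc (length rs)"] by fastforce
        then have "psi_el r * (mon rs - psi_el r * mon ws) + psi_el r * (psi_el r * mon ws) \<in> U (Suc (length rs))"
          using psi_U[OF r ws(2)] U_add by blast
        then show ?thesis
          using U red(3) by (simp add: algebra_simps)
      qed
    qed
    then show "psi_el r * q \<in> fa.span (J \<union> {mon rs | rs. (\<exists>T. red T rs) \<and> length rs < Suc k})"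
      by (simp add: Rspan_def)
  qed
  have "mon rs \<in> Rspan (Suc k)" if rs: "set rs \<subseteq> {2..<n}" "length rs < Suc k" for rs
  proof (cases rs)
    case Nil
    then show ?thesis
      using red_Rspan[OF red_base] by simp
  next
    case (Cons r ss)
    then have "mon ss \<in> U k"
      using rs by (intro mon_U) auto
    then show ?thesis
      using step[of r "mon ss"] Suc rs Cons by auto
  qed
  then show ?case
    unfolding U_def by (intro fa.span_minimal) (auto simp: J_Rspan, auto simp: Rspan_def)
qed

text \<open>Left multiplication by any generator maps each \<open>U k\<close> into some
  \<open>U l\<close>, and 1 lies in \<open>U 1\<close>.\<close>

lemma generated: "p \<in> A \<Longrightarrow> \<exists>k. p \<in> U k"
proof -
  assume p: "p \<in> A"
  have gen: "\<exists>l. gen g * q \<in> U l" if g: "g \<in> klr_gens n" and q: "q \<in> U k" for g q k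
  proof -
    consider r where "g = GenY r" "r \<in> {1..n}" | r where "g = GenPsi r" "r \<in> {2..<n}" | "g = GenPsi 1"
      | i where "g = GenE i" "i \<in> res_seqs n"
      using g by (fastforce simp: klr_gens_def)
    then show ?thesis
    proof cases
      case 3
      then have "psi_el 1 * q \<in> J"
        using q U_closed by (intro psi_one_J) auto
      then show ?thesis
        using 3 J_U by blast
    qed (use q y_U psi_U e_U in blast)+
  qed
  have *: "\<exists>k. prod_list (map gen gs) \<in> U k" if "set gs \<subseteq> klr_gens n" for gs
    using that
  proof (induction gs)
    case Nil
    then show ?case
      using mon_U[of "[]" 1] by auto
  next
    case (Cons g gs)
    then show ?case
      using gen[of g] by auto
  qed
  have **: "Poly_Mapping.single w c = scalar c * prod_list (map gen (letters w))" for w :: "klr_gen free_monoid" and c :: 'f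
  proof -
    have "Poly_Mapping.single (Word gs) (1::'f) = prod_list (map gen gs)" for gs :: "klr_gen list"
    proof (induction gs)
      case Nil
      show ?case by (simp flip: zero_free_monoid_def)
    next
      case (Cons g gs)
      have "Poly_Mapping.single (Word (g # gs)) (1::'f) = gen g * Poly_Mapping.single (Word gs) 1"
        by (simp add: gen_def mult_single plus_free_monoid_def)
      then show ?case
        using Cons by simp
    qed
    from this[of "letters w"] have "prod_list (map gen (letters w)) = Poly_Mapping.single w (1::'f)"
      by simp
    then show ?thesis
      by (simp add: scalar_def mult_single)
  qed
  have single: "\<exists>k. Poly_Mapping.single w (Poly_Mapping.lookup p w) \<in> U k"
    if "w \<in> Poly_Mapping.keys p" for w
  proof -
    have "set (letters w) \<subseteq> klr_gens n"
      using p that by (simp add: carrier_free_algebra)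
    then obtain k where "prod_list (map gen (letters w)) \<in> U k"
      using * by blast
    then have "scalar (Poly_Mapping.lookup p w) * prod_list (map gen (letters w)) \<in> U k"
      unfolding U_def by (rule fa.span_scale)
    then show ?thesis
      using ** by auto
  qed
  have "\<exists>k. (\<Sum>w \<in> W. Poly_Mapping.single w (Poly_Mapping.lookup p w)) \<in> U k"
    if "finite W" "W \<subseteq> Poly_Mapping.keys p" for W
    using that
  proof (induction W)
    case empty
    then show ?case
      using J_U[OF J_zero] by auto
  next
    case (insert w W)
    then obtain k l where "Poly_Mapping.single w (Poly_Mapping.lookup p w) \<in> U k"
      "(\<Sum>w \<in> W. Poly_Mapping.single w (Poly_Mapping.lookup p w)) \<in> U l"
      using single by blast
    then have "(\<Sum>w \<in> insert w W. Poly_Mapping.single w (Poly_Mapping.lookup p w)) \<in> U (max k l)"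
      using insert.hyps U_mono[of k "max k l"] U_mono[of l "max k l"] by (auto intro!: U_add)
    then show ?case by blast
  qed
  from this[OF _ subset_refl] show ?thesis
    by (simp add: sum_single_keys)
qed

end

section \<open>The reduced words are linearly independent\<close>

text \<open>A slot is mixed exactly if it holds an odd number of legs.\<close>

lemma sg_parity: "sg T (Suc m) \<longleftrightarrow> odd (\<Sum>j = 2..2 * m + 1. if T j then 0 else 1 :: int)"
proof (induction m)
  case (Suc m)
  have "{2..2 * Suc m + 1} = {2..2 * m + 1} \<union> {2 * Suc m, 2 * Suc m + 1}"
    by auto
  then have "(\<Sum>j = 2..2 * Suc m + 1. if T j then 0 else 1 :: int) =
      (\<Sum>j = 2..2 * m + 1. if T j then 0 else 1) +
      ((if T (2 * Suc m) then 0 else 1) + (if T (2 * Suc m + 1) then 0 else 1))"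
    by (simp add: sum.union_disjoint)
  moreover have "sg T (Suc (Suc m)) \<longleftrightarrow> (sg T (Suc m) \<noteq> (T (2 * Suc m) \<noteq> T (2 * Suc m + 1)))"
    by (simp only: sg.simps) simp
  ultimately show ?case
    unfolding Suc.IH by auto
qed simp

context even_hook
begin

lemma n_pos: "n \<noteq> 0" and even_n: "even n"
  using b_less even_a even_b by (auto simp: n_eq)

section \<open>The map from the Specht module to the representation\<close>

definition vac :: "(nat \<Rightarrow> bool) \<Rightarrow> 'f" where "vac T = (if T = hook_word then 1 else 0)"

definition phi :: "(klr_gen, 'f) free_alg \<Rightarrow> (nat \<Rightarrow> bool) \<Rightarrow> 'f" where
  "phi p = act (rep n) p vac"

lemma phi_add: "phi (p + q) T = phi p T + phi q T"
  and phi_diff: "phi (p - q) T = phi p T - phi q T"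
  and phi_scalar_mult: "phi (scalar c * p) T = c * phi p T"
  and phi_gen_mult: "phi (gen g * p) = rep n g (phi p)"
  and phi_one: "phi 1 = vac"
  by (simp_all add: phi_def rep.act_add rep.act_diff rep.act_mult rep.act_scalar rep.act_gen rep.act_one)

lemma phi_scalar: "phi (scalar c) T = c * vac T"
  by (simp add: phi_def rep.act_scalar)

lemma phi_zero: "phi 0 T = 0"
  by (simp add: phi_def rep.act_zero)

text \<open>As \<open>b\<close> is even, the letters change at the beginning of a slot.\<close>

lemma hook_word_pure: "hook_word (2 * m) = hook_word (2 * m + 1)"
  using even_b unfolding hook_word_def by presburger

text \<open>The residues also alternate across the border: b + 1 has residue 0 because
  \<open>b\<close> is even, and b + 2 lies in the second column of the first row.\<close>

lemma word_res_hook_word: "word_res n hook_word = hook_res_seq a b"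
proof
  fix k
  have sg: "sg hook_word m = False" for m
    using hook_word_pure by (induction m) auto
  have "residue (hook_node b k) = of_bool (even k)" if "1 \<le> k"
  proof (cases "k \<le> b + 1")
    case True
    have "(1 - int k) mod 2 = (if even k then 1 else 0)"
      by presburger
    then show ?thesis
      using True by (simp add: residue_def hook_node_def)
  next
    case False
    have "(int (k - b) - 1) mod 2 = (if even k then 1 else 0)"
      using False even_b by presburger
    then show ?thesis
      using False by (simp add: residue_def hook_node_def)
  qed
  then show "word_res n hook_word k = hook_res_seq a b k"
    by (auto simp: word_res_def hook_res_seq_def sg n_eq simp del: sg.simps)
qed

lemma vac_eq_zero: "T j \<noteq> hook_word j \<Longrightarrow> vac T = 0"
  by (auto simp: vac_def)

text \<open>An even r meets a pure slot. An odd r other than b + 1 meets two equal pure slots, on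
  which the symplectic form vanishes.\<close>

lemma opPsi_vac:
  assumes "r \<noteq> b + 1"
  shows "opPsi r vac T = 0"
proof (cases r rule: index_cases)
  case (even m)
  have "vac (T(2 * m := False, Suc (2 * m) := True)) = 0"
  proof (cases "hook_word (2 * m)")
    case True
    then show ?thesis by (intro vac_eq_zero[of _ "2 * m"]) simp
  next
    case False
    then show ?thesis using hook_word_pure[of m] by (intro vac_eq_zero[of _ "Suc (2 * m)"]) simp
  qed
  then show ?thesis
    using even by (simp add: opPsi_simps slotF_def opF_def)
next
  case (odd m)
  have ne: "vac T' = 0" if "T' (2 * m) \<noteq> T' (2 * m + 1) \<or> T' (2 * m + 2) \<noteq> T' (2 * m + 3) \<or>
    T' (2 * m + 1) \<noteq> T' (2 * m + 2)" for T'
  proof -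
    have "hook_word (2 * m + 1) = hook_word (2 * m + 2)" "hook_word (2 * m + 2) = hook_word (2 * m + 3)"
      using odd assms even_b by (auto simp: hook_word_def elim!: evenE)
    then show ?thesis
      using that hook_word_pure[of m] vac_eq_zero by metis
  qed
  have "opB (2 * m) (2 * m + 1) (2 * m + 2) (2 * m + 3) vac T = 0"
    by (cases "T (2 * m + 1)"; cases "T (2 * m + 2)"; simp add: opB_def opE_def opF_def ne)
  then show ?thesis
    using odd by (simp add: opPsi_simps slotB_def)
qed (simp_all add: opPsi_simps)

lemma opY_vac: "opY r vac T = 0"
proof -
  have "slotE m vac T = 0" for m
  proof (cases "hook_word (2 * m)")
    case True
    then show ?thesis
      using hook_word_pure[of m] vac_eq_zero[of "T(2 * m := True, 2 * m + 1 := False)" "2 * m + 1"]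
      by (simp add: slotE_def opE_def)
  next
    case False
    then show ?thesis
      using vac_eq_zero[of "T(2 * m := True, 2 * m + 1 := False)" "2 * m"]
      by (simp add: slotE_def opE_def)
  qed
  then show ?thesis
    by (cases r rule: index_cases) (simp_all add: opY_simps)
qed

lemma phi_specht_rel:
  assumes "s \<in> specht_rels a b"
  shows "phi s T = 0"
proof -
  consider k where "s = y_el k" | i where "s = e_el i - (if i = hook_res_seq a b then 1 else 0)"
    | j where "s = psi_el j" "j \<noteq> b + 1" | "s = prod_list (map psi_el [1..<b + 2])"
    using assms unfolding specht_rels_def by blast
  then show ?thesis
  proof cases
    case 1
    then show ?thesis by (simp add: phi_def rep.act_gen opY_vac)
  next
    case 2
    then show ?thesis
      by (auto simp: phi_def rep.act_gen rep.act_diff rep.act_one rep.act_zero opR_def vac_def word_res_hook_word)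
  next
    case 3
    then show ?thesis by (simp add: phi_def rep.act_gen opPsi_vac)
  next
    case 4
    \<comment> \<open>The leftmost factor psi_1 acts as zero, which settles the last relation of
      z.\<close>
    have "[1..<b + 2] = 1 # [2..<b + 2]"
      by (simp add: upt_rec numeral_2_eq_2)
    then show ?thesis
      by (simp add: 4 phi_gen_mult opPsi_simps del: upt_Suc)
  qed
qed

lemma phi_J: "p \<in> J \<Longrightarrow> phi p T = 0"
proof -
  have "J \<subseteq> {p \<in> A. \<forall>T. phi p T = 0}"
  proof (rule J_minimal)
    fix x p assume "x \<in> A" "p \<in> {p \<in> A. \<forall>T. phi p T = 0}"
    moreover from this have "phi p = (\<lambda>T. 0)" by auto
    ultimately show "x * p \<in> {p \<in> A. \<forall>T. phi p T = 0}"
      by (simp add: phi_def rep.act_mult rep.act_zero_arg)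
  next
    fix r x :: "(klr_gen, 'f) free_alg" assume "r \<in> klr_rels n" "x \<in> A"
    then show "r * x \<in> {p \<in> A. \<forall>T. phi p T = 0}"
      using klr_rels_subset by (auto simp: phi_def rep.act_mult rep_rel[OF n_pos])
  qed (use S_subset in \<open>auto simp: phi_zero phi_add phi_specht_rel\<close>)
  then show "p \<in> J \<Longrightarrow> phi p T = 0" by blast
qed

section \<open>Height of words and leading terms\<close>

definition leg_sum :: "(nat \<Rightarrow> int) \<Rightarrow> (nat \<Rightarrow> bool) \<Rightarrow> int" where
  "leg_sum g T = (\<Sum>j = 2..n + 1. if T j then 0 else g j)"

lemma leg_sum_upd:
  assumes "2 \<le> j" "j \<le> n + 1"
  shows "leg_sum g (T(j := x)) = leg_sum g T + ((if x then 0 else g j) - (if T j then 0 else g j))"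
proof -
  have "leg_sum g T' = (if T' j then 0 else g j) + (\<Sum>k \<in> {2..n + 1} - {j}. if T' k then 0 else g k)" for T'
    unfolding leg_sum_def using assms by (subst sum.remove[of _ j]) auto
  moreover have "(\<Sum>k \<in> {2..n + 1} - {j}. if (T(j := x)) k then 0 else g k) =
      (\<Sum>k \<in> {2..n + 1} - {j}. if T k then 0 else g k)"
    by (intro sum.cong) auto
  ultimately show ?thesis
    by simp
qed

text \<open>The words of standard tableaux of the hook. Outside 2, ..., n the letters are frozen; in
  particular n + 1 carries \<open>A\<close>.\<close>

definition good :: "(nat \<Rightarrow> bool) \<Rightarrow> bool" where
  "good T \<longleftrightarrow> (\<forall>j. j \<notin> {2..n} \<longrightarrow> T j = hook_word j) \<and> leg_sum (\<lambda>_. 1) T = leg_sum (\<lambda>_. 1) hook_word"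

text \<open>The sum of the positions of the legs. A step of \<open>red\<close> moves one leg one
  place to the right, so the height measures the length of reduced words.\<close>

abbreviation ht where "ht \<equiv> leg_sum int"

lemma good_last: "good T \<Longrightarrow> T (n + 1)"
  using b_less by (simp add: good_def hook_word_def)

lemma good_cong:
  "good T' \<Longrightarrow> (\<And>j. j \<notin> {2..n} \<Longrightarrow> T j = T' j) \<Longrightarrow>
    leg_sum (\<lambda>_. 1) T = leg_sum (\<lambda>_. 1) T' \<Longrightarrow> good T"
  by (simp add: good_def)

lemma leg_sum_move:
  assumes "2 \<le> i" "i < j" "j \<le> n + 1" "\<not> T i" "T j"
  shows "leg_sum g (T(i := True, j := False)) = leg_sum g T - g i + g j"
  using assms by (simp add: leg_sum_upd)

lemma leg_sum_swap:
  assumes "r \<in> {2..<n}" "T r" "\<not> T (Suc r)"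
  shows "leg_sum g (T(r := False, Suc r := True)) = leg_sum g T + g r - g (Suc r)"
  using assms by (simp add: leg_sum_upd)

lemma good_swap:
  assumes "r \<in> {2..<n}" "T r" "\<not> T (Suc r)" "good (T(r := False, Suc r := True))"
  shows "good T"
  using assms leg_sum_swap[OF assms(1-3)] by (intro good_cong[OF assms(4)]) auto

text \<open>The first alternative is the swap at \<open>r\<close>. The second comes from the summand
  \<open>opE\<close> of \<open>opB\<close>, which moves a leg three places to the left and so lowers
  the height.\<close>

lemma opPsi_support:
  assumes r: "r \<in> {2..<n}" and T: "opPsi r f T \<noteq> 0" and f: "\<And>T. f T \<noteq> 0 \<Longrightarrow> good T"
  obtains "f (T(r := False, Suc r := True)) \<noteq> 0" "T r" "\<not> T (Suc r)" "good T"
    | T' where "f T' \<noteq> 0" "good T" "ht T \<le> ht T'"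
proof (cases r rule: index_cases)
  case (even m)
  then have "T r" "\<not> T (Suc r)" "f (T(r := False, Suc r := True)) \<noteq> 0"
    using T by (auto simp: opPsi_simps slotF_def opF_def split: if_splits)
  then show thesis
    using that(1) good_swap[OF r] f by blast
next
  case (odd m)
  have range: "2 \<le> 2 * m" "2 * m + 3 \<le> n + 1"
    using r odd even_n by (auto elim!: evenE)
  let ?T = "T(2 * m := True, 2 * m + 3 := False)"
  have "opF (2 * m + 1) (2 * m + 2) f T \<noteq> 0 \<or> opE (2 * m) (2 * m + 3) f T \<noteq> 0"
    using T odd by (auto simp: opPsi_simps slotB_def opB_def split: if_splits)
  then consider "T r" "\<not> T (Suc r)" "f (T(r := False, Suc r := True)) \<noteq> 0"
    | "\<not> T (2 * m)" "T (2 * m + 3)" "f ?T \<noteq> 0"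
    using odd by (auto simp: opF_def opE_def split: if_splits)
  then show thesis
  proof cases
    case 1
    then show thesis
      using that(1) good_swap[OF r] f by blast
  next
    case 2
    have sum: "leg_sum g ?T = leg_sum g T - g (2 * m) + g (2 * m + 3)" for g
      using 2 range by (intro leg_sum_move) auto
    have good: "good ?T"
      using f 2 by blast
    then have "2 * m + 3 \<noteq> n + 1"
      using good_last by (metis fun_upd_same)
    then have "good T"
      using range sum[of "\<lambda>_. 1"] by (intro good_cong[OF good]) auto
    then show thesis
      using that(2)[OF 2(3)] sum[of int] by simp
  qed
qed (use r in auto)

text \<open>The only other word that could contribute has height \<open>ht T + 4\<close>, outside
  the support of \<open>f\<close>.\<close>

lemma opPsi_leading:
  assumes r: "r \<in> {2..<n}" and T: "\<not> T r" "T (Suc r)" and f: "\<And>T'. f T' \<noteq> 0 \<Longrightarrow> ht T' \<le> ht T"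
  shows "opPsi r f (T(r := True, Suc r := False)) = f T"
proof -
  let ?T = "T(r := True, Suc r := False)"
  have T': "?T(r := False, Suc r := True) = T"
    using T by (auto simp: fun_eq_iff)
  show ?thesis
  proof (cases r rule: index_cases)
    case (even m)
    then show ?thesis
      using T' by (simp add: opPsi_simps slotF_def opF_def)
  next
    case (odd m)
    have range: "2 \<le> 2 * m" "2 * m + 3 \<le> n + 1"
      using r odd even_n by (auto elim!: evenE)
    have "opE (2 * m) (2 * m + 3) f ?T = 0"
    proof (cases "\<not> ?T (2 * m) \<and> ?T (2 * m + 3)")
      case True
      let ?S = "?T(2 * m := True, 2 * m + 3 := False)"
      have "ht ?S = ht ?T + 3"
        using True range leg_sum_move[of "2 * m" "2 * m + 3" ?T int] by linarith
      moreover have "ht T = ht ?T + int r - int (Suc r)"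
        using leg_sum_swap[OF r, of ?T int] T' by simp
      ultimately have "f ?S = 0"
        using f[of ?S] by fastforce
      then show ?thesis
        by (simp add: opE_def)
    qed (auto simp: opE_def)
    then show ?thesis
      using T' odd by (simp add: opPsi_simps slotB_def opB_def opF_def)
  qed (use r in auto)
qed

lemma hook_word_good: "good hook_word"
  by (simp add: good_def)

lemma phi_mon_support:
  "set rs \<subseteq> {2..<n} \<Longrightarrow> phi (mon rs) T \<noteq> 0 \<Longrightarrow> good T \<and> ht T \<le> ht hook_word + int (length rs)"
proof (induction rs arbitrary: T)
  case Nil
  then show ?case
    by (auto simp: phi_one vac_def hook_word_good split: if_splits)
next
  case (Cons r rs)
  have r: "r \<in> {2..<n}" and nz: "opPsi r (phi (mon rs)) T \<noteq> 0"
    using Cons.prems by (auto simp: phi_gen_mult)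
  show ?case
  proof (rule opPsi_support[OF r nz])
    show "good T'" if "phi (mon rs) T' \<noteq> 0" for T'
      using Cons that by simp
  next
    assume *: "phi (mon rs) (T(r := False, Suc r := True)) \<noteq> 0" "T r" "\<not> T (Suc r)" "good T"
    have "ht (T(r := False, Suc r := True)) \<le> ht hook_word + int (length rs)"
      using Cons.IH[OF _ *(1)] Cons.prems(1) by (metis insert_subset list.simps(15))
    then show ?thesis
      using leg_sum_swap[OF r *(2,3), of int] \<open>good T\<close> by simp
  next
    fix T' assume "phi (mon rs) T' \<noteq> 0" "good T" "ht T \<le> ht T'"
    then show ?thesis
      using Cons.IH[of T'] Cons.prems by simp
  qed
qed

text \<open>Unitriangularity: each step carries the leading word to the next one with coefficient 1,
  and all other contributions stay strictly below the new height.\<close>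

lemma phi_red:
  "red T rs \<Longrightarrow> phi (mon rs) T = 1 \<and> ht T = ht hook_word + int (length rs) \<and>
    (\<forall>T'. phi (mon rs) T' \<noteq> 0 \<longrightarrow> T' = T \<or> ht T' < ht T)"
proof (induction rule: red.induct)
  case red_base
  then show ?case
    by (simp add: phi_one vac_def)
next
  case (red_step T rs r)
  let ?T = "T(r := True, Suc r := False)"
  have T': "?T(r := False, Suc r := True) = T"
    using red_step.hyps by (auto simp: fun_eq_iff)
  have ht: "ht ?T = ht T + 1"
    using leg_sum_swap[OF red_step.hyps(2), of ?T int] T' by simp
  have "opPsi r (phi (mon rs)) ?T = phi (mon rs) T"
    using red_step.hyps(2-4) by (rule opPsi_leading) (use red_step.IH in force)
  then have "phi (mon (r # rs)) ?T = phi (mon rs) T"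
    by (simp add: phi_gen_mult)
  moreover have "S = ?T \<or> ht S < ht ?T" if S: "phi (mon (r # rs)) S \<noteq> 0" for S
  proof (rule opPsi_support[OF red_step.hyps(2)])
    show "opPsi r (phi (mon rs)) S \<noteq> 0"
      using S by (simp add: phi_gen_mult)
    show "good T'" if "phi (mon rs) T' \<noteq> 0" for T'
      using phi_mon_support[OF red_set[OF red_step.hyps(1)] that] by simp
  next
    assume *: "phi (mon rs) (S(r := False, Suc r := True)) \<noteq> 0" "S r" "\<not> S (Suc r)" "good S"
    then have "S(r := False, Suc r := True) = T \<or> ht (S(r := False, Suc r := True)) < ht T"
      using red_step.IH by blast
    moreover have "S = (S(r := False, Suc r := True))(r := True, Suc r := False)"
      using *(2,3) by (auto simp: fun_eq_iff)
    then have "S = ?T" if "S(r := False, Suc r := True) = T"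
      unfolding that .
    ultimately show ?thesis
      using leg_sum_swap[OF red_step.hyps(2) *(2,3), of int] ht by auto
  next
    fix T' assume "phi (mon rs) T' \<noteq> 0" "good S" "ht S \<le> ht T'"
    then have "ht S \<le> ht T"
      using red_step.IH by force
    then show ?thesis
      using ht by simp
  qed
  ultimately have "phi (mon (r # rs)) ?T = 1" "\<forall>S. phi (mon (r # rs)) S \<noteq> 0 \<longrightarrow> S = ?T \<or> ht S < ht ?T"
    using red_step.IH by auto
  moreover have "ht ?T = ht hook_word + int (length (r # rs))"
    using red_step.IH ht by simp
  ultimately show ?case
    by blast
qed

section \<open>Injectivity of the map from the Specht module\<close>

lemma phi_support:
  assumes "p \<in> A" "phi p T \<noteq> 0"
  shows "good T"
proof -
  obtain k where "p \<in> U k"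
    using generated assms(1) by blast
  then have "phi p T \<noteq> 0 \<longrightarrow> good T"
    unfolding U_def
  proof (induction rule: fa.span_induct_alt)
    case base
    then show ?case by (simp add: phi_zero)
  next
    case (step c x y)
    then show ?case
      using phi_J phi_mon_support by (auto simp: phi_add phi_scalar_mult)
  qed
  then show ?thesis
    using assms by simp
qed

text \<open>Reduced words of the greatest length have distinct leading words, so their coefficients
  can be read off from \<open>phi p\<close>. If \<open>phi p\<close> vanishes, all of them are zero
  and the bound on the length drops.\<close>

lemma kernel_Rspan: "p \<in> Rspan k \<Longrightarrow> (\<And>T. phi p T = 0) \<Longrightarrow> p \<in> J"
proof (induction k arbitrary: p)
  case 0
  have "Rspan 0 \<subseteq> J"
    unfolding Rspan_def by (rule fa.span_minimal) (auto simp: fa.subspace_def J_zero J_add J_scale)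
  then show ?case
    using 0 by blast
next
  case (Suc k)
  let ?W = "{T. \<exists>rs. red T rs \<and> length rs = k}"
  define w where "w T = (SOME rs. red T rs \<and> length rs = k)" for T
  have w: "red T (w T)" "length (w T) = k" if "T \<in> ?W" for T
    using that someI_ex[of "\<lambda>rs. red T rs \<and> length rs = k"] by (auto simp: w_def)
  \<comment> \<open>\<open>T\<close> is recovered from \<open>rs\<close> as the word of greatest
    height in the support of \<open>phi (mon rs)\<close>.\<close>
  have red_fun: "T = T'" if "red T rs" "red T' rs" for T T' rs
    using phi_red[OF that(1)] phi_red[OF that(2)] by (metis less_asym' zero_neq_one)
  have fin: "finite ?W"
  proof (rule inj_on_finite)
    show "inj_on w ?W"
    proof (rule inj_onI)
      fix S T assume "S \<in> ?W" "T \<in> ?W" "w S = w T"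
      then show "S = T"
        using red_fun[OF w(1)[of S]] w(1)[of T] by simp
    qed
    show "w ` ?W \<subseteq> {rs. set rs \<subseteq> {2..<n} \<and> length rs = k}"
      using w red_set by blast
    show "finite {rs. set rs \<subseteq> {2..<n} \<and> length rs = k}"
      by (rule finite_lists_length_eq) simp
  qed
  \<comment> \<open>A linear map that removes the components of length \<open>k\<close>. It sends
    \<open>Rspan (Suc k)\<close> into \<open>Rspan k\<close> and fixes the elements killed by
    \<open>phi\<close>.\<close>
  define D where "D p = p - (\<Sum>T \<in> ?W. scalar (phi p T) * mon (w T))" for p
  have D_id: "D p = p" if "\<And>T. T \<in> ?W \<Longrightarrow> phi p T = 0" for p
    using that by (simp add: D_def scalar_def)
  have "D p \<in> Rspan k"
    using Suc.prems(1) unfolding Rspan_def[of "Suc k"]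
  proof (induction rule: fa.span_induct_alt)
    case base
    then show ?case
      using D_id[of 0] J_Rspan[OF J_zero] by (simp add: phi_zero)
  next
    case (step c x y)
    have "(\<Sum>T \<in> ?W. scalar (phi (scalar c * x + y) T) * mon (w T)) =
        scalar c * (\<Sum>T \<in> ?W. scalar (phi x T) * mon (w T)) + (\<Sum>T \<in> ?W. scalar (phi y T) * mon (w T))"
      unfolding sum_distrib_left sum.distrib[symmetric]
      by (intro sum.cong refl)
         (simp only: phi_add phi_scalar_mult scalar_add scalar_mult distrib_right mult.assoc)
    then have "D (scalar c * x + y) = scalar c * D x + D y"
      by (simp only: D_def right_diff_distrib add_diff_add)
    moreover have "D x \<in> Rspan k"
    proof -
      consider "x \<in> J" | T rs where "red T rs" "length rs < k" "x = mon rs"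
        | T rs where "red T rs" "length rs = k" "x = mon rs"
        using step.hyps(1) by (blast dest: less_SucE)
      then show ?thesis
      proof cases
        case 1
        then show ?thesis
          using D_id[of x] phi_J J_Rspan by simp
      next
        case (2 T rs)
        have "phi x S = 0" if "S \<in> ?W" for S
        proof -
          have "ht S = ht hook_word + int k"
            using that phi_red[of S] by auto
          then show ?thesis
            using phi_mon_support[OF red_set[OF 2(1)], of S] 2(2,3) by fastforce
        qed
        then show ?thesis
          using D_id[of x] red_Rspan 2 by simp
      next
        case (3 T rs)
        have T: "T \<in> ?W"
          using 3 by blast
        have "phi x S = (if S = T then 1 else 0)" if "S \<in> ?W" for S
        proof -
          have "ht S = ht T"
            using that phi_red[of S] phi_red[OF 3(1)] 3(2) by auto
          then show ?thesis
            using phi_red[OF 3(1)] 3(3) by (cases "S = T") auto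
        qed
        then have "(\<Sum>S \<in> ?W. scalar (phi x S) * mon (w S)) = (\<Sum>S \<in> ?W. if S = T then mon (w S) else 0)"
          by (intro sum.cong) (auto simp: scalar_one scalar_def)
        also have "\<dots> = mon (w T)"
          using fin T by simp
        finally have "D x = mon rs - mon (w T)"
          by (simp add: D_def 3)
        then show ?thesis
          using red_unique[OF 3(1) w(1)[OF T]] 3(2) U_subset_Rspan by auto
      qed
    qed
    ultimately show ?case
      using step.IH unfolding Rspan_def by (simp add: fa.span_add fa.span_scale)
  qed
  then have "p \<in> Rspan k"
    using D_id[of p] Suc.prems(2) by simp
  then show ?case
    using Suc by blast
qed

lemma kernel: "p \<in> A \<Longrightarrow> (\<And>T. phi p T = 0) \<Longrightarrow> p \<in> J"
  using generated U_subset_Rspan kernel_Rspan by blast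

lemma one_notin_J: "1 \<notin> J"
  using phi_J[of 1 hook_word] by (auto simp: phi_one vac_def)

section \<open>Endomorphisms of the Specht module\<close>


lemma hook_res_seq_mem: "hook_res_seq a b \<in> res_seqs n"
  using word_res_mem[of n hook_word] by (simp add: word_res_hook_word)

text \<open>The residues determine the purity of every slot but the last, which contains the
  position n + 1. For that one, the total number of legs supplies the missing parity.\<close>

lemma good_pure:
  assumes "good T" "word_res n T = hook_res_seq a b" "m \<noteq> 0" "2 * m \<le> n"
  shows "T (2 * m) = T (2 * m + 1)"
proof (cases "2 * m = n")
  case False
  then have "word_res n hook_word (2 * m) \<noteq> word_res n hook_word (2 * m + 1)"
    using word_res_even_odd[of m n hook_word] hook_word_pure assms by simp
  then show ?thesis
    using word_res_even_odd[of m n T] assms False by (simp add: word_res_hook_word)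
next
  case True
  have parity: "sg S (Suc m) \<longleftrightarrow> odd (leg_sum (\<lambda>_. 1) S)" for S
    using sg_parity[of S m] True by (simp add: leg_sum_def)
  have "leg_sum (\<lambda>_. 1) T = leg_sum (\<lambda>_. 1) hook_word"
    using assms(1) by (simp add: good_def)
  then have "sg T (Suc m) = sg hook_word (Suc m)"
    unfolding parity by simp
  moreover have "sg T m = sg hook_word m"
  proof -
    have "word_res n T n = word_res n hook_word n"
      using assms(2) word_res_hook_word by simp
    then show ?thesis
      using True assms(3) even_n by (auto simp: word_res_def split: if_splits)
  qed
  ultimately show ?thesis
    using assms(3) hook_word_pure[of m] by auto
qed

text \<open>For pure words \<open>\<psi>\<^bsub>2m+1\<^esub>\<close> contracts the slots \<open>m\<close> and \<open>m + 1\<close> with the symplectic form, so it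
  kills \<open>f\<close> only if \<open>f\<close> is symmetric in these two slots. As the last slot always holds \<open>AA\<close>, an
  \<open>LL\<close> right of the slot \<open>b div 2\<close> could be moved there.\<close>

lemma leg_left:
  assumes f: "\<And>T. f T \<noteq> 0 \<Longrightarrow> good T \<and> word_res n T = hook_res_seq a b"
    and psi: "\<And>r T. r \<in> {2..<n} \<Longrightarrow> r \<noteq> b + 1 \<Longrightarrow> opPsi r f T = 0"
  shows "2 * m \<le> n \<Longrightarrow> b < 2 * m \<Longrightarrow> \<not> T (2 * m) \<Longrightarrow> f T = 0"
proof (induction "n - 2 * m" arbitrary: m T rule: less_induct)
  case less
  show ?case
  proof (rule ccontr)
    assume nz: "f T \<noteq> 0"
    have m: "m \<noteq> 0"
      using less.prems by auto
    have T: "\<not> T (2 * m + 1)"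
      using good_pure[of T m] f[OF nz] m less.prems by simp
    have "2 * m \<noteq> n"
      using T good_last f[OF nz] by metis
    then have less_n: "2 * (m + 1) \<le> n"
      using less.prems even_n by (auto elim!: evenE)
    have IH: "f S = 0" if "\<not> S (2 * m + 2)" for S
      using less.hyps[of "m + 1" S] less_n less.prems that by simp
    have T2: "T (2 * m + 2)"
      using nz IH by blast
    have T3: "T (2 * m + 3)"
      using good_pure[of T "m + 1"] f[OF nz] less_n T2 by (simp add: numeral_3_eq_3)
    \<comment> \<open>The target word \<open>LALA\<close>: the value of psi_{2m+1} f there is the
      coefficient of \<open>LLAA\<close>, which is \<open>T\<close>, minus that of
      \<open>AALL\<close>, which vanishes by induction.\<close>
    let ?T = "T(2 * m + 1 := True, 2 * m + 2 := False)"
    have "(2 * m + 1) \<noteq> b + 1"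
      using less.prems by simp
    then have "opPsi (2 * m + 1) f ?T = 0"
      using less_n m by (intro psi) auto
    then have "opB (2 * m) (2 * m + 1) (2 * m + 2) (2 * m + 3) f ?T = 0"
      using m by (simp add: opPsi_simps slotB_def)
    moreover have "?T(2 * m + 1 := False, 2 * m + 2 := True) = T"
      using T T2 by (auto simp: fun_eq_iff)
    moreover have "f (?T(2 * m := True, 2 * m + 3 := False)) = 0"
      by (rule IH) simp
    ultimately show False
      using nz less.prems T3 by (simp add: opB_def opE_def opF_def)
  qed
qed

text \<open>All legs lie among the positions up to b + 1, and their number forces them to fill these
  positions.\<close>

lemma good_leg_left:
  assumes "good T" "\<And>j. j \<in> {b + 2..n} \<Longrightarrow> T j"
  shows "T = hook_word"
proof (rule ccontr)
  assume "T \<noteq> hook_word"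
  then obtain j where j: "T j \<noteq> hook_word j"
    by (auto simp: fun_eq_iff)
  then have jn: "j \<in> {2..n}"
    using assms(1) by (auto simp: good_def)
  have le: "(if T k then 0 else 1) \<le> (if hook_word k then 0 else 1 :: int)" if "k \<in> {2..n + 1}" for k
    using assms(2)[of k] good_last[OF assms(1)] that by (cases "k = n + 1") (auto simp: hook_word_def)
  have "leg_sum (\<lambda>_. 1) T < leg_sum (\<lambda>_. 1) hook_word"
    unfolding leg_sum_def
  proof (rule sum_strict_mono_ex1)
    have "(if T j then 0 else 1) < (if hook_word j then 0 else 1 :: int)"
      using j jn le[of j] by (auto split: if_splits)
    then show "\<exists>k \<in> {2..n + 1}. (if T k then 0 else 1) < (if hook_word k then 0 else 1 :: int)"
      using jn by (intro bexI[of _ j]) auto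
  qed (use le in auto)
  then show False
    using assms(1) by (simp add: good_def)
qed

text \<open>The relation for e(i_lambda) leaves only pure words in \<open>phi p\<close>, and those
  for psi_j push all legs to the left, so \<open>phi p\<close> is a multiple of \<open>vac\<close>.
  The scalar is its coefficient at \<open>hook_word\<close>, and \<open>kernel\<close> carries the
  equation back to the Specht module.\<close>

lemma annihilated_scalar:
  assumes p: "p \<in> A" and s: "\<And>s. s \<in> specht_rels a b \<Longrightarrow> s * p \<in> J"
  shows "\<exists>c. p - scalar c \<in> J"
proof -
  have "e_el (hook_res_seq a b) - 1 \<in> specht_rels a b"
    using specht_relI(2)[OF hook_res_seq_mem] by simp
  then have "(e_el (hook_res_seq a b) - 1) * p \<in> J"
    by (rule s)
  then have "opR n (hook_res_seq a b) (phi p) T = phi p T" for T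
    using phi_J[of "(e_el (hook_res_seq a b) - 1) * p" T]
    by (simp add: left_diff_distrib phi_diff phi_gen_mult)
  then have f: "good T \<and> word_res n T = hook_res_seq a b" if "phi p T \<noteq> 0" for T
    using that phi_support[OF p] by (metis opR_def)
  have psi: "opPsi r (phi p) T = 0" if "r \<in> {2..<n}" "r \<noteq> b + 1" for r T
    using phi_J[OF s[OF specht_relI(3)], of r T] that by (simp add: phi_gen_mult)
  have "T = hook_word" if nz: "phi p T \<noteq> 0" for T
  proof (rule good_leg_left)
    show "good T"
      using f[OF nz] by blast
    fix j assume j: "j \<in> {b + 2..n}"
    show "T j"
    proof (cases "even j")
      case True
      then have "j = 2 * (j div 2)" by simp
      then show ?thesis
        using leg_left[of "phi p" "j div 2" T, OF f psi] j nz by auto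
    next
      case False
      then have "j = 2 * (j div 2) + 1" by simp
      moreover have "2 * (j div 2) \<le> n" "b < 2 * (j div 2)"
        using j False even_b by (simp; presburger)+
      then have "T (2 * (j div 2))"
        using leg_left[of "phi p" "j div 2" T, OF f psi] nz by blast
      ultimately show ?thesis
        using good_pure[of T "j div 2"] f[OF nz] j by auto
    qed
  qed
  then have "phi (p - scalar (phi p hook_word)) T = 0" for T
    by (cases "T = hook_word") (auto simp: phi_diff phi_scalar vac_def)
  then have "p - scalar (phi p hook_word) \<in> J"
    using p by (intro kernel) auto
  then show ?thesis
    by blast
qed

lemma specht_hook_End:
  "one_dimensional (End_space (klr_scalar n) (klr_algebra n) (specht_hook a b ::
    ((klr_gen, 'f) free_alg set, (klr_gen, 'f) free_alg set set) module))"
  and specht_hook_indecomposable: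
  "indecomposable_module (klr_algebra n) (specht_hook a b ::
    ((klr_gen, 'f) free_alg set, (klr_gen, 'f) free_alg set set) module)"
  using End_and_indecomposable[OF one_notin_J annihilated_scalar]
  by (simp_all add: specht_hook_def n_eq)

end

theorem theorem4p2:
  fixes a b n :: nat
    and S :: "((klr_gen, 'f::field) free_alg set, (klr_gen, 'f) free_alg set set) module"
  assumes "even a" "a > 0" "even b" "b > 0"
    and "n = a + b"
    and "S = specht_hook a b"
  shows "one_dimensional (End_space (klr_scalar n) (klr_algebra n) S)
       \<and> indecomposable_module (klr_algebra n) S
       \<and> (\<forall>\<theta> \<in> bk_isos n.
            one_dimensional (End_space (iwahori_hecke_scalar (-1) n) (iwahori_hecke (-1) n)
              (pullback_module \<theta> S))
          \<and> indecomposable_module (iwahori_hecke (-1) n) (pullback_module \<theta> S))"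
proof -
  interpret even_hook a b n "TYPE('f)"
    by unfold_locales (use assms in auto)
  have klr: "one_dimensional (End_space (klr_scalar n) (klr_algebra n) S)"
    "indecomposable_module (klr_algebra n) S"
    unfolding assms(6) by (rule specht_hook_End specht_hook_indecomposable)+
  have "one_dimensional (End_space (iwahori_hecke_scalar (-1) n) (iwahori_hecke (-1) n) (pullback_module \<theta> S))
      \<and> indecomposable_module (iwahori_hecke (-1) n) (pullback_module \<theta> S)" if "\<theta> \<in> bk_isos n" for \<theta>
  proof -
    have carrier: "\<theta> ` carrier (iwahori_hecke (-1) n) = carrier (klr_algebra n)"
      using that by (auto simp: bk_isos_def ring_iso_def bij_betw_def)
    have scalar: "\<theta> (iwahori_hecke_scalar (-1) n c) = klr_scalar n c" for c
      using that by (simp add: bk_isos_def)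
    show ?thesis
      using klr unfolding End_space_pullback[OF carrier scalar] indecomposable_module_pullback[OF carrier]
      by blast
  qed
  then show ?thesis
    using klr by blast
qed

end
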